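(* Let $N\geq 3$, $0<s<1$, $2_s^*=\frac{2N}{N-2s}$, $2^*=\frac{2N}{N-2}$, and let $f:\mathbb{R}\to\mathbb{R}$ be such that there exists $C>0$ with $$|f(t)t|\leq C\left(|t|^{2_s^*}+|t|^{2^*}\right)\quad\text{for every }t\in\mathbb{R}.$$ Then every non-negative solution of $$-\Delta u+(-\Delta)^su=f(u),\qquad x\in\mathbb{R}^N,$$ belongs to $L^\infty(\mathbb{R}^N)$.
   Context: $X$ is the completion of $C_0^\infty(\mathbb{R}^N)$ with respect to $$\|u\|_X^2=\int_{\mathbb{R}^N}|\nabla u|^2\,dx+\int_{\mathbb{R}^N}\int_{\mathbb{R}^N}\frac{|u(x)-u(y)|^2}{|x-y|^{N+2s}}\,dx\,dy,$$ regarded as a space of real-valued functions (it embeds continuously in $L^{2_s^*}(\mathbb{R}^N)$ and in $L^{2^*}(\mathbb{R}^N)$). A solution is a function $u\in X$ such that for every $\phi\in X$ $$\int_{\mathbb{R}^N}\nabla u\cdot\nabla\phi\,dx+\int_{\mathbb{R}^N}\int_{\mathbb{R}^N}\frac{(u(x)-u(y))(\phi(x)-\phi(y))}{|x-y|^{N+2s}}\,dx\,dy=\int_{\mathbb{R}^N}f(u)\phi\,dx,$$ where the right-hand integral is understood to be well defined (the normalizing constant of $(-\Delta)^s$ is dropped in the weak formulation). *)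

theory Defs
  imports "HOL-Analysis.Analysis"
begin

(* The exponent 2N/(N-2s), which is 2_s^* for 0 < s < 1 and 2^* for s = 1. *)
definition crit_exp :: "nat \<Rightarrow> real \<Rightarrow> real" where
  "crit_exp N s = 2 * real N / (real N - 2 * s)"

primrec Ck :: "nat \<Rightarrow> ('a::euclidean_space \<Rightarrow> real) \<Rightarrow> bool" where
  "Ck 0 f \<longleftrightarrow> continuous_on UNIV f"
| "Ck (Suc k) f \<longleftrightarrow> (\<forall>x. f differentiable (at x)) \<and>
     (\<forall>b\<in>Basis. Ck k (\<lambda>x. frechet_derivative f (at x) b))"

definition test_fun :: "('a::euclidean_space \<Rightarrow> real) \<Rightarrow> bool" where
  "test_fun \<phi> \<longleftrightarrow> (\<forall>k. Ck k \<phi>) \<and> compact (closure (support_on UNIV \<phi>))"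

definition grad :: "('a::euclidean_space \<Rightarrow> real) \<Rightarrow> 'a \<Rightarrow> 'a" where
  "grad \<phi> x = (\<Sum>b\<in>Basis. frechet_derivative \<phi> (at x) b *\<^sub>R b)"

(* The squared norm, for differentiable functions; on the diagonal x = y the
   quotient is 0 / 0 = 0, which affects only a null set. *)
definition X_norm_sq :: "real \<Rightarrow> ('a::euclidean_space \<Rightarrow> real) \<Rightarrow> ennreal" where
  "X_norm_sq s \<phi> =
     (\<integral>\<^sup>+ x. ennreal ((norm (grad \<phi> x))\<^sup>2) \<partial>lebesgue) +
     (\<integral>\<^sup>+ x. \<integral>\<^sup>+ y. ennreal (\<bar>\<phi> x - \<phi> y\<bar>\<^sup>2 / norm (x - y) powr (real DIM('a) + 2 * s))
        \<partial>lebesgue \<partial>lebesgue)"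

(* The completion of the test functions, realised as functions: a Cauchy sequence of
   test functions is identified with its limit in L^{2^*}, where 2^* = crit_exp N 1.
   As X embeds in this space, every element of the completion has a unique such limit
   (up to null sets) and is determined by it. *)
definition X_space :: "real \<Rightarrow> ('a::euclidean_space \<Rightarrow> real) set" where
  "X_space s = {u. u \<in> borel_measurable lebesgue \<and>
     (\<exists>\<phi>. (\<forall>n::nat. test_fun (\<phi> n)) \<and>
        (\<forall>e>0. \<exists>M. \<forall>m\<ge>M. \<forall>n\<ge>M. X_norm_sq s (\<lambda>x. \<phi> m x - \<phi> n x) < ennreal e) \<and>
        (\<lambda>n. \<integral>\<^sup>+ x. ennreal (\<bar>\<phi> n x - u x\<bar> powr crit_exp DIM('a) 1) \<partial>lebesgue)
          \<longlonglongrightarrow> 0)}"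

definition locally_integrable :: "('a::euclidean_space \<Rightarrow> 'b::euclidean_space) \<Rightarrow> bool" where
  "locally_integrable g \<longleftrightarrow> (\<forall>K. compact K \<longrightarrow> set_integrable lebesgue K g)"

definition has_weak_grad :: "('a::euclidean_space \<Rightarrow> real) \<Rightarrow> ('a \<Rightarrow> 'a) \<Rightarrow> bool" where
  "has_weak_grad u G \<longleftrightarrow> locally_integrable u \<and> locally_integrable G \<and>
     (\<forall>\<phi>. test_fun \<phi> \<longrightarrow>
        (LINT x|lebesgue. u x *\<^sub>R grad \<phi> x) = - (LINT x|lebesgue. \<phi> x *\<^sub>R G x))"

(* A weak gradient is unique only up to null sets; this picks a representative. *)
definition weak_grad :: "('a::euclidean_space \<Rightarrow> real) \<Rightarrow> 'a \<Rightarrow> 'a" where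
  "weak_grad u = (SOME G. has_weak_grad u G)"

definition gagliardo_form ::
    "real \<Rightarrow> ('a::euclidean_space \<Rightarrow> real) \<Rightarrow> ('a \<Rightarrow> real) \<Rightarrow> real" where
  "gagliardo_form s u \<phi> =
     (LINT z|(lebesgue \<Otimes>\<^sub>M lebesgue).
        (case z of (x, y) \<Rightarrow>
          (u x - u y) * (\<phi> x - \<phi> y) / norm (x - y) powr (real DIM('a) + 2 * s)))"

(* Integrability of f(u) \<phi> is part of the notion of solution, since f is not
   assumed measurable and f 0 is unconstrained by the growth condition. On the left-hand
   side both integrands are integrable for all u, \<phi> in X by the Cauchy-Schwarz inequality. *)
definition is_solution ::
    "real \<Rightarrow> (real \<Rightarrow> real) \<Rightarrow> ('a::euclidean_space \<Rightarrow> real) \<Rightarrow> bool" where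
  "is_solution s f u \<longleftrightarrow> u \<in> X_space s \<and>
     (\<forall>\<phi>\<in>X_space s. integrable lebesgue (\<lambda>x. f (u x) * \<phi> x) \<and>
        (LINT x|lebesgue. weak_grad u x \<bullet> weak_grad \<phi> x) + gagliardo_form s u \<phi>
          = (LINT x|lebesgue. f (u x) * \<phi> x))"

definition L_infinity :: "('a::euclidean_space \<Rightarrow> real) set" where
  "L_infinity = {u. u \<in> borel_measurable lebesgue \<and> (\<exists>M. AE x in lebesgue. \<bar>u x\<bar> \<le> M)}"

end

theory Submission
  imports Defs
begin

text \<open>The idea is De Giorgi's truncation method. Let \<open>n\<close> be the dimension and \<open>p = 2 * n / (n - 2)\<close> the critical
  exponent. The equation is tested with a truncation \<open>h (u)\<close> that vanishes where \<open>u \<le> b\<close>, for a level \<open>b > 1\<close>.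
  The nonlocal term is nonnegative because \<open>h\<close> is monotone, and above level \<open>1\<close> the growth condition
  reads \<open>\<bar>f t * t\<bar> \<le> 2 * C * t powr p\<close>. With the Sobolev inequality this gives, for levels
  \<open>1 \<le> a < b < c\<close> and \<open>Y a = \<integral> (max 0 (u - a)) powr p\<close>, the estimate
  \<open>Y c ^ (n - 2) \<le> const * (b / (b - a)) powr (n * p) * Y a ^ n\<close> (lemma \<open>level_excess_step\<close>).
  It is superlinear although the growth is critical, and \<open>Y M\<close> is as small as desired for
  large \<open>M\<close>, since \<open>u\<close> is approximated by bounded functions. Iterating along levels
  that increase from \<open>M\<close> to \<open>2 * M\<close> yields \<open>Y (2 * M) = 0\<close>, that is, \<open>u \<le> 2 * M\<close> almost everywhere
  (lemma \<open>solution_bounded_above\<close>). Only the local part of the energy and the embedding into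
  \<open>L\<^sup>p\<close> enter this argument; the nonlocal part matters only for \<open>h (u)\<close> to be an admissible test function.

  All truncations are smooth, so that compositions of test functions with them are again test
  functions and no mollification is needed. That \<open>h (u)\<close> lies in the energy space and satisfies the
  chain rule (lemma \<open>X_space_compose\<close>) follows by dominated convergence along a subsequence of
  test functions whose gradients and Gagliardo quotients are dominated by square-integrable
  functions. For this, test functions must have finite Gagliardo seminorm, and weak gradients must
  be unique, which is the fundamental lemma of the calculus of variations. The Sobolev inequality
  is proved by Gagliardo's method (lemma \<open>marginal_gagliardo\<close>). All inequalities between integrals are
  stated without roots, so that only natural powers of extended reals occur.\<close>

section \<open>Functions of class C k and smooth functions of one variable\<close>

lemma Ck_Suc_D: "Ck (Suc k) f \<Longrightarrow> Ck k f"
proof (induction k arbitrary: f)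
  case 0
  then show ?case
    by (auto intro!: continuous_at_imp_continuous_on differentiable_imp_continuous_within)
next
  case (Suc k)
  then show ?case by (metis Ck.simps(2))
qed

lemma frechet_derivative_eqI:
  "(f has_derivative f') (at x) \<Longrightarrow> frechet_derivative f (at x) = f'"
  by (metis frechet_derivative_at)

lemma has_frechet_derivative:
  "f differentiable (at x) \<Longrightarrow> (f has_derivative frechet_derivative f (at x)) (at x)"
  by (simp add: frechet_derivative_works[symmetric])

lemma Ck_const: "Ck k (\<lambda>x. c)"
proof (induction k arbitrary: c)
  case (Suc k)
  then show ?case by (simp add: frechet_derivative_const)
qed simp

lemma Ck_add: "Ck k f \<Longrightarrow> Ck k g \<Longrightarrow> Ck k (\<lambda>x. f x + g x)"
proof (induction k arbitrary: f g)
  case 0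
  then show ?case by (simp add: continuous_on_add)
next
  case (Suc k)
  have D: "((\<lambda>x. f x + g x) has_derivative
      (\<lambda>h. frechet_derivative f (at x) h + frechet_derivative g (at x) h)) (at x)" for x
    using Suc.prems by (intro has_derivative_add) (simp_all add: has_frechet_derivative)
  then have "frechet_derivative (\<lambda>x. f x + g x) (at x) b =
     frechet_derivative f (at x) b + frechet_derivative g (at x) b" for x b
    by (simp add: frechet_derivative_eqI[OF D])
  moreover have "(\<lambda>x. f x + g x) differentiable at x" for x
    using D unfolding differentiable_def by blast
  ultimately show ?case using Suc.prems by (simp add: Suc.IH)
qed

lemma Ck_mult: "Ck k f \<Longrightarrow> Ck k g \<Longrightarrow> Ck k (\<lambda>x. f x * g x)"
proof (induction k arbitrary: f g)
  case 0
  then show ?case by (simp add: continuous_on_mult)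
next
  case (Suc k)
  have "((\<lambda>x. f x * g x) has_derivative
      (\<lambda>h. f x * frechet_derivative g (at x) h + frechet_derivative f (at x) h * g x)) (at x)" for x
    using Suc.prems by (intro has_derivative_mult) (simp_all add: has_frechet_derivative)
  note D = this
  then have "frechet_derivative (\<lambda>x. f x * g x) (at x) b =
     f x * frechet_derivative g (at x) b + frechet_derivative f (at x) b * g x" for x b
    by (simp add: frechet_derivative_eqI[OF D])
  moreover have "(\<lambda>x. f x * g x) differentiable at x" for x
    using D unfolding differentiable_def by blast
  ultimately show ?case
    using Suc.prems Ck_Suc_D[OF Suc.prems(1)] Ck_Suc_D[OF Suc.prems(2)]
    by (simp add: Ck_add Suc.IH)
qed

lemma Ck_prod: "finite I \<Longrightarrow> (\<And>i. i \<in> I \<Longrightarrow> Ck k (f i)) \<Longrightarrow> Ck k (\<lambda>x. \<Prod>i\<in>I. f i x)"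
  by (induction I rule: finite_induct) (auto simp: Ck_const Ck_mult)

text \<open>Smoothness of a function of one real variable, encoded by the existence of the whole sequence
  of its derivatives, the first of them being the function itself.\<close>

definition smooth_real :: "(real \<Rightarrow> real) \<Rightarrow> bool" where
  "smooth_real g \<longleftrightarrow> (\<exists>D. D 0 = g \<and> (\<forall>k t. (D k has_real_derivative D (Suc k) t) (at t)))"

lemma Ck_compose:
  assumes "\<And>j t. (D j has_real_derivative D (Suc j) t) (at t)" "Ck k \<phi>"
  shows "Ck k (\<lambda>x. D j (\<phi> x))"
  using assms(2)
proof (induction k arbitrary: j \<phi>)
  case 0
  have "continuous_on UNIV (D j)"
    using assms(1) by (meson DERIV_continuous_on has_field_derivative_at_within)
  then have "continuous_on UNIV (\<lambda>x. D j (\<phi> x))"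
    by (rule continuous_on_compose2) (use 0 in auto)
  then show ?case by simp
next
  case (Suc k)
  have D: "((\<lambda>x. D j (\<phi> x)) has_derivative
      (\<lambda>h. D (Suc j) (\<phi> x) * frechet_derivative \<phi> (at x) h)) (at x)" for x
  proof -
    have "(\<phi> has_derivative frechet_derivative \<phi> (at x)) (at x)"
      using Suc.prems by (intro has_frechet_derivative) simp
    moreover have "(D j has_derivative (*) (D (Suc j) (\<phi> x))) (at (\<phi> x))"
      using assms(1) by (simp add: has_field_derivative_def)
    ultimately show ?thesis by (rule has_derivative_compose)
  qed
  then have "frechet_derivative (\<lambda>x. D j (\<phi> x)) (at x) b =
     D (Suc j) (\<phi> x) * frechet_derivative \<phi> (at x) b" for x b
    by (simp add: frechet_derivative_eqI[OF D])
  moreover have "(\<lambda>x. D j (\<phi> x)) differentiable at x" for x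
    using D unfolding differentiable_def by blast
  ultimately show ?case
    using Suc.prems Ck_Suc_D[OF Suc.prems(1)] by (simp add: Ck_mult Suc.IH)
qed

lemma Ck_smooth_compose:
  assumes "smooth_real g" "Ck k \<phi>"
  shows "Ck k (\<lambda>x. g (\<phi> x))"
proof -
  obtain D where D: "D 0 = g" "\<And>k t. (D k has_real_derivative D (Suc k) t) (at t)"
    using assms(1) unfolding smooth_real_def by blast
  show ?thesis using Ck_compose[of D k \<phi> 0] D assms(2) by simp
qed

lemma Ck_inner: "Ck k (\<lambda>x. x \<bullet> b)"
proof (cases k)
  case 0
  then show ?thesis by (simp add: continuous_on_inner)
next
  case (Suc m)
  have D: "((\<lambda>x. x \<bullet> b) has_derivative (\<lambda>h. h \<bullet> b)) (at x)" for x :: 'a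
    by (auto intro!: derivative_eq_intros)
  then have "frechet_derivative (\<lambda>x. x \<bullet> b) (at x) c = c \<bullet> b" for x c :: 'a
    by (simp add: frechet_derivative_eqI[OF D])
  moreover have "(\<lambda>x. x \<bullet> b) differentiable at x" for x :: 'a
    using D unfolding differentiable_def by blast
  ultimately show ?thesis by (simp add: Suc Ck_const)
qed

lemma smooth_realI:
  assumes "\<And>t. (D (0::nat) t :: real) = g t" "\<And>k t. (D k has_real_derivative D (Suc k) t) (at t)"
  shows "smooth_real g"
  unfolding smooth_real_def using assms by (intro exI[of _ D]) auto

lemma smooth_real_affine: 
  assumes "smooth_real g" shows "smooth_real (\<lambda>t. g (m * t + c))"
proof -
  obtain D where D: "D 0 = g" "\<And>k t. (D k has_real_derivative D (Suc k) t) (at t)"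
    using assms(1) unfolding smooth_real_def by blast
  show ?thesis
  proof (rule smooth_realI[where D="\<lambda>k t. m ^ k * D k (m * t + c)"])
    show "((\<lambda>t. m ^ k * D k (m * t + c)) has_real_derivative m ^ Suc k * D (Suc k) (m * t + c)) (at t)" for k t
      by (rule derivative_eq_intros DERIV_chain2[OF D(2)] refl | simp)+
  qed (simp add: D)
qed

lemma smooth_real_cmult:
  assumes "smooth_real g" shows "smooth_real (\<lambda>t. m * g t)"
proof -
  obtain D where D: "D 0 = g" "\<And>k t. (D k has_real_derivative D (Suc k) t) (at t)"
    using assms(1) unfolding smooth_real_def by blast
  show ?thesis
    by (rule smooth_realI[where D="\<lambda>k t. m * D k t"])
       (auto simp: D intro: DERIV_cmult)
qed

lemma smooth_real_mult_id:
  assumes "smooth_real g" shows "smooth_real (\<lambda>t. t * g t)"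
proof -
  obtain D where D: "D 0 = g" "\<And>k t. (D k has_real_derivative D (Suc k) t) (at t)"
    using assms(1) unfolding smooth_real_def by blast
  show ?thesis
  proof (rule smooth_realI[where D="\<lambda>k t. t * D k t + (case k of 0 \<Rightarrow> 0 | Suc j \<Rightarrow> real k * D j t)"])
    show "((\<lambda>t. t * D k t + (case k of 0 \<Rightarrow> 0 | Suc j \<Rightarrow> real k * D j t)) has_real_derivative
      t * D (Suc k) t + (case Suc k of 0 \<Rightarrow> 0 | Suc j \<Rightarrow> real (Suc k) * D j t)) (at t)" for k t
      by (cases k) (auto intro!: derivative_eq_intros D(2) simp: algebra_simps)
  qed (simp add: D)
qed

text \<open>The function \<open>P (1/t) * exp (-1/t)\<close> for \<open>t > 0\<close>, extended by zero, with a polynomial \<open>P\<close>. This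
  class is closed under differentiation, so its members are smooth across \<open>0\<close>. The case \<open>P = 1\<close>
  takes values in the unit interval and is the only source of cut-off functions below.\<close>

definition exp_inv :: "real poly \<Rightarrow> real \<Rightarrow> real" where
  "exp_inv P t = (if t > 0 then poly P (1 / t) * exp (- 1 / t) else 0)"

lemma poly_exp_decay: "((\<lambda>y::real. poly P y * exp (- y)) \<longlongrightarrow> 0) at_top"
proof -
  have "((\<lambda>y::real. y ^ i * exp (- y)) \<longlongrightarrow> 0) at_top" for i
    using tendsto_power_div_exp_0[of i] by (simp add: exp_minus divide_inverse)
  then have "((\<lambda>y::real. \<Sum>i\<le>degree P. coeff P i * (y ^ i * exp (- y))) \<longlongrightarrow> (\<Sum>i\<le>degree P. coeff P i * 0)) at_top"
    by (intro tendsto_sum tendsto_mult tendsto_const)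
  moreover have "(\<Sum>i\<le>degree P. coeff P i * (y ^ i * exp (- y))) = poly P y * exp (- y)" for y
    unfolding poly_altdef sum_distrib_right by (simp add: mult.assoc)
  ultimately show ?thesis by simp
qed

lemma exp_inv_DERIV:
  "(exp_inv P has_real_derivative exp_inv ([:0,0,1:] * (P - pderiv P)) t) (at t)"
proof -
  consider "t > 0" | "t < 0" | "t = 0" by linarith
  then show ?thesis
  proof cases
    case 1
    have "((\<lambda>t. poly P (1 / t) * exp (- 1 / t)) has_real_derivative
         exp_inv ([:0,0,1:] * (P - pderiv P)) t) (at t)"
      using 1 by (auto intro!: derivative_eq_intros poly_DERIV[THEN DERIV_chain2] 
         simp: exp_inv_def power2_eq_square field_simps)
    then show ?thesis
      by (rule has_field_derivative_transform_within_open[where S="{0<..}"]) (use 1 in \<open>auto simp: exp_inv_def\<close>)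
  next
    case 2
    have "((\<lambda>t. 0) has_real_derivative exp_inv ([:0,0,1:] * (P - pderiv P)) t) (at t)"
      using 2 by (auto simp: exp_inv_def)
    then show ?thesis
      by (rule has_field_derivative_transform_within_open[where S="{..<0}"]) (use 2 in \<open>auto simp: exp_inv_def\<close>)
  next
    case 3
    have r: "((\<lambda>h. exp_inv P h / h) \<longlongrightarrow> 0) (at_right 0)"
    proof -
      have "((\<lambda>h::real. poly ([:0,1:] * P) (inverse h) * exp (- inverse h)) \<longlongrightarrow> 0) (at_right 0)"
        by (rule filterlim_compose[OF poly_exp_decay filterlim_inverse_at_top_right])
      then show ?thesis
        by (rule tendsto_cong[THEN iffD1, rotated])
           (auto simp: eventually_at_right_field exp_inv_def field_simps intro!: exI[of _ 1])
    qed
    have l: "((\<lambda>h. exp_inv P h / h) \<longlongrightarrow> 0) (at_left 0)"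
      by (rule tendsto_eventually) (auto simp: eventually_at_left_field exp_inv_def intro!: exI[of _ "-1"])
    have "((\<lambda>h. exp_inv P h / h) \<longlongrightarrow> 0) (at 0)"
      using l r by (rule filterlim_split_at)
    then show ?thesis using 3
      by (simp add: has_field_derivative_iff exp_inv_def)
  qed
qed

lemma smooth_exp_inv: "smooth_real (exp_inv P)"
proof (rule smooth_realI)
  define Q where "Q k = ((\<lambda>P. [:0,0,1:] * (P - pderiv P)) ^^ k) P" for k
  show "exp_inv (Q 0) t = exp_inv P t" for t by (simp add: Q_def)
  show "(exp_inv (Q k) has_real_derivative exp_inv (Q (Suc k)) t) (at t)" for k t
    unfolding Q_def funpow.simps o_def by (rule exp_inv_DERIV)
qed

section \<open>Test functions\<close>

lemma test_fun_iff:
  "test_fun \<phi> \<longleftrightarrow> (\<forall>k. Ck k \<phi>) \<and> (\<exists>R. \<forall>x. R < norm x \<longrightarrow> \<phi> x = 0)"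
proof -
  have "compact (closure (support_on UNIV \<phi>)) \<longleftrightarrow> bounded (support_on UNIV \<phi>)"
    by (simp add: compact_closure)
  also have "\<dots> \<longleftrightarrow> (\<exists>R. \<forall>x. R < norm x \<longrightarrow> \<phi> x = 0)"
    unfolding bounded_iff support_on_def by (force simp: not_less[symmetric])
  finally show ?thesis unfolding test_fun_def by simp
qed

lemma grad_eqI:
  assumes "(f has_derivative (\<lambda>h. g \<bullet> h)) (at x)"
  shows "grad f x = g"
  unfolding grad_def frechet_derivative_eqI[OF assms] by (rule euclidean_representation)

lemma grad_inner:
  assumes "f differentiable (at x)"
  shows "grad f x \<bullet> h = frechet_derivative f (at x) h"
proof -
  have l: "linear (frechet_derivative f (at x))"
    by (rule linear_frechet_derivative[OF assms])
  have "frechet_derivative f (at x) h = frechet_derivative f (at x) (\<Sum>b\<in>Basis. (h \<bullet> b) *\<^sub>R b)"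
    by (simp add: euclidean_representation)
  also have "\<dots> = (\<Sum>b\<in>Basis. (h \<bullet> b) * frechet_derivative f (at x) b)"
    by (simp add: linear_sum[OF l] linear_cmul[OF l])
  also have "\<dots> = grad f x \<bullet> h"
    unfolding grad_def inner_sum_left inner_scaleR_left
    by (intro sum.cong refl) (simp add: inner_commute[of h] mult.commute)
  finally show ?thesis by simp
qed

lemma test_fun_differentiable: "test_fun f \<Longrightarrow> f differentiable (at x)"
  unfolding test_fun_def by (metis Ck.simps(2))

lemma test_fun_has_derivative:
  assumes "test_fun f"
  shows "(f has_derivative (\<lambda>h. grad f x \<bullet> h)) (at x)"
  using has_frechet_derivative[OF test_fun_differentiable[OF assms]]
  by (simp add: grad_inner[OF test_fun_differentiable[OF assms]])

lemma test_fun_continuous: "test_fun f \<Longrightarrow> continuous_on S f"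
  unfolding test_fun_def by (metis Ck.simps(1) continuous_on_subset subset_UNIV)

lemma test_fun_grad_continuous: "test_fun f \<Longrightarrow> continuous_on S (grad f)"
proof -
  assume f: "test_fun f"
  then have "Ck (Suc 0) f" unfolding test_fun_def by blast
  then have "continuous_on S (\<lambda>x. frechet_derivative f (at x) b)" if "b \<in> Basis" for b
    using that continuous_on_subset by fastforce
  then show ?thesis
    unfolding grad_def[abs_def] by (intro continuous_intros) auto
qed

lemma test_fun_support:
  assumes "test_fun f"
  obtains R where "R > 0" "\<And>x. R < norm x \<Longrightarrow> f x = 0" "\<And>x. R < norm x \<Longrightarrow> grad f x = 0"
proof -
  obtain R0 where R0: "\<And>x. R0 < norm x \<Longrightarrow> f x = 0"
    using assms unfolding test_fun_iff by blast
  define R where "R = max R0 1"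
  have 1: "f x = 0" if "R < norm x" for x using that R0[of x] by (auto simp: R_def)
  have 2: "grad f x = 0" if "R < norm x" for x
  proof (rule grad_eqI)
    have "((\<lambda>x. 0::real) has_derivative (\<lambda>h. 0 \<bullet> h)) (at x)" by simp
    then show "(f has_derivative (\<lambda>h. 0 \<bullet> h)) (at x)"
    proof (rule has_derivative_transform_within_open)
      show "open {x. R < norm x}" by (intro open_Collect_less continuous_intros)
    qed (use that 1 in auto)
  qed
  show ?thesis by (rule that[of R]) (use 1 2 in \<open>auto simp: R_def\<close>)
qed

lemma bounded_of_compact_support:
  fixes g :: "'a::euclidean_space \<Rightarrow> 'b::real_normed_vector"
  assumes "continuous_on UNIV g" "\<And>x. R < norm x \<Longrightarrow> g x = 0"
  obtains B where "B > 0" "\<And>x. norm (g x) \<le> B"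
proof -
  have "compact (g ` cball 0 R)"
    by (intro compact_continuous_image continuous_on_subset[OF assms(1)]) auto
  then obtain B where B: "B > 0" "\<And>y. y \<in> g ` cball 0 R \<Longrightarrow> norm y \<le> B"
    by (meson bounded_pos compact_imp_bounded)
  show ?thesis
  proof (rule that[OF B(1)])
    show "norm (g x) \<le> B" for x
      by (cases "R < norm x") (use assms(2)[of x] B in auto)
  qed
qed

lemma test_fun_bounded:
  assumes "test_fun f"
  obtains B where "B > 0" "\<And>x. \<bar>f x\<bar> \<le> B"
  using bounded_of_compact_support[OF test_fun_continuous[OF assms]] test_fun_support[OF assms]
  by (metis real_norm_def)

lemma test_fun_grad_bounded:
  assumes "test_fun f"
  obtains B where "B > 0" "\<And>x. norm (grad f x) \<le> B"
  using bounded_of_compact_support[OF test_fun_grad_continuous[OF assms]] test_fun_support[OF assms]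
  by metis

lemma test_fun_compose:
  assumes "smooth_real h" "h 0 = 0" "test_fun f"
  shows "test_fun (\<lambda>x. h (f x))"
proof -
  obtain R where "\<forall>x. R < norm x \<longrightarrow> f x = 0" using assms(3) unfolding test_fun_iff by blast
  then have "\<forall>x. R < norm x \<longrightarrow> h (f x) = 0" using assms(2) by simp
  moreover have "Ck k (\<lambda>x. h (f x))" for k
    by (rule Ck_smooth_compose[OF assms(1)]) (use assms(3) in \<open>simp add: test_fun_iff\<close>)
  ultimately show ?thesis unfolding test_fun_iff by blast
qed

lemma grad_compose:
  assumes "(h has_real_derivative h') (at (f x))" "test_fun f"
  shows "grad (\<lambda>x. h (f x)) x = h' *\<^sub>R grad f x"
proof (rule grad_eqI)
  have "((\<lambda>x. h (f x)) has_derivative (\<lambda>v. h' * (grad f x \<bullet> v))) (at x)"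
    using has_derivative_compose[OF test_fun_has_derivative[OF assms(2)], of h "\<lambda>v. h' * v" x] assms(1)
    by (simp add: has_field_derivative_def)
  then show "((\<lambda>x. h (f x)) has_derivative (\<lambda>v. (h' *\<^sub>R grad f x) \<bullet> v)) (at x)" by simp
qed

lemma test_fun_mult: "test_fun f \<Longrightarrow> test_fun g \<Longrightarrow> test_fun (\<lambda>x. f x * g x)"
  unfolding test_fun_iff by (auto intro!: Ck_mult)

lemma grad_mult:
  assumes "test_fun f" "test_fun g"
  shows "grad (\<lambda>x. f x * g x) x = f x *\<^sub>R grad g x + g x *\<^sub>R grad f x"
proof (rule grad_eqI)
  show "((\<lambda>x. f x * g x) has_derivative (\<lambda>h. (f x *\<^sub>R grad g x + g x *\<^sub>R grad f x) \<bullet> h)) (at x)"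
    using has_derivative_mult[OF test_fun_has_derivative[OF assms(1)] test_fun_has_derivative[OF assms(2)]]
    by (simp add: inner_add_left mult.commute)
qed

lemma grad_diff:
  assumes "test_fun f" "test_fun g"
  shows "grad (\<lambda>x. f x - g x) x = grad f x - grad g x"
proof (rule grad_eqI)
  show "((\<lambda>x. f x - g x) has_derivative (\<lambda>h. (grad f x - grad g x) \<bullet> h)) (at x)"
    using has_derivative_diff[OF test_fun_has_derivative[OF assms(1)] test_fun_has_derivative[OF assms(2)]]
    by (simp add: inner_diff_left)
qed

lemma test_fun_borel: "test_fun f \<Longrightarrow> f \<in> borel_measurable borel"
  by (simp add: borel_measurable_continuous_onI test_fun_continuous)

lemma test_fun_grad_borel: "test_fun f \<Longrightarrow> grad f \<in> borel_measurable borel"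
  by (simp add: borel_measurable_continuous_onI test_fun_grad_continuous)

lemma measurable_lebesgueI: "f \<in> borel_measurable borel \<Longrightarrow> f \<in> borel_measurable lebesgue"
  by (simp add: measurable_completion)

lemma integrable_compact_support:
  fixes g :: "'a::euclidean_space \<Rightarrow> 'b::{banach, second_countable_topology}"
  assumes "continuous_on UNIV g" "\<And>x. R < norm x \<Longrightarrow> g x = 0"
  shows "integrable lborel g"
proof -
  have "integrable lborel (\<lambda>x. indicator (cball 0 R) x *\<^sub>R g x)"
    by (intro borel_integrable_compact continuous_on_subset[OF assms(1)]) auto
  moreover have "indicator (cball 0 R) x *\<^sub>R g x = g x" for x
    using assms(2)[of x] by (auto simp: indicator_def)
  ultimately show ?thesis by simp
qed

section \<open>Integration by parts\<close>

lemma lborel_integral_shift: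
  fixes f :: "'a::euclidean_space \<Rightarrow> 'b::{banach, second_countable_topology}"
  assumes [measurable]: "f \<in> borel_measurable borel"
  shows "(LINT x|lborel. f (c + x)) = (LINT x|lborel. f x)"
proof -
  have "(LINT x|lborel. f x) = (LINT x|distr lborel borel ((+) c). f x)"
    by (simp add: lborel_distr_plus)
  also have "\<dots> = (LINT x|lborel. f (c + x))"
    by (subst integral_distr) auto
  finally show ?thesis by simp
qed

lemma test_fun_lipschitz:
  assumes "test_fun f" "\<And>x. norm (grad f x) \<le> B"
  shows "\<bar>f (x + v) - f x\<bar> \<le> B * norm v"
proof -
  have "norm (f (x + v) - f x) \<le> B * norm (x + v - x)"
  proof (rule differentiable_bound[where S=UNIV])
    show "(f has_derivative (\<lambda>h. grad f y \<bullet> h)) (at y within UNIV)" for y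
      using test_fun_has_derivative[OF assms(1)] by simp
    show "onorm (\<lambda>h. grad f y \<bullet> h) \<le> B" for y
      by (rule onorm_le) (metis Cauchy_Schwarz_ineq2 assms(2) mult_right_mono norm_ge_zero order_trans real_norm_def)
  qed auto
  then show ?thesis by simp
qed

text \<open>By translation invariance every difference quotient of a test function has integral zero, and the
  difference quotients converge to a partial derivative boundedly and with common compact support.\<close>

lemma integral_grad_eq_0:
  fixes f :: "'a::euclidean_space \<Rightarrow> real"
  assumes f: "test_fun f"
  shows "(LINT x|lborel. grad f x) = 0"
proof -
  obtain R where R: "R > 0" "\<And>x. R < norm x \<Longrightarrow> f x = 0" "\<And>x. R < norm x \<Longrightarrow> grad f x = 0"
    using test_fun_support[OF f] by blast
  obtain B where B: "B > 0" "\<And>x. norm (grad f x) \<le> B" using test_fun_grad_bounded[OF f] by blast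
  note [measurable] = test_fun_borel[OF f] test_fun_grad_borel[OF f]
  have int_f: "integrable lborel f"
    by (rule integrable_compact_support[OF test_fun_continuous[OF f] R(2)])
  have int_g: "integrable lborel (grad f)"
    by (rule integrable_compact_support[OF test_fun_grad_continuous[OF f] R(3)])
  have "(LINT x|lborel. grad f x \<bullet> b) = 0" if b: "b \<in> Basis" for b
  proof -
    define q where "q n x = real (Suc n) * (f (inverse (real (Suc n)) *\<^sub>R b + x) - f x)" for n x
    have "integrable lborel (\<lambda>x. f (c + x))" for c
    proof -
      have "integrable (distr lborel borel ((+) c)) f" using int_f by (simp add: lborel_distr_plus)
      then show ?thesis by (subst (asm) integrable_distr_eq) auto
    qed
    then have "(LINT x|lborel. q n x) = 0" for n
      using int_f lborel_integral_shift[of f] by (simp add: q_def)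
    moreover have "(\<lambda>n. LINT x|lborel. q n x) \<longlonglongrightarrow> (LINT x|lborel. grad f x \<bullet> b)"
    proof (rule integral_dominated_convergence[where w="\<lambda>x. B * indicator (cball 0 (R + 1)) x"])
      show "integrable lborel (\<lambda>x. B * indicator (cball 0 (R + 1)) x :: real)"
        by (intro integrable_mult_right integrable_real_indicator) (use emeasure_lborel_cball_finite[of 0 "R + 1"] in auto)
      show "AE x in lborel. (\<lambda>n. q n x) \<longlonglongrightarrow> grad f x \<bullet> b"
      proof (rule AE_I2)
        fix x
        have "((\<lambda>t. f (x + t *\<^sub>R b)) has_derivative (\<lambda>t. grad f (x + 0 *\<^sub>R b) \<bullet> (t *\<^sub>R b))) (at 0)"
          by (rule has_derivative_compose[where g=f and s=UNIV, simplified])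
             (auto intro!: derivative_eq_intros test_fun_has_derivative[OF f, THEN has_derivative_eq_rhs])
        then have "((\<lambda>t. f (x + t *\<^sub>R b)) has_real_derivative (grad f x \<bullet> b)) (at 0)"
          by (simp add: has_field_derivative_def mult.commute[of _ "grad f x \<bullet> b"])
        then have "((\<lambda>h. (f (x + h *\<^sub>R b) - f x) / h) \<longlongrightarrow> grad f x \<bullet> b) (at 0)"
          by (simp add: DERIV_def)
        then have "(\<lambda>n. (f (x + inverse (real (Suc n)) *\<^sub>R b) - f x) / inverse (real (Suc n))) \<longlonglongrightarrow> grad f x \<bullet> b"
          by (rule filterlim_compose)
             (use LIMSEQ_inverse_real_of_nat in \<open>auto simp: filterlim_at\<close>)
        then show "(\<lambda>n. q n x) \<longlonglongrightarrow> grad f x \<bullet> b"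
          by (simp add: q_def add.commute divide_inverse mult.commute)
      qed
      show "AE x in lborel. norm (q n x) \<le> B * indicator (cball 0 (R + 1)) x" for n
      proof (rule AE_I2)
        fix x :: 'a
        define v where "v = inverse (real (Suc n)) *\<^sub>R b"
        have v: "norm v = inverse (real (Suc n))" using b by (simp add: v_def)
        have v1: "norm v \<le> 1" unfolding v by (simp add: field_simps)
        show "norm (q n x) \<le> B * indicator (cball 0 (R + 1)) x"
        proof (cases "norm x \<le> R + 1")
          case True
          have "\<bar>f (x + v) - f x\<bar> \<le> B * norm v" by (rule test_fun_lipschitz[OF f B(2)])
          then have "real (Suc n) * \<bar>f (x + v) - f x\<bar> \<le> real (Suc n) * (B * norm v)"
            by (intro mult_left_mono) auto
          also have "\<dots> = B" unfolding v by simp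
          finally show ?thesis using True unfolding q_def v_def[symmetric] by (simp add: abs_mult add.commute)
        next
          case False
          moreover have "norm x \<le> norm (v + x) + norm v" using norm_triangle_ineq4[of "v + x" v] by simp
          ultimately have "f x = 0" "f (v + x) = 0" using v1 by (auto intro!: R(2))
          then show ?thesis using False B(1) unfolding q_def v_def[symmetric] by simp
        qed
      qed
    qed (auto simp: q_def)
    ultimately show ?thesis by (simp add: LIMSEQ_const_iff)
  qed
  then have "(LINT x|lborel. grad f x) \<bullet> b = 0" if "b \<in> Basis" for b
    using integral_inner_left[of b lborel "grad f"] int_g that by simp
  then show ?thesis by (metis euclidean_all_zero_iff)
qed

lemma test_fun_integration_by_parts:
  assumes f: "test_fun f" and g: "test_fun g"
  shows "(LINT x|lebesgue. f x *\<^sub>R grad g x) = - (LINT x|lebesgue. g x *\<^sub>R grad f x)"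
proof -
  obtain R where "R > 0" and R: "\<And>x. R < norm x \<Longrightarrow> f x = 0" "\<And>x. R < norm x \<Longrightarrow> grad f x = 0"
    using test_fun_support[OF f] by blast
  note [measurable] = test_fun_borel[OF f] test_fun_grad_borel[OF f] test_fun_borel[OF g] test_fun_grad_borel[OF g]
  have 1: "integrable lborel (\<lambda>x. f x *\<^sub>R grad g x)"
  proof (rule integrable_compact_support)
    show "continuous_on UNIV (\<lambda>x. f x *\<^sub>R grad g x)"
      by (rule continuous_on_scaleR[OF test_fun_continuous[OF f] test_fun_grad_continuous[OF g]])
    show "f x *\<^sub>R grad g x = 0" if "R < norm x" for x using R(1)[OF that] by simp
  qed
  have 2: "integrable lborel (\<lambda>x. g x *\<^sub>R grad f x)"
  proof (rule integrable_compact_support)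
    show "continuous_on UNIV (\<lambda>x. g x *\<^sub>R grad f x)"
      by (rule continuous_on_scaleR[OF test_fun_continuous[OF g] test_fun_grad_continuous[OF f]])
    show "g x *\<^sub>R grad f x = 0" if "R < norm x" for x using R(2)[OF that] by simp
  qed
  have "0 = (LINT x|lborel. f x *\<^sub>R grad g x + g x *\<^sub>R grad f x)"
    using integral_grad_eq_0[OF test_fun_mult[OF f g]] by (simp add: grad_mult[OF f g])
  also have "\<dots> = (LINT x|lborel. f x *\<^sub>R grad g x) + (LINT x|lborel. g x *\<^sub>R grad f x)"
    by (rule Bochner_Integration.integral_add[OF 1 2])
  finally show ?thesis
    by (simp add: integral_completion eq_neg_iff_add_eq_0)
qed

section \<open>Uniqueness of weak gradients\<close>

text \<open>Test functions supported in the closure of an open box; as \<open>n\<close> grows they increase to its indicator function.\<close>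

definition box_bump :: "nat \<Rightarrow> 'a::euclidean_space \<Rightarrow> 'a \<Rightarrow> 'a \<Rightarrow> real" where
  "box_bump n a b x = (\<Prod>i\<in>Basis. exp_inv 1 (real (Suc n) * ((x - a) \<bullet> i)) * exp_inv 1 (real (Suc n) * ((b - x) \<bullet> i)))"

lemma exp_inv_1_bounds: "0 \<le> exp_inv 1 t" "exp_inv 1 t \<le> 1"
  by (auto simp: exp_inv_def)

lemma box_bump_bounds: "0 \<le> box_bump n a b x" "box_bump n a b x \<le> indicator (box a b) x"
proof -
  show "0 \<le> box_bump n a b x"
    unfolding box_bump_def by (intro prod_nonneg ballI mult_nonneg_nonneg exp_inv_1_bounds)
  show "box_bump n a b x \<le> indicator (box a b) x"
  proof (cases "x \<in> box a b")
    case True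
    have "box_bump n a b x \<le> (\<Prod>i\<in>(Basis::'a set). 1)"
      unfolding box_bump_def
      by (intro prod_mono conjI mult_nonneg_nonneg exp_inv_1_bounds mult_le_one)
    with True show ?thesis by simp
  next
    case False
    then obtain i where i: "i \<in> Basis" "x \<bullet> i \<le> a \<bullet> i \<or> b \<bullet> i \<le> x \<bullet> i"
      unfolding box_def by (auto simp: not_less)
    then have "exp_inv 1 (real (Suc n) * ((x - a) \<bullet> i)) * exp_inv 1 (real (Suc n) * ((b - x) \<bullet> i)) = 0"
      by (auto simp: exp_inv_def inner_diff_left zero_less_mult_iff not_less)
    then have "box_bump n a b x = 0"
      unfolding box_bump_def using i by (intro prod_zero) auto
    then show ?thesis by simp
  qed
qed

lemma box_bump_tendsto: "(\<lambda>n. box_bump n a b x) \<longlonglongrightarrow> indicator (box a b) x"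
proof (cases "x \<in> box a b")
  case True
  have *: "(\<lambda>n. exp_inv 1 (real (Suc n) * t)) \<longlonglongrightarrow> 1" if "t > 0" for t
  proof -
    have "(\<lambda>n. - (inverse (real (Suc n)) * inverse t)) \<longlonglongrightarrow> - (0 * inverse t)"
      by (intro tendsto_intros LIMSEQ_inverse_real_of_nat)
    then have "(\<lambda>n. exp (- (inverse (real (Suc n)) * inverse t))) \<longlonglongrightarrow> exp 0"
      by (intro tendsto_exp) simp
    then show ?thesis using that by (simp add: exp_inv_def divide_inverse)
  qed
  have "(\<lambda>n. box_bump n a b x) \<longlonglongrightarrow> (\<Prod>i\<in>(Basis::'a set). 1 * 1)"
    unfolding box_bump_def using True
    by (intro tendsto_prod tendsto_mult *) (auto simp: box_def inner_diff_left)
  with True show ?thesis by simp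
next
  case False
  then have "box_bump n a b x = 0" for n
    using box_bump_bounds[of n a b x] by simp
  with False show ?thesis by simp
qed

lemma test_fun_box_bump: "test_fun (box_bump n a b)"
  unfolding test_fun_iff
proof (intro conjI allI)
  have "smooth_real (exp_inv 1)" by (rule smooth_exp_inv)
  then have 1: "smooth_real (\<lambda>t. exp_inv 1 (real (Suc n) * t + c))" for c by (rule smooth_real_affine)
  have 2: "smooth_real (\<lambda>t. exp_inv 1 (- real (Suc n) * t + c))" for c
    using \<open>smooth_real (exp_inv 1)\<close> by (rule smooth_real_affine)
  have "box_bump n a b = (\<lambda>x. \<Prod>i\<in>Basis. exp_inv 1 (real (Suc n) * (x \<bullet> i) + (- real (Suc n) * (a \<bullet> i)))
      * exp_inv 1 (- real (Suc n) * (x \<bullet> i) + real (Suc n) * (b \<bullet> i)))"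
    unfolding box_bump_def[abs_def] by (simp add: inner_diff_left algebra_simps)
  then show "Ck k (box_bump n a b)" for k
    by (simp only:) (intro Ck_prod Ck_mult Ck_smooth_compose[OF 1] Ck_smooth_compose[OF 2] Ck_inner finite_Basis)
  obtain R where "\<And>x. x \<in> box a b \<Longrightarrow> norm x \<le> R"
    using bounded_box[of a b] unfolding bounded_iff by blast
  then have "box_bump n a b x = 0" if "R < norm x" for x
    using box_bump_bounds[of n a b x] that by (cases "x \<in> box a b") force+
  then show "\<exists>R. \<forall>x. R < norm x \<longrightarrow> box_bump n a b x = 0" by blast
qed

lemma sigma_finite_lebesgue: "sigma_finite_measure (lebesgue :: 'a::euclidean_space measure)"
proof
  obtain A :: "'a set set" where A: "countable A" "A \<subseteq> sets lborel" "\<Union>A = space lborel" "\<forall>a\<in>A. emeasure lborel a \<noteq> \<infinity>"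
    using lborel.sigma_finite_countable by blast
  then show "\<exists>A. countable A \<and> A \<subseteq> sets (lebesgue :: 'a measure) \<and> \<Union> A = space lebesgue \<and> (\<forall>a\<in>A. emeasure lebesgue a \<noteq> \<infinity>)"
    by (intro exI[of _ A]) (auto simp: subset_eq)
qed

text \<open>The fundamental lemma of the calculus of variations. Testing with the bumps above shows that the
  integral of \<open>D\<close> over each box vanishes. Boxes are stable under intersection and generate the
  Borel sets, so the same holds for the integral over any Borel subset of a fixed box.\<close>

lemma locally_integrable_eq_0:
  fixes D :: "'a::euclidean_space \<Rightarrow> 'b::euclidean_space"
  assumes D: "locally_integrable D"
    and zero: "\<And>\<phi>. test_fun \<phi> \<Longrightarrow> (LINT x|lebesgue. \<phi> x *\<^sub>R D x) = 0"
  shows "AE x in lebesgue. D x = 0"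
proof -
  have box_int: "integrable lebesgue (\<lambda>x. indicator (cbox a b) x *\<^sub>R D x)" for a b
    using D compact_cbox unfolding locally_integrable_def set_integrable_def by blast
  have box0: "(LINT x|lebesgue. indicator (box a b) x *\<^sub>R D x) = 0" for a b
  proof -
    have ind: "box_bump n a b x = 0 \<and> indicat_real (box a b) x = 0"
      if "indicator (cbox a b) x *\<^sub>R D x \<noteq> D x" for x n
    proof -
      have "x \<notin> box a b" using that box_subset_cbox[of a b] by (auto simp: indicator_def split: if_splits)
      then show ?thesis using box_bump_bounds[of n a b x] by simp
    qed
    have "(\<lambda>n. LINT x|lebesgue. box_bump n a b x *\<^sub>R (indicator (cbox a b) x *\<^sub>R D x)) \<longlonglongrightarrow>
          (LINT x|lebesgue. indicator (box a b) x *\<^sub>R (indicator (cbox a b) x *\<^sub>R D x))"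
    proof (rule integral_dominated_convergence[where w="\<lambda>x. norm (indicator (cbox a b) x *\<^sub>R D x)"])
      note [measurable] = borel_measurable_integrable[OF box_int[of a b]]
      have [measurable]: "box a b \<in> sets lebesgue" by simp
      have [measurable]: "box_bump n a b \<in> borel_measurable lebesgue" for n
        by (intro measurable_lebesgueI test_fun_borel test_fun_box_bump)
      show "(\<lambda>x. indicator (box a b) x *\<^sub>R (indicator (cbox a b) x *\<^sub>R D x)) \<in> borel_measurable lebesgue"
        by measurable
      show "(\<lambda>x. box_bump n a b x *\<^sub>R (indicator (cbox a b) x *\<^sub>R D x)) \<in> borel_measurable lebesgue" for n
        by measurable
      show "AE x in lebesgue. (\<lambda>n. box_bump n a b x *\<^sub>R (indicator (cbox a b) x *\<^sub>R D x)) \<longlonglongrightarrow>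
          indicator (box a b) x *\<^sub>R (indicator (cbox a b) x *\<^sub>R D x)"
        by (intro AE_I2 tendsto_scaleR box_bump_tendsto tendsto_const)
      show "AE x in lebesgue. norm (box_bump n a b x *\<^sub>R (indicator (cbox a b) x *\<^sub>R D x)) \<le> norm (indicator (cbox a b) x *\<^sub>R D x)" for n
      proof (rule AE_I2)
        fix x
        have "\<bar>box_bump n a b x\<bar> \<le> 1"
          using box_bump_bounds[of n a b x] by (cases "x \<in> box a b") auto
        then show "norm (box_bump n a b x *\<^sub>R (indicator (cbox a b) x *\<^sub>R D x)) \<le> norm (indicator (cbox a b) x *\<^sub>R D x)"
          by (metis mult_left_le_one_le norm_ge_zero norm_scaleR abs_ge_zero)
      qed
      show "integrable lebesgue (\<lambda>x. norm (indicator (cbox a b) x *\<^sub>R D x))"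
        using box_int by (rule integrable_norm)
    qed
    moreover have "box_bump n a b x *\<^sub>R (indicator (cbox a b) x *\<^sub>R D x) = box_bump n a b x *\<^sub>R D x" for n x
      using ind[of x n] by (cases "indicator (cbox a b) x *\<^sub>R D x = D x") simp_all
    moreover have "indicator (box a b) x *\<^sub>R (indicator (cbox a b) x *\<^sub>R D x) = indicat_real (box a b) x *\<^sub>R D x" for x
      using ind[of x] by (cases "indicator (cbox a b) x *\<^sub>R D x = D x") simp_all
    ultimately have "(\<lambda>n. LINT x|lebesgue. box_bump n a b x *\<^sub>R D x) \<longlonglongrightarrow>
        (LINT x|lebesgue. indicator (box a b) x *\<^sub>R D x)"
      by (simp only:)
    then show ?thesis
      using zero[OF test_fun_box_bump] by (simp add: LIMSEQ_const_iff)
  qed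
  have "AE x in lebesgue. x \<in> box (- (real n *\<^sub>R One)) (real n *\<^sub>R One) \<longrightarrow> D x = 0" for n
  proof -
    define Q :: "'a set" where "Q = box (- (real n *\<^sub>R One)) (real n *\<^sub>R One)"
    define F where "F x = indicat_real Q x *\<^sub>R D x" for x
    have F: "integrable lebesgue F"
    proof -
      have "integrable lebesgue (\<lambda>x. indicator Q x *\<^sub>R (indicator (cbox (- (real n *\<^sub>R One)) (real n *\<^sub>R One)) x *\<^sub>R D x))"
        by (rule integrable_mult_indicator[OF _ box_int]) (auto simp: Q_def)
      moreover have "indicator Q x *\<^sub>R (indicator (cbox (- (real n *\<^sub>R One)) (real n *\<^sub>R One)) x *\<^sub>R D x) = F x" for x
        using box_subset_cbox[of "- (real n *\<^sub>R One)" "real n *\<^sub>R One"] by (auto simp: F_def Q_def indicator_def)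
      ultimately show ?thesis by simp
    qed
    have FA: "integrable lebesgue (\<lambda>x. indicator A x *\<^sub>R F x)" if "A \<in> sets borel" for A
      using that by (intro integrable_mult_indicator F) auto
    have borel0: "(LINT x|lebesgue. indicator A x *\<^sub>R F x) = 0" if "A \<in> sets borel" for A
    proof -
      have "Int_stable (range (\<lambda>(a, b). box a b :: 'a set))"
        by (auto simp: Int_stable_def box_Int_box)
      moreover have "range (\<lambda>(a, b). box a b :: 'a set) \<subseteq> Pow UNIV" by simp
      moreover have "A \<in> sigma_sets UNIV (range (\<lambda>(a, b). box a b))"
        using that by (simp add: borel_eq_box)
      ultimately show ?thesis
      proof (induction rule: sigma_sets_induct_disjoint)
        case (basic A)
        then obtain a b where A: "A = box a b" by auto
        obtain c d where cd: "box a b \<inter> Q = box c d" unfolding Q_def box_Int_box by blast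
        have "indicator A x *\<^sub>R F x = indicator (box c d) x *\<^sub>R D x" for x
          using cd by (auto simp: F_def A indicator_def)
        then show ?case by (simp add: box0)
      next
        case empty
        then show ?case by simp
      next
        case (compl A)
        then have A: "A \<in> sets borel" by (simp add: borel_eq_box)
        have "(LINT x|lebesgue. indicator (UNIV - A) x *\<^sub>R F x) = (LINT x|lebesgue. F x - indicator A x *\<^sub>R F x)"
          by (rule Bochner_Integration.integral_cong) (auto simp: indicator_def)
        also have "\<dots> = (LINT x|lebesgue. F x) - (LINT x|lebesgue. indicator A x *\<^sub>R F x)"
          by (rule Bochner_Integration.integral_diff[OF F FA[OF A]])
        also have "(LINT x|lebesgue. F x) = 0" unfolding F_def Q_def by (rule box0)
        finally show ?case using compl by simp
      next
        case (union A)
        then have A: "A i \<in> sets borel" for i by (auto simp: borel_eq_box)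
        have "(LINT x:(\<Union>i. A i)|lebesgue. F x) = (\<Sum>i. LINT x:A i|lebesgue. F x)"
        proof (rule lebesgue_integral_countable_add)
          show "A i \<in> sets lebesgue" for i using A by auto
          show "A i \<inter> A j = {}" if "i \<noteq> j" for i j using union(1) that by (auto simp: disjoint_family_on_def)
          have "(\<Union>i. A i) \<in> sets borel" using A by auto
          then show "set_integrable lebesgue (\<Union>i. A i) F" unfolding set_integrable_def by (rule FA)
        qed
        then show ?case using union by (simp add: set_lebesgue_integral_def)
      qed
    qed
    have "AE x in lebesgue. F x = 0"
    proof (rule sigma_finite_measure.density_zero[OF sigma_finite_lebesgue F])
      fix A :: "'a set" assume "A \<in> sets lebesgue"
      then obtain S N N' where A: "A = S \<union> N" "N \<subseteq> N'" "N' \<in> null_sets lborel" "S \<in> sets lborel"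
        by (elim sets_completionE)
      have "AE x in lebesgue. x \<notin> N'"
        using A(3) by (intro AE_completion AE_not_in)
      then have "AE x in lebesgue. indicat_real A x *\<^sub>R F x = indicator S x *\<^sub>R F x"
        by eventually_elim (use A(1,2) in \<open>auto simp: indicator_def\<close>)
      moreover have "(\<lambda>x. indicat_real A x *\<^sub>R F x) \<in> borel_measurable lebesgue" 
        "(\<lambda>x. indicat_real S x *\<^sub>R F x) \<in> borel_measurable lebesgue"
        using \<open>A \<in> sets lebesgue\<close> A(4) F
        by (auto intro: borel_measurable_scaleR[OF borel_measurable_indicator borel_measurable_integrable[OF F]])
      ultimately have "(LINT x|lebesgue. indicat_real A x *\<^sub>R F x) = (LINT x|lebesgue. indicator S x *\<^sub>R F x)"
        by (intro integral_cong_AE)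
      then show "(LINT x:A|lebesgue. F x) = 0"
        using borel0[of S] A(4) by (simp add: set_lebesgue_integral_def)
    qed
    then show ?thesis by eventually_elim (auto simp: F_def Q_def)
  qed
  then have "AE x in lebesgue. \<forall>n. x \<in> box (- (real n *\<^sub>R One)) (real n *\<^sub>R One) \<longrightarrow> D x = 0"
    unfolding AE_all_countable by blast
  then show ?thesis
  proof eventually_elim
    case (elim x)
    have "x \<in> (\<Union>n::nat. box (- (real n *\<^sub>R One)) (real n *\<^sub>R One))" unfolding UN_box_eq_UNIV by simp
    then show ?case using elim by blast
  qed
qed

lemma integrable_test_fun_scaleR:
  fixes D :: "'a::euclidean_space \<Rightarrow> 'b::euclidean_space"
  assumes D: "locally_integrable D" and f: "test_fun f"
  shows "integrable lebesgue (\<lambda>x. f x *\<^sub>R D x)"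
proof -
  obtain R where "R > 0" and R: "\<And>x. R < norm x \<Longrightarrow> f x = 0" "\<And>x. R < norm x \<Longrightarrow> grad f x = 0"
    using test_fun_support[OF f] by blast
  obtain B where B: "B > 0" "\<And>x. \<bar>f x\<bar> \<le> B" using test_fun_bounded[OF f] by blast
  have I: "integrable lebesgue (\<lambda>x. indicator (cball 0 R) x *\<^sub>R D x)"
    using D compact_cball unfolding locally_integrable_def set_integrable_def by blast
  have eq: "f x *\<^sub>R D x = f x *\<^sub>R (indicator (cball 0 R) x *\<^sub>R D x)" for x
    using R[of x] by (cases "R < norm x") (auto simp: not_less)
  note [measurable] = borel_measurable_integrable[OF I] measurable_lebesgueI[OF test_fun_borel[OF f]]
  show ?thesis
  proof (rule Bochner_Integration.integrable_bound[where f="\<lambda>x. B *\<^sub>R (indicator (cball 0 R) x *\<^sub>R D x)"])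
    show "integrable lebesgue (\<lambda>x. B *\<^sub>R (indicator (cball 0 R) x *\<^sub>R D x))" using I by (rule integrable_scaleR_right)
    show "(\<lambda>x. f x *\<^sub>R D x) \<in> borel_measurable lebesgue" unfolding eq by measurable
    have "norm (f x *\<^sub>R y) \<le> norm (B *\<^sub>R y)" for x and y :: 'b
      using B(1) B(2)[of x] by (simp add: mult_right_mono)
    then show "AE x in lebesgue. norm (f x *\<^sub>R D x) \<le> norm (B *\<^sub>R (indicator (cball 0 R) x *\<^sub>R D x))"
      by (intro AE_I2) (metis eq)
  qed
qed

lemma weak_grad_unique:
  assumes "has_weak_grad u G" "has_weak_grad u G'"
  shows "AE x in lebesgue. G x = G' x"
proof -
  have G: "locally_integrable G" "locally_integrable G'" using assms by (auto simp: has_weak_grad_def)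
  have "AE x in lebesgue. G x - G' x = 0"
  proof (rule locally_integrable_eq_0)
    show "locally_integrable (\<lambda>x. G x - G' x)"
      using G unfolding locally_integrable_def by (auto intro: set_integral_diff)
    fix \<phi> :: "'a \<Rightarrow> real" assume t: "test_fun \<phi>"
    have "(LINT x|lebesgue. \<phi> x *\<^sub>R (G x - G' x)) = (LINT x|lebesgue. \<phi> x *\<^sub>R G x) - (LINT x|lebesgue. \<phi> x *\<^sub>R G' x)"
      using integrable_test_fun_scaleR[OF G(1) t] integrable_test_fun_scaleR[OF G(2) t]
      by (simp add: scaleR_diff_right)
    also have "\<dots> = 0"
      using assms t unfolding has_weak_grad_def by (metis diff_self neg_equal_iff_equal)
    finally show "(LINT x|lebesgue. \<phi> x *\<^sub>R (G x - G' x)) = 0" .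
  qed
  then show ?thesis by eventually_elim simp
qed

section \<open>A generalised Hoelder inequality\<close>

lemma ennreal_power_le_imp_le:
  fixes a b :: ennreal
  assumes "a ^ m \<le> b ^ m" "m > 0"
  shows "a \<le> b"
proof (cases a)
  case (real r)
  show ?thesis
  proof (cases b)
    case (real r')
    with \<open>a = ennreal r\<close> \<open>0 \<le> r\<close> assms show ?thesis
      by (simp add: ennreal_power power_le_imp_le_base[of r "m - 1" r'])
  qed simp
next
  case top
  then have "b ^ m = top" using assms by (simp add: top_unique)
  then show ?thesis by (simp add: power_eq_top_ennreal)
qed

text \<open>The inequality between arithmetic and geometric means, without roots.\<close>

lemma prod_le_mean_power_real:
  fixes y :: "'i \<Rightarrow> real"
  assumes A: "finite A" "A \<noteq> {}" and y: "\<And>i. i \<in> A \<Longrightarrow> y i \<ge> 0"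
  shows "(\<Prod>i\<in>A. y i) \<le> ((\<Sum>i\<in>A. y i) / card A) ^ card A"
proof -
  have c: "card A > 0" using A by (simp add: card_gt_0_iff)
  define P where "P = (\<Prod>i\<in>A. y i)"
  have P: "P \<ge> 0" unfolding P_def by (intro prod_nonneg y)
  have "P powr (1 / card A) \<le> (\<Sum>i\<in>A. y i / card A)"
    unfolding P_def by (rule arith_geom_mean[OF A y])
  also have "\<dots> = (\<Sum>i\<in>A. y i) / card A" by (simp add: sum_divide_distrib)
  finally have "(P powr (1 / card A)) ^ card A \<le> ((\<Sum>i\<in>A. y i) / card A) ^ card A"
    by (intro power_mono) auto
  moreover have "(P powr (1 / card A)) ^ card A = P"
  proof (cases "P = 0")
    case False
    then have "P > 0" using P by simp
    then show ?thesis using c by (simp add: powr_realpow[symmetric] powr_powr)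
  qed (use c in simp)
  ultimately show ?thesis unfolding P_def by simp
qed

lemma prod_le_mean_power_ennreal:
  fixes y :: "'i \<Rightarrow> ennreal"
  assumes A: "finite A" "A \<noteq> {}"
  shows "(\<Prod>i\<in>A. y i) \<le> ((\<Sum>i\<in>A. y i) / ennreal (card A)) ^ card A"
proof (cases "\<exists>i\<in>A. y i = top")
  case True
  then obtain k where "k \<in> A" "y k = top" by blast
  then have "(\<Sum>i\<in>A. y i) = top" using A by (simp add: sum.remove[of A k])
  moreover have "card A > 0" using A by (simp add: card_gt_0_iff)
  ultimately show ?thesis by (simp add: ennreal_top_divide)
next
  case False
  define r where "r i = enn2real (y i)" for i
  have yr: "y i = ennreal (r i)" if "i \<in> A" for i
    using False that by (simp add: r_def less_top)
  have r: "r i \<ge> 0" for i by (simp add: r_def)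
  have c: "card A > 0" using A by (simp add: card_gt_0_iff)
  have "(\<Prod>i\<in>A. y i) = ennreal (\<Prod>i\<in>A. r i)"
    using r by (simp add: yr prod_ennreal)
  also have "\<dots> \<le> ennreal (((\<Sum>i\<in>A. r i) / card A) ^ card A)"
    by (intro ennreal_leI prod_le_mean_power_real A r)
  also have "\<dots> = ((\<Sum>i\<in>A. y i) / ennreal (card A)) ^ card A"
    using r c by (simp add: yr sum_ennreal ennreal_power[symmetric] divide_ennreal[symmetric] sum_nonneg)
  finally show ?thesis .
qed

text \<open>Hoelder's inequality for finitely many factors in root-free form, which avoids fractional
  powers of extended reals. If all integrals on the right are positive and finite, each factor is
  divided by its integral and the arithmetic mean of the quotients bounds their geometric mean.\<close>

lemma nn_integral_holder_prod:
  fixes h :: "'i \<Rightarrow> 'a \<Rightarrow> ennreal"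
  assumes A: "finite A" "A \<noteq> {}"
    and [measurable]: "F \<in> borel_measurable M" "\<And>i. i \<in> A \<Longrightarrow> h i \<in> borel_measurable M"
    and le: "\<And>x. x \<in> space M \<Longrightarrow> F x ^ card A \<le> (\<Prod>i\<in>A. h i x)"
  shows "(\<integral>\<^sup>+x. F x \<partial>M) ^ card A \<le> (\<Prod>i\<in>A. \<integral>\<^sup>+x. h i x \<partial>M)"
proof -
  have c: "card A > 0" using A by (simp add: card_gt_0_iff)
  define I where "I i = (\<integral>\<^sup>+x. h i x \<partial>M)" for i
  consider (zero) i where "i \<in> A" "I i = 0" | (top) "\<forall>i\<in>A. I i \<noteq> 0" "\<exists>i\<in>A. I i = top"
    | (fin) "\<forall>i\<in>A. I i \<noteq> 0" "\<forall>i\<in>A. I i \<noteq> top" by blast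
  then show ?thesis
  proof cases
    case zero
    then have "AE x in M. h i x = 0" unfolding I_def by (subst (asm) nn_integral_0_iff_AE) auto
    then have "AE x in M. F x = 0"
    proof (rule AE_mp, intro AE_I2 impI)
      fix x assume x: "x \<in> space M" "h i x = 0"
      then have "(\<Prod>i\<in>A. h i x) = 0" using A zero by (intro prod_zero) auto
      then have "F x ^ card A = 0" using le[OF x(1)] by (simp only: le_zero_eq)
      then show "F x = 0" using c by (simp only: power_eq_0_iff)
    qed
    then have "(\<integral>\<^sup>+x. F x \<partial>M) = 0" by (subst nn_integral_0_iff_AE) auto
    then show ?thesis using c by (simp add: power_0_left)
  next
    case top
    then obtain i where i: "i \<in> A" "I i = top" by blast
    have "(\<Prod>i\<in>A. I i) = I i * (\<Prod>i\<in>A - {i}. I i)" using A i by (simp add: prod.remove)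
    also have "\<dots> = top" using i top A by (auto simp: ennreal_top_mult prod_zero_iff)
    finally show ?thesis unfolding I_def by simp
  next
    case fin
    define a where "a i = enn2real (I i)" for i
    have Ia: "I i = ennreal (a i)" "a i > 0" if "i \<in> A" for i
      using fin that by (auto simp: a_def less_top enn2real_positive_iff zero_less_iff_neq_zero)
    define r where "r = root (card A) (\<Prod>i\<in>A. a i)"
    have pa: "(\<Prod>i\<in>A. a i) > 0" by (intro prod_pos) (use Ia in auto)
    have r: "r > 0" "r ^ card A = (\<Prod>i\<in>A. a i)"
      unfolding r_def using c pa by (auto simp: real_root_gt_zero real_root_pow_pos)
    have F: "F x \<le> ennreal (r / card A) * (\<Sum>i\<in>A. ennreal (1 / a i) * h i x)" if x: "x \<in> space M" for x
    proof (rule ennreal_power_le_imp_le[OF _ c])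
      have "F x ^ card A \<le> (\<Prod>i\<in>A. h i x)" by (rule le[OF x])
      also have "\<dots> = (\<Prod>i\<in>A. ennreal (a i) * (ennreal (1 / a i) * h i x))"
        using Ia(2) by (intro prod.cong refl) (simp add: mult.assoc[symmetric] ennreal_mult[symmetric] less_imp_le less_imp_neq[THEN not_sym])
      also have "\<dots> = ennreal (r ^ card A) * (\<Prod>i\<in>A. ennreal (1 / a i) * h i x)"
        using Ia(2) by (simp add: prod.distrib r prod_ennreal less_imp_le)
      also have "\<dots> \<le> ennreal (r ^ card A) * ((\<Sum>i\<in>A. ennreal (1 / a i) * h i x) / ennreal (card A)) ^ card A"
        by (intro mult_left_mono prod_le_mean_power_ennreal A) auto
      also have "\<dots> = (ennreal r * ((\<Sum>i\<in>A. ennreal (1 / a i) * h i x) / ennreal (card A))) ^ card A"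
        using r by (simp add: power_mult_distrib ennreal_power less_imp_le)
      also have "ennreal r * ((\<Sum>i\<in>A. ennreal (1 / a i) * h i x) / ennreal (card A))
          = ennreal (r / card A) * (\<Sum>i\<in>A. ennreal (1 / a i) * h i x)"
        using r c by (simp add: divide_ennreal[symmetric] divide_ennreal_def mult_ac less_imp_le)
      finally show "F x ^ card A \<le> (ennreal (r / card A) * (\<Sum>i\<in>A. ennreal (1 / a i) * h i x)) ^ card A" .
    qed
    have "(\<integral>\<^sup>+x. F x \<partial>M) \<le> (\<integral>\<^sup>+x. ennreal (r / card A) * (\<Sum>i\<in>A. ennreal (1 / a i) * h i x) \<partial>M)"
      by (intro nn_integral_mono F)
    also have "\<dots> = ennreal (r / card A) * (\<Sum>i\<in>A. ennreal (1 / a i) * I i)"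
      unfolding I_def by (simp add: nn_integral_cmult nn_integral_sum)
    also have "(\<Sum>i\<in>A. ennreal (1 / a i) * I i) = (\<Sum>i\<in>A. 1)"
      by (intro sum.cong refl) (use Ia in \<open>simp add: ennreal_mult[symmetric] less_imp_le less_imp_neq[THEN not_sym]\<close>)
    also have "ennreal (r / card A) * (\<Sum>i\<in>A. 1) = ennreal r"
      using r c by (simp add: ennreal_of_nat_eq_real_of_nat ennreal_mult[symmetric] less_imp_le)
    finally have "(\<integral>\<^sup>+x. F x \<partial>M) ^ card A \<le> ennreal r ^ card A" by (rule power_mono) simp
    also have "\<dots> = (\<Prod>i\<in>A. I i)"
      using r Ia by (simp add: ennreal_power prod_ennreal less_imp_le)
    finally show ?thesis unfolding I_def .
  qed
qed

lemma nn_integral_holder_prod_const: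
  fixes h :: "'i \<Rightarrow> 'a \<Rightarrow> ennreal"
  assumes A: "finite A" "A \<noteq> {}"
    and [measurable]: "F \<in> borel_measurable M" "\<And>i. i \<in> A \<Longrightarrow> h i \<in> borel_measurable M"
    and le: "\<And>x. x \<in> space M \<Longrightarrow> F x ^ card A \<le> c * (\<Prod>i\<in>A. h i x)"
  shows "(\<integral>\<^sup>+x. F x \<partial>M) ^ card A \<le> c * (\<Prod>i\<in>A. \<integral>\<^sup>+x. h i x \<partial>M)"
proof -
  obtain k where k: "k \<in> A" using A by blast
  define h' where "h' i x = (if i = k then c * h i x else h i x)" for i x
  have 1: "(\<Prod>i\<in>A. h' i x) = c * (\<Prod>i\<in>A. h i x)" for x
    using A k by (simp add: prod.remove[of A k] h'_def mult.assoc)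
  have 2: "(\<Prod>i\<in>A. \<integral>\<^sup>+x. h' i x \<partial>M) = c * (\<Prod>i\<in>A. \<integral>\<^sup>+x. h i x \<partial>M)"
    using A k by (simp add: prod.remove[of A k] h'_def nn_integral_cmult mult.assoc)
  have "(\<integral>\<^sup>+x. F x \<partial>M) ^ card A \<le> (\<Prod>i\<in>A. \<integral>\<^sup>+x. h' i x \<partial>M)"
  proof (rule nn_integral_holder_prod[OF A])
    show "F x ^ card A \<le> (\<Prod>i\<in>A. h' i x)" if "x \<in> space M" for x
      unfolding 1 by (rule le[OF that])
  qed (auto simp: h'_def[abs_def])
  then show ?thesis by (simp add: 2)
qed

section \<open>The inequality of Gagliardo and Loomis-Whitney\<close>

text \<open>The integral of \<open>f\<close> over the affine subspace through \<open>x\<close> spanned by the set \<open>J\<close> of basis vectors. The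
  integration variables are shifts of \<open>x\<close>, so the result does not depend on the coordinates of \<open>x\<close>
  in the directions of \<open>J\<close>.\<close>

definition marginal :: "'a::euclidean_space set \<Rightarrow> ('a \<Rightarrow> ennreal) \<Rightarrow> 'a \<Rightarrow> ennreal" where
  "marginal J f x = (\<integral>\<^sup>+y. f (x + (\<Sum>b\<in>J. y b *\<^sub>R b)) \<partial>(\<Pi>\<^sub>M b\<in>J. (lborel :: real measure)))"

interpretation lborel_PiM: product_sigma_finite "\<lambda>b::'a::euclidean_space. (lborel :: real measure)" ..

lemma marginal_measurable [measurable]:
  assumes [measurable]: "f \<in> borel_measurable borel" and J: "finite J"
  shows "marginal J f \<in> borel_measurable borel"
proof -
  interpret finite_product_sigma_finite "\<lambda>b::'a. (lborel :: real measure)" J by standard fact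
  have "(\<lambda>x. \<integral>\<^sup>+y. f (x + (\<Sum>b\<in>J. y b *\<^sub>R b)) \<partial>(\<Pi>\<^sub>M b\<in>J. (lborel :: real measure))) \<in> borel_measurable borel"
    by measurable
  then show ?thesis unfolding marginal_def[abs_def] .
qed

lemma marginal_empty [simp]: "marginal {} f x = f x"
  unfolding marginal_def by (simp add: lborel_PiM.nn_integral_empty space_PiM_empty emeasure_PiM_empty)

lemma marginal_insert:
  assumes [measurable]: "f \<in> borel_measurable borel" and J: "finite J" "j \<notin> J"
  shows "marginal (insert j J) f x = (\<integral>\<^sup>+t. marginal J f (x + t *\<^sub>R j) \<partial>lborel)"
proof -
  have *: "(\<Sum>b\<in>J. (y(j := t)) b *\<^sub>R b) = (\<Sum>b\<in>J. y b *\<^sub>R b)" for y t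
    using J by (intro sum.cong) auto
  show ?thesis unfolding marginal_def
    by (subst lborel_PiM.product_nn_integral_insert_rev) (use J in \<open>auto simp: * add.assoc fun_upd_same simp del: fun_upd_apply\<close>)
qed

lemma marginal_singleton:
  assumes [measurable]: "f \<in> borel_measurable borel"
  shows "marginal {j} f x = (\<integral>\<^sup>+t. f (x + t *\<^sub>R j) \<partial>lborel)"
  using marginal_insert[of f "{}" j x] by simp

lemma marginal_shift:
  assumes [measurable]: "f \<in> borel_measurable borel" and J: "finite J" "j \<in> J"
  shows "marginal J f (x + r *\<^sub>R j) = marginal J f x"
proof -
  define K where "K = J - {j}"
  have K: "finite K" "j \<notin> K" "J = insert j K" using J by (auto simp: K_def)
  have [measurable]: "marginal K f \<in> borel_measurable borel" using K by measurable
  have "(\<integral>\<^sup>+t. marginal K f (x + t *\<^sub>R j) \<partial>lborel) = (\<integral>\<^sup>+t. marginal K f (x + (r + 1 * t) *\<^sub>R j) \<partial>lborel)"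
    by (subst nn_integral_real_affine[where c=1 and t=r]) auto
  then show ?thesis using K by (simp add: marginal_insert algebra_simps)
qed

lemma marginal_Basis:
  assumes [measurable]: "f \<in> borel_measurable borel"
  shows "marginal Basis f 0 = (\<integral>\<^sup>+x. f x \<partial>lborel)"
  unfolding marginal_def by (subst lborel_eq, subst nn_integral_distr) auto

text \<open>The directions are integrated out one at a time. When the integral in direction \<open>j\<close> is taken, the
  \<open>j\<close>-th factor is constant in that direction and leaves the integral; the remaining
  \<open>DIM('a) - 1\<close> factors are separated by Hoelder's inequality.\<close>

lemma marginal_gagliardo:
  fixes f :: "'a::euclidean_space \<Rightarrow> 'a \<Rightarrow> ennreal"
  assumes dim: "DIM('a) \<ge> 2"
    and [measurable]: "F \<in> borel_measurable borel" "\<And>i. i \<in> Basis \<Longrightarrow> f i \<in> borel_measurable borel"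
    and le: "\<And>x. F x ^ (DIM('a) - 1) \<le> (\<Prod>i\<in>Basis. marginal {i} (f i) x)"
    and J: "J \<subseteq> Basis"
  shows "marginal J F x ^ (DIM('a) - 1) \<le> (\<Prod>i\<in>Basis. marginal (insert i J) (f i) x)"
proof -
  have "finite J" using J finite_Basis by (rule finite_subset)
  then show ?thesis using J
  proof (induction J arbitrary: x rule: finite_induct)
    case empty
    then show ?case using le[of x] by simp
  next
    case (insert j J)
    then have j: "j \<in> Basis" and IH: "\<And>x. marginal J F x ^ (DIM('a) - 1) \<le> (\<Prod>i\<in>Basis. marginal (insert i J) (f i) x)"
      by auto
    have [measurable]: "marginal J F \<in> borel_measurable borel" using insert by measurable
    have [measurable]: "marginal (insert i J) (f i) \<in> borel_measurable borel" if "i \<in> Basis" for i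
      by (rule marginal_measurable) (use insert that in auto)
    have cardB: "card (Basis - {j}) = DIM('a) - 1" using j by simp
    have "(\<integral>\<^sup>+t. marginal J F (x + t *\<^sub>R j) \<partial>lborel) ^ card (Basis - {j}) \<le>
       marginal (insert j J) (f j) x * (\<Prod>i\<in>Basis - {j}. \<integral>\<^sup>+t. marginal (insert i J) (f i) (x + t *\<^sub>R j) \<partial>lborel)"
    proof (rule nn_integral_holder_prod_const)
      show "finite (Basis - {j})" by simp
      have "card (Basis - {j}) \<noteq> 0" using cardB dim by simp
      then show "Basis - {j} \<noteq> {}" by (metis card.empty)
      fix t
      have "marginal J F (x + t *\<^sub>R j) ^ card (Basis - {j}) \<le> (\<Prod>i\<in>Basis. marginal (insert i J) (f i) (x + t *\<^sub>R j))"
        unfolding cardB by (rule IH)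
      also have "\<dots> = marginal (insert j J) (f j) (x + t *\<^sub>R j) * (\<Prod>i\<in>Basis - {j}. marginal (insert i J) (f i) (x + t *\<^sub>R j))"
        using j by (simp add: prod.remove)
      also have "marginal (insert j J) (f j) (x + t *\<^sub>R j) = marginal (insert j J) (f j) x"
        using insert j by (intro marginal_shift) auto
      finally show "marginal J F (x + t *\<^sub>R j) ^ card (Basis - {j}) \<le>
          marginal (insert j J) (f j) x * (\<Prod>i\<in>Basis - {j}. marginal (insert i J) (f i) (x + t *\<^sub>R j))" .
    qed (auto intro!: measurable_compose[where g="marginal _ _"])
    also have "(\<Prod>i\<in>Basis - {j}. \<integral>\<^sup>+t. marginal (insert i J) (f i) (x + t *\<^sub>R j) \<partial>lborel) =
        (\<Prod>i\<in>Basis - {j}. marginal (insert i (insert j J)) (f i) x)"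
      using insert by (intro prod.cong refl) (auto simp: insert_commute[of _ j] marginal_insert)
    also have "marginal (insert j J) (f j) x * \<dots> = (\<Prod>i\<in>Basis. marginal (insert i (insert j J)) (f i) x)"
      using j by (simp add: prod.remove)
    finally show ?case using insert by (simp add: marginal_insert cardB)
  qed
qed

lemma gagliardo_inequality:
  fixes f :: "'a::euclidean_space \<Rightarrow> 'a \<Rightarrow> ennreal"
  assumes dim: "DIM('a) \<ge> 2"
    and [measurable]: "F \<in> borel_measurable borel" "\<And>i. i \<in> Basis \<Longrightarrow> f i \<in> borel_measurable borel"
    and le: "\<And>x. F x ^ (DIM('a) - 1) \<le> (\<Prod>i\<in>Basis. \<integral>\<^sup>+t. f i (x + t *\<^sub>R i) \<partial>lborel)"
  shows "(\<integral>\<^sup>+x. F x \<partial>lborel) ^ (DIM('a) - 1) \<le> (\<Prod>i\<in>Basis. \<integral>\<^sup>+x. f i x \<partial>lborel)"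
proof -
  have "marginal Basis F 0 ^ (DIM('a) - 1) \<le> (\<Prod>i\<in>Basis. marginal (insert i Basis) (f i) 0)"
    by (rule marginal_gagliardo[OF dim]) (use le nonempty_Basis in \<open>auto simp: marginal_singleton\<close>)
  then show ?thesis by (simp add: marginal_Basis insert_absorb)
qed

section \<open>Sequences decaying fast in Lebesgue spaces\<close>

lemma norm_diff_sq_le:
  fixes a b :: "'a::real_inner"
  shows "(norm (a - b))\<^sup>2 \<le> 2 * (norm a)\<^sup>2 + 2 * (norm b)\<^sup>2"
proof -
  have "(norm (a - b))\<^sup>2 + (norm (a + b))\<^sup>2 = 2 * (norm a)\<^sup>2 + 2 * (norm b)\<^sup>2"
    by (simp add: power2_norm_eq_inner algebra_simps inner_commute)
  then show ?thesis using zero_le_power2[of "norm (a + b)"] by linarith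
qed

lemma le_suminf_ennreal: "a n \<le> (\<Sum>n. a n :: ennreal)"
  using sum_le_suminf[of a "{n}"] by simp

lemma ennreal_less_top_E:
  assumes "(a::ennreal) < \<infinity>"
  obtains r where "a = ennreal r" "r \<ge> 0"
  using assms by (cases a) auto

text \<open>Each increment is at most \<open>sqrt S / 2 ^ n\<close>, where \<open>S\<close> is the weighted sum of squares assumed to be
  finite; so the increments are dominated by a geometric series.\<close>

lemma fast_Cauchy_pointwise:
  fixes f :: "nat \<Rightarrow> 'b::banach"
  assumes fin: "(\<Sum>n. ennreal (4 ^ n * (norm (f (Suc n) - f n))\<^sup>2)) < \<infinity>"
  shows "convergent f"
    and "\<And>n. ennreal ((norm (f n))\<^sup>2) \<le>
       2 * ennreal ((norm (f 0))\<^sup>2) + 8 * (\<Sum>n. ennreal (4 ^ n * (norm (f (Suc n) - f n))\<^sup>2))"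
proof -
  obtain S where S: "(\<Sum>n. ennreal (4 ^ n * (norm (f (Suc n) - f n))\<^sup>2)) = ennreal S" "S \<ge> 0"
    using fin by (rule ennreal_less_top_E)
  have step: "norm (f (Suc n) - f n) \<le> sqrt S * (1/2) ^ n" for n
  proof -
    have "ennreal (4 ^ n * (norm (f (Suc n) - f n))\<^sup>2) \<le> ennreal S"
      unfolding S(1)[symmetric]
      by (rule le_suminf_ennreal)
    then have "4 ^ n * (norm (f (Suc n) - f n))\<^sup>2 \<le> S" using S(2) by simp
    moreover have "4 ^ n * (norm (f (Suc n) - f n))\<^sup>2 = (2 ^ n * norm (f (Suc n) - f n))\<^sup>2"
      by (simp add: power_mult_distrib power_mult[symmetric] mult.commute[of n 2] power_mult)
    ultimately have "2 ^ n * norm (f (Suc n) - f n) \<le> sqrt S"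
      by (simp add: real_le_rsqrt)
    then show ?thesis by (simp add: field_simps power_one_over)
  qed
  have sm: "summable (\<lambda>n. sqrt S * (1/2::real) ^ n)" by (intro summable_mult summable_geometric) auto
  have sn: "summable (\<lambda>n. norm (f (Suc n) - f n))"
    by (rule summable_comparison_test[OF _ sm]) (use step in auto)
  have "summable (\<lambda>n. f (Suc n) - f n)" using sn by (rule summable_norm_cancel)
  then have "convergent (\<lambda>n. f n - f 0)"
    by (simp add: summable_iff_convergent sum_lessThan_telescope)
  then have "convergent (\<lambda>n. (f n - f 0) + f 0)" by (intro convergent_add convergent_const)
  then show "convergent f" by simp
  show "ennreal ((norm (f n))\<^sup>2) \<le>
       2 * ennreal ((norm (f 0))\<^sup>2) + 8 * (\<Sum>n. ennreal (4 ^ n * (norm (f (Suc n) - f n))\<^sup>2))" for n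
  proof -
    have "norm (f n - f 0) = norm (\<Sum>i<n. f (Suc i) - f i)" by (simp add: sum_lessThan_telescope)
    also have "\<dots> \<le> (\<Sum>i<n. norm (f (Suc i) - f i))" by (rule norm_sum)
    also have "\<dots> \<le> (\<Sum>i<n. sqrt S * (1/2) ^ i)" by (intro sum_mono step)
    also have "\<dots> \<le> (\<Sum>i. sqrt S * (1/2) ^ i)" by (intro sum_le_suminf sm) (use S in auto)
    also have "\<dots> = 2 * sqrt S" by (subst suminf_mult) (auto simp: suminf_geometric)
    finally have d: "norm (f n - f 0) \<le> 2 * sqrt S" .
    have "norm (f n) \<le> norm (f 0) + norm (f n - f 0)" by (metis add_diff_cancel_left' diff_add_cancel norm_triangle_ineq)
    then have "(norm (f n))\<^sup>2 \<le> (norm (f 0) + 2 * sqrt S)\<^sup>2" using d by (intro power_mono) auto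
    also have "\<dots> \<le> 2 * (norm (f 0))\<^sup>2 + 2 * (2 * sqrt S)\<^sup>2"
      using sum_squares_bound[of "norm (f 0)" "2 * sqrt S"] by (simp add: power2_sum)
    also have "\<dots> = 2 * (norm (f 0))\<^sup>2 + 8 * S" using S(2) by (simp add: power_mult_distrib)
    finally have "ennreal ((norm (f n))\<^sup>2) \<le> ennreal (2 * (norm (f 0))\<^sup>2 + 8 * S)" by (rule ennreal_leI)
    also have "\<dots> = 2 * ennreal ((norm (f 0))\<^sup>2) + 8 * ennreal S"
      using S(2) by (simp add: ennreal_plus ennreal_mult)
    finally show ?thesis unfolding S(1) .
  qed
qed

text \<open>A sequence whose increments decay fast in \<open>L\<^sup>2\<close> is dominated by a square-integrable
  function and converges almost everywhere.\<close>

lemma fast_Cauchy_L2_dominated: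
  fixes f :: "nat \<Rightarrow> 'a \<Rightarrow> 'b::{banach, second_countable_topology}"
  assumes [measurable]: "\<And>n. f n \<in> borel_measurable M"
    and f0: "(\<integral>\<^sup>+x. ennreal ((norm (f 0 x))\<^sup>2) \<partial>M) < \<infinity>"
    and fast: "\<And>n. (\<integral>\<^sup>+x. ennreal ((norm (f (Suc n) x - f n x))\<^sup>2) \<partial>M) \<le> ennreal ((1/8) ^ n)"
  obtains W :: "'a \<Rightarrow> ennreal" where "W \<in> borel_measurable M" "(\<integral>\<^sup>+x. W x \<partial>M) < \<infinity>"
    "AE x in M. convergent (\<lambda>n. f n x) \<and> (\<forall>n. ennreal ((norm (f n x))\<^sup>2) \<le> W x)"
proof -
  define T where "T x = (\<Sum>n. ennreal (4 ^ n * (norm (f (Suc n) x - f n x))\<^sup>2))" for x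
  have [measurable]: "T \<in> borel_measurable M" unfolding T_def[abs_def] by measurable
  have "(\<integral>\<^sup>+x. T x \<partial>M) = (\<Sum>n. \<integral>\<^sup>+x. ennreal (4 ^ n * (norm (f (Suc n) x - f n x))\<^sup>2) \<partial>M)"
    unfolding T_def by (rule nn_integral_suminf) measurable
  also have "\<dots> = (\<Sum>n. ennreal (4 ^ n) * (\<integral>\<^sup>+x. ennreal ((norm (f (Suc n) x - f n x))\<^sup>2) \<partial>M))"
    by (simp add: ennreal_mult nn_integral_cmult)
  also have "\<dots> \<le> (\<Sum>n. ennreal (4 ^ n) * ennreal ((1/8) ^ n))"
    by (intro suminf_le mult_left_mono fast) auto
  also have "\<dots> = (\<Sum>n. ennreal ((1/2) ^ n))"
    by (simp add: ennreal_mult[symmetric] power_mult_distrib[symmetric])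
  also have "\<dots> < \<infinity>"
    by (subst suminf_ennreal2) (auto intro!: summable_geometric)
  finally have T: "(\<integral>\<^sup>+x. T x \<partial>M) < \<infinity>" .
  show ?thesis
  proof (rule that[of "\<lambda>x. 2 * ennreal ((norm (f 0 x))\<^sup>2) + 8 * T x"])
    show "(\<integral>\<^sup>+x. 2 * ennreal ((norm (f 0 x))\<^sup>2) + 8 * T x \<partial>M) < \<infinity>"
      using T f0 by (simp add: nn_integral_add nn_integral_cmult ennreal_mult_less_top)
    have "AE x in M. T x \<noteq> \<infinity>" using T by (intro nn_integral_PInf_AE) auto
    then show "AE x in M. convergent (\<lambda>n. f n x) \<and>
        (\<forall>n. ennreal ((norm (f n x))\<^sup>2) \<le> 2 * ennreal ((norm (f 0 x))\<^sup>2) + 8 * T x)"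
    proof eventually_elim
      case (elim x)
      then have "T x < \<infinity>" by (simp add: less_top)
      then show ?case
        using fast_Cauchy_pointwise[of "\<lambda>n. f n x"] unfolding T_def by blast
    qed
  qed measurable
qed

lemma L2_dominated_convergence:
  fixes f :: "nat \<Rightarrow> 'a \<Rightarrow> 'b::{real_inner, banach, second_countable_topology}"
  assumes [measurable]: "\<And>n. f n \<in> borel_measurable M" "g \<in> borel_measurable M" "W \<in> borel_measurable M"
    and W: "(\<integral>\<^sup>+x. W x \<partial>M) < \<infinity>"
    and dom: "AE x in M. \<forall>n. ennreal ((norm (f n x))\<^sup>2) \<le> W x"
    and lim: "AE x in M. (\<lambda>n. f n x) \<longlonglongrightarrow> g x"
  shows "(\<lambda>n. \<integral>\<^sup>+x. ennreal ((norm (f n x - g x))\<^sup>2) \<partial>M) \<longlonglongrightarrow> 0"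
    and "AE x in M. ennreal ((norm (g x))\<^sup>2) \<le> W x"
proof -
  show gW: "AE x in M. ennreal ((norm (g x))\<^sup>2) \<le> W x"
    using dom lim
  proof eventually_elim
    case (elim x)
    have "(\<lambda>n. ennreal ((norm (f n x))\<^sup>2)) \<longlonglongrightarrow> ennreal ((norm (g x))\<^sup>2)"
      by (intro tendsto_ennrealI tendsto_power tendsto_norm elim)
    then show ?case by (rule LIMSEQ_le_const2) (use elim in auto)
  qed
  have "(\<lambda>n. \<integral>\<^sup>+x. ennreal ((norm (f n x - g x))\<^sup>2) \<partial>M) \<longlonglongrightarrow> (\<integral>\<^sup>+x. 0 \<partial>M)"
  proof (rule nn_integral_dominated_convergence[where w="\<lambda>x. 4 * W x"])
    show "(\<integral>\<^sup>+x. 4 * W x \<partial>M) < \<infinity>" using W by (simp add: nn_integral_cmult ennreal_mult_less_top)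
    show "AE x in M. ennreal ((norm (f n x - g x))\<^sup>2) \<le> 4 * W x" for n
      using gW dom
    proof eventually_elim
      case (elim x)
      have "ennreal ((norm (f n x - g x))\<^sup>2) \<le> ennreal (2 * (norm (f n x))\<^sup>2 + 2 * (norm (g x))\<^sup>2)"
        by (intro ennreal_leI norm_diff_sq_le)
      also have "\<dots> = 2 * ennreal ((norm (f n x))\<^sup>2) + 2 * ennreal ((norm (g x))\<^sup>2)"
        by (simp add: ennreal_plus ennreal_mult)
      also have "\<dots> \<le> 2 * W x + 2 * W x" using elim by (intro add_mono mult_left_mono) auto
      also have "\<dots> = 4 * W x" by (simp add: distrib_right[symmetric])
      finally show ?case .
    qed
    show "AE x in M. (\<lambda>n. ennreal ((norm (f n x - g x))\<^sup>2)) \<longlonglongrightarrow> 0"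
      using lim
    proof eventually_elim
      case (elim x)
      have "(\<lambda>n. ennreal ((norm (f n x - g x))\<^sup>2)) \<longlonglongrightarrow> ennreal ((norm (g x - g x))\<^sup>2)"
        by (intro tendsto_ennrealI tendsto_power tendsto_norm tendsto_diff elim tendsto_const)
      then show ?case by simp
    qed
  qed measurable
  then show "(\<lambda>n. \<integral>\<^sup>+x. ennreal ((norm (f n x - g x))\<^sup>2) \<partial>M) \<longlonglongrightarrow> 0" by simp
qed

lemma nn_integral_norm_diff_sq_le:
  fixes a b c :: "'a \<Rightarrow> 'b::{real_inner, banach, second_countable_topology}"
  assumes [measurable]: "a \<in> borel_measurable M" "b \<in> borel_measurable M" "c \<in> borel_measurable M"
  shows "(\<integral>\<^sup>+x. ennreal ((norm (a x - b x))\<^sup>2) \<partial>M) \<le>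
    2 * (\<integral>\<^sup>+x. ennreal ((norm (a x - c x))\<^sup>2) \<partial>M) + 2 * (\<integral>\<^sup>+x. ennreal ((norm (b x - c x))\<^sup>2) \<partial>M)"
proof -
  have "(\<integral>\<^sup>+x. ennreal ((norm (a x - b x))\<^sup>2) \<partial>M) \<le>
     (\<integral>\<^sup>+x. 2 * ennreal ((norm (a x - c x))\<^sup>2) + 2 * ennreal ((norm (b x - c x))\<^sup>2) \<partial>M)"
  proof (intro nn_integral_mono)
    fix x
    have "ennreal ((norm (a x - b x))\<^sup>2) = ennreal ((norm ((a x - c x) - (b x - c x)))\<^sup>2)" by simp
    also have "\<dots> \<le> ennreal (2 * (norm (a x - c x))\<^sup>2 + 2 * (norm (b x - c x))\<^sup>2)"
      by (intro ennreal_leI norm_diff_sq_le)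
    also have "\<dots> = 2 * ennreal ((norm (a x - c x))\<^sup>2) + 2 * ennreal ((norm (b x - c x))\<^sup>2)"
      by (simp add: ennreal_plus ennreal_mult)
    finally show "ennreal ((norm (a x - b x))\<^sup>2) \<le> 2 * ennreal ((norm (a x - c x))\<^sup>2) + 2 * ennreal ((norm (b x - c x))\<^sup>2)" .
  qed
  also have "\<dots> = 2 * (\<integral>\<^sup>+x. ennreal ((norm (a x - c x))\<^sup>2) \<partial>M) + 2 * (\<integral>\<^sup>+x. ennreal ((norm (b x - c x))\<^sup>2) \<partial>M)"
    by (simp add: nn_integral_add nn_integral_cmult)
  finally show ?thesis .
qed

text \<open>Along a sequence converging fast in \<open>L\<^sup>q\<close>, the convergence is almost everywhere.\<close>

lemma fast_convergence_AE:
  fixes g :: "nat \<Rightarrow> 'a \<Rightarrow> real"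
  assumes [measurable]: "\<And>n. g n \<in> borel_measurable M" and q: "q > 0"
    and fast: "\<And>n. (\<integral>\<^sup>+x. ennreal (\<bar>g n x\<bar> powr q) \<partial>M) \<le> ennreal ((1/2) ^ n)"
  shows "AE x in M. (\<lambda>n. g n x) \<longlonglongrightarrow> 0"
proof -
  have "(\<integral>\<^sup>+x. (\<Sum>n. ennreal (\<bar>g n x\<bar> powr q)) \<partial>M) = (\<Sum>n. \<integral>\<^sup>+x. ennreal (\<bar>g n x\<bar> powr q) \<partial>M)"
    by (rule nn_integral_suminf) measurable
  also have "\<dots> \<le> (\<Sum>n. ennreal ((1/2) ^ n))" by (intro suminf_le fast) auto
  also have "\<dots> < \<infinity>"
    by (subst suminf_ennreal2) (auto intro!: summable_geometric)
  finally have "AE x in M. (\<Sum>n. ennreal (\<bar>g n x\<bar> powr q)) \<noteq> \<infinity>"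
    by (intro nn_integral_PInf_AE) auto
  then show ?thesis
  proof eventually_elim
    case (elim x)
    then have "summable (\<lambda>n. \<bar>g n x\<bar> powr q)"
      by (intro summable_suminf_not_top) auto
    then have "(\<lambda>n. \<bar>g n x\<bar> powr q) \<longlonglongrightarrow> 0" by (rule summable_LIMSEQ_zero)
    then have "(\<lambda>n. (\<bar>g n x\<bar> powr q) powr (1 / q)) \<longlonglongrightarrow> 0 powr (1 / q)"
      using q by (intro tendsto_powr2) (auto simp: always_eventually)
    then have "(\<lambda>n. \<bar>g n x\<bar>) \<longlonglongrightarrow> 0" using q by (simp add: powr_powr)
    then show ?case by (simp add: tendsto_rabs_zero_iff)
  qed
qed

section \<open>The Sobolev inequality\<close>

lemma abs_powr_has_derivative:
  fixes q :: real
  assumes q: "q > 1"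
  shows "((\<lambda>y. \<bar>y\<bar> powr q) has_real_derivative q * \<bar>y\<bar> powr (q - 1) * sgn y) (at y)"
proof -
  consider "y > 0" | "y < 0" | "y = 0" by linarith
  then show ?thesis
  proof cases
    case 1
    have "((\<lambda>y. y powr q) has_real_derivative q * \<bar>y\<bar> powr (q - 1) * sgn y) (at y)"
      using 1 by (auto intro!: derivative_eq_intros)
    then show ?thesis
      by (rule has_field_derivative_transform_within_open[where S="{0<..}"]) (use 1 in auto)
  next
    case 2
    have "((\<lambda>y. (- y) powr q) has_real_derivative q * \<bar>y\<bar> powr (q - 1) * sgn y) (at y)"
      using 2 by (auto intro!: derivative_eq_intros)
    then show ?thesis
      by (rule has_field_derivative_transform_within_open[where S="{..<0}"]) (use 2 in auto)
  next
    case 3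
    have "((\<lambda>h::real. \<bar>h\<bar> powr (q - 1)) \<longlongrightarrow> \<bar>0\<bar> powr (q - 1)) (at 0)"
      using q by (intro tendsto_powr2 tendsto_intros) (auto simp: always_eventually)
    then have "((\<lambda>h::real. \<bar>h\<bar> powr (q - 1)) \<longlongrightarrow> 0) (at 0)" using q by simp
    then have "((\<lambda>h::real. \<bar>h\<bar> powr q / h) \<longlongrightarrow> 0) (at 0)"
    proof (rule Lim_null_comparison[rotated])
      show "\<forall>\<^sub>F h::real in at 0. norm (\<bar>h\<bar> powr q / h) \<le> \<bar>h\<bar> powr (q - 1)"
        unfolding eventually_at_filter by (rule always_eventually) (auto simp: powr_diff)
    qed
    then show ?thesis using 3 q by (simp add: has_field_derivative_iff)
  qed
qed

lemma continuous_abs_powr_sgn: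
  fixes q :: real
  assumes "q > 0"
  shows "continuous_on UNIV (\<lambda>y. \<bar>y\<bar> powr q * sgn y)"
proof -
  have "continuous_on ({0..} \<union> {..0}) (\<lambda>y::real. if 0 \<le> y then y powr q else - ((- y) powr q))"
    by (rule continuous_on_cases) (use assms in \<open>auto intro!: continuous_intros continuous_on_powr'\<close>)
  moreover have "({0..} \<union> {..0}) = (UNIV :: real set)" by auto
  moreover have "(\<lambda>y::real. if 0 \<le> y then y powr q else - ((- y) powr q)) = (\<lambda>y. \<bar>y\<bar> powr q * sgn y)"
    using assms by (auto simp: sgn_if)
  ultimately show ?thesis by (simp only:)
qed

text \<open>The fundamental theorem of calculus for \<open>\<bar>\<phi>\<bar> powr q\<close> on a line parallel to a coordinate axis, started
  outside the support of \<open>\<phi>\<close>. The exponent \<open>q > 1\<close> makes this power continuously differentiable.\<close>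

lemma abs_powr_le_line_integral:
  fixes \<phi> :: "'a::euclidean_space \<Rightarrow> real"
  assumes \<phi>: "test_fun \<phi>" and q: "q > 1" and b: "b \<in> Basis"
  shows "ennreal (\<bar>\<phi> x\<bar> powr q) \<le>
    (\<integral>\<^sup>+t. ennreal (q * \<bar>\<phi> (x + t *\<^sub>R b)\<bar> powr (q - 1) * norm (grad \<phi> (x + t *\<^sub>R b))) \<partial>lborel)"
proof -
  obtain R where R: "R > 0" "\<And>x. R < norm x \<Longrightarrow> \<phi> x = 0" "\<And>x. R < norm x \<Longrightarrow> grad \<phi> x = 0"
    using test_fun_support[OF \<phi>] by blast
  define T where "T = R + norm x + 1"
  have T: "T > 0" using R(1) by (simp add: T_def add_pos_nonneg)
  have nb: "norm b = 1" using b by simp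
  define w where "w t = \<bar>\<phi> (x + t *\<^sub>R b)\<bar> powr q" for t
  define w' where "w' t = q * \<bar>\<phi> (x + t *\<^sub>R b)\<bar> powr (q - 1) * sgn (\<phi> (x + t *\<^sub>R b)) * (grad \<phi> (x + t *\<^sub>R b) \<bullet> b)" for t
  have line: "((\<lambda>t. \<phi> (x + t *\<^sub>R b)) has_real_derivative (grad \<phi> (x + t *\<^sub>R b) \<bullet> b)) (at t)" for t
  proof -
    have "((\<lambda>t. x + t *\<^sub>R b) has_derivative (\<lambda>s. s *\<^sub>R b)) (at t)"
      by (auto intro!: derivative_eq_intros)
    from has_derivative_compose[OF this test_fun_has_derivative[OF \<phi>]]
    have "((\<lambda>t. \<phi> (x + t *\<^sub>R b)) has_derivative (\<lambda>s. grad \<phi> (x + t *\<^sub>R b) \<bullet> (s *\<^sub>R b))) (at t)" .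
    then show ?thesis by (simp add: has_field_derivative_def mult.commute[of _ "_ \<bullet> _"])
  qed
  have der: "(w has_real_derivative w' t) (at t)" for t
    unfolding w_def w'_def using DERIV_chain2[OF abs_powr_has_derivative[OF q] line] .
  have cont: "continuous_on UNIV w'"
  proof -
    have 1: "continuous_on UNIV (\<lambda>t. x + t *\<^sub>R b)" by (intro continuous_intros)
    have "continuous_on UNIV (\<lambda>t. \<phi> (x + t *\<^sub>R b))"
      by (rule continuous_on_compose2[OF test_fun_continuous[OF \<phi>, of UNIV] 1]) simp
    from continuous_on_compose2[OF continuous_abs_powr_sgn[of "q - 1"] this]
    have 2: "continuous_on UNIV (\<lambda>t. \<bar>\<phi> (x + t *\<^sub>R b)\<bar> powr (q - 1) * sgn (\<phi> (x + t *\<^sub>R b)))"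
      using q by simp
    have 3: "continuous_on UNIV (\<lambda>t. grad \<phi> (x + t *\<^sub>R b))"
      by (rule continuous_on_compose2[OF test_fun_grad_continuous[OF \<phi>, of UNIV] 1]) simp
    have "continuous_on UNIV (\<lambda>t. q * (\<bar>\<phi> (x + t *\<^sub>R b)\<bar> powr (q - 1) * sgn (\<phi> (x + t *\<^sub>R b))) * (grad \<phi> (x + t *\<^sub>R b) \<bullet> b))"
      by (intro continuous_intros 2 3)
    then show ?thesis unfolding w'_def[abs_def] by (simp add: mult.assoc)
  qed
  have "R < norm (x + (- T) *\<^sub>R b)"
  proof -
    have "norm ((- T) *\<^sub>R b) \<le> norm (x + (- T) *\<^sub>R b) + norm x"
      using norm_triangle_ineq4[of "x + (- T) *\<^sub>R b" x] by simp
    then show ?thesis using T nb by (simp add: T_def)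
  qed
  then have w0: "w (- T) = 0" using R(2) by (simp add: w_def)
  have "has_bochner_integral lborel (\<lambda>t. indicator {- T..0} t *\<^sub>R w' t) (w 0 - w (- T))"
    by (rule has_bochner_integral_FTC_Icc)
       (use T cont in \<open>auto intro: der[THEN has_field_derivative_at_within] continuous_on_subset simp: has_real_derivative_iff_has_vector_derivative[symmetric]\<close>)
  then have i: "integrable lborel (\<lambda>t. indicator {- T..0} t *\<^sub>R w' t)" 
    "(LINT t|lborel. indicator {- T..0} t *\<^sub>R w' t) = w 0"
    using w0 by (auto simp: has_bochner_integral_iff)
  have "ennreal (\<bar>\<phi> x\<bar> powr q) = ennreal (norm (LINT t|lborel. indicator {- T..0} t *\<^sub>R w' t))"
    unfolding i(2) by (simp add: w_def)
  also have "\<dots> \<le> (\<integral>\<^sup>+t. ennreal (norm (indicator {- T..0} t *\<^sub>R w' t)) \<partial>lborel)"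
    by (rule integral_norm_bound_ennreal[OF i(1)])
  also have "\<dots> \<le> (\<integral>\<^sup>+t. ennreal (q * \<bar>\<phi> (x + t *\<^sub>R b)\<bar> powr (q - 1) * norm (grad \<phi> (x + t *\<^sub>R b))) \<partial>lborel)"
  proof (intro nn_integral_mono ennreal_leI)
    fix t
    let ?y = "x + t *\<^sub>R b"
    have "norm (indicator {- T..0} t *\<^sub>R w' t) \<le> \<bar>w' t\<bar>" by (auto simp: indicator_def)
    also have "\<dots> = q * \<bar>\<phi> ?y\<bar> powr (q - 1) * (\<bar>sgn (\<phi> ?y)\<bar> * \<bar>grad \<phi> ?y \<bullet> b\<bar>)"
      using q by (simp add: w'_def abs_mult)
    also have "\<dots> \<le> q * \<bar>\<phi> ?y\<bar> powr (q - 1) * (1 * norm (grad \<phi> ?y))"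
      using q Basis_le_norm[OF b, of "grad \<phi> ?y"] by (intro mult_left_mono mult_mono) (auto simp: sgn_if)
    finally show "norm (indicator {- T..0} t *\<^sub>R w' t) \<le> q * \<bar>\<phi> ?y\<bar> powr (q - 1) * norm (grad \<phi> ?y)" by simp
  qed
  finally show ?thesis .
qed

lemma test_fun_powr_integrable:
  fixes \<phi> :: "'a::euclidean_space \<Rightarrow> real"
  assumes \<phi>: "test_fun \<phi>" and p: "p > 0"
  shows "(\<integral>\<^sup>+x. ennreal (\<bar>\<phi> x\<bar> powr p) \<partial>lborel) < \<infinity>"
proof -
  obtain R where R: "R > 0" "\<And>x. R < norm x \<Longrightarrow> \<phi> x = 0" "\<And>x. R < norm x \<Longrightarrow> grad \<phi> x = 0"
    using test_fun_support[OF \<phi>] by blast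
  have "integrable lborel (\<lambda>x. \<bar>\<phi> x\<bar> powr p)"
  proof (rule integrable_compact_support)
    show "continuous_on UNIV (\<lambda>x. \<bar>\<phi> x\<bar> powr p)"
      using p by (intro continuous_on_powr' continuous_intros test_fun_continuous[OF \<phi>]) auto
    show "\<bar>\<phi> x\<bar> powr p = 0" if "R < norm x" for x using R(2)[OF that] by simp
  qed
  then show ?thesis by (simp add: integrable_iff_bounded)
qed

text \<open>A (non-optimal) constant in the Sobolev inequality below, where the inequality is raised to a power.\<close>

definition sobolev_const :: "nat \<Rightarrow> real" where
  "sobolev_const n = (2 * (real n - 1) / (real n - 2)) ^ (2 * n)"

text \<open>The Sobolev inequality for the exponent \<open>2 * n / (n - 2)\<close>, raised to the power that clears all roots.
  Gagliardo's inequality is applied to \<open>\<bar>\<phi>\<bar> powr q\<close> with \<open>q = 2 * (n - 1) / (n - 2)\<close>; the gradient of that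
  power is then split by the Cauchy-Schwarz inequality, and \<open>q\<close> is chosen so that the factor
  without gradient is again the integral on the left.\<close>

lemma sobolev_inequality:
  fixes \<phi> :: "'a::euclidean_space \<Rightarrow> real"
  assumes \<phi>: "test_fun \<phi>" and n: "DIM('a) \<ge> 3"
  shows "(\<integral>\<^sup>+x. ennreal (\<bar>\<phi> x\<bar> powr crit_exp DIM('a) 1) \<partial>lborel) ^ (DIM('a) - 2) \<le>
    ennreal (sobolev_const DIM('a)) * (\<integral>\<^sup>+x. ennreal ((norm (grad \<phi> x))\<^sup>2) \<partial>lborel) ^ DIM('a)"
proof -
  define n where "n = DIM('a)"
  have n3: "n \<ge> 3" using n by (simp add: n_def)
  define p where "p = crit_exp n 1"
  define q where "q = 2 * (real n - 1) / (real n - 2)"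
  have q: "q > 1" using n3 by (simp add: q_def field_simps)
  have p: "p > 0" using n3 by (simp add: p_def crit_exp_def)
  have pq: "p * real (n - 1) = q * real n" "2 * (q - 1) = p"
    using n3 by (simp_all add: p_def q_def crit_exp_def of_nat_diff field_simps)
  note [measurable] = test_fun_borel[OF \<phi>] test_fun_grad_borel[OF \<phi>]
  define I where "I = (\<integral>\<^sup>+x. ennreal (\<bar>\<phi> x\<bar> powr p) \<partial>lborel)"
  define D where "D = (\<integral>\<^sup>+x. ennreal ((norm (grad \<phi> x))\<^sup>2) \<partial>lborel)"
  define A where "A = (\<integral>\<^sup>+x. ennreal (q * \<bar>\<phi> x\<bar> powr (q - 1) * norm (grad \<phi> x)) \<partial>lborel)"
  have 1: "I ^ (n - 1) \<le> A ^ n"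
  proof -
    have "I ^ (DIM('a) - 1) \<le> (\<Prod>i\<in>(Basis :: 'a set). A)"
      unfolding I_def A_def
    proof (rule gagliardo_inequality)
      show "DIM('a) \<ge> 2" using n by simp
      fix x
      have "ennreal (\<bar>\<phi> x\<bar> powr p) ^ (DIM('a) - 1) = ennreal ((\<bar>\<phi> x\<bar> powr p) ^ (n - 1))"
        by (simp add: ennreal_power n_def)
      also have "(\<bar>\<phi> x\<bar> powr p) ^ (n - 1) = (\<bar>\<phi> x\<bar> powr q) ^ n"
      proof (cases "\<phi> x = 0")
        case True
        then show ?thesis using n3 by (simp add: power_0_left)
      next
        case False
        then have "(\<bar>\<phi> x\<bar> powr p) ^ (n - 1) = \<bar>\<phi> x\<bar> powr (p * real (n - 1))"
          by (simp add: powr_powr powr_realpow[symmetric])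
        also have "\<dots> = (\<bar>\<phi> x\<bar> powr q) ^ n"
          unfolding pq using False by (simp add: powr_powr powr_realpow[symmetric])
        finally show ?thesis .
      qed
      also have "ennreal ((\<bar>\<phi> x\<bar> powr q) ^ n) = (\<Prod>i\<in>(Basis :: 'a set). ennreal (\<bar>\<phi> x\<bar> powr q))"
        by (simp add: ennreal_power n_def)
      also have "\<dots> \<le> (\<Prod>i\<in>(Basis :: 'a set). \<integral>\<^sup>+t. ennreal (q * \<bar>\<phi> (x + t *\<^sub>R i)\<bar> powr (q - 1) * norm (grad \<phi> (x + t *\<^sub>R i))) \<partial>lborel)"
        by (intro prod_mono_ennreal abs_powr_le_line_integral \<phi> q)
      finally show "ennreal (\<bar>\<phi> x\<bar> powr p) ^ (DIM('a) - 1) \<le> (\<Prod>i\<in>(Basis :: 'a set). \<integral>\<^sup>+t. ennreal (q * \<bar>\<phi> (x + t *\<^sub>R i)\<bar> powr (q - 1) * norm (grad \<phi> (x + t *\<^sub>R i))) \<partial>lborel)" .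
    qed measurable
    then show ?thesis by (simp add: n_def)
  qed
  have 2: "A\<^sup>2 \<le> ennreal (q\<^sup>2) * I * D"
  proof -
    have "A = (\<integral>\<^sup>+x. ennreal (q * \<bar>\<phi> x\<bar> powr (q - 1)) * ennreal (norm (grad \<phi> x)) \<partial>lborel)"
      unfolding A_def using q by (intro nn_integral_cong ennreal_mult) auto
    then have "A\<^sup>2 \<le> (\<integral>\<^sup>+x. ennreal (q * \<bar>\<phi> x\<bar> powr (q - 1)) ^ 2 \<partial>lborel) * (\<integral>\<^sup>+x. ennreal (norm (grad \<phi> x)) ^ 2 \<partial>lborel)"
      by (simp only:) (rule Cauchy_Schwarz_nn_integral; measurable)
    also have "(\<integral>\<^sup>+x. ennreal (norm (grad \<phi> x)) ^ 2 \<partial>lborel) = D"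
      unfolding D_def by (simp add: ennreal_power)
    also have "(\<integral>\<^sup>+x. ennreal (q * \<bar>\<phi> x\<bar> powr (q - 1)) ^ 2 \<partial>lborel) = (\<integral>\<^sup>+x. ennreal (q\<^sup>2) * ennreal (\<bar>\<phi> x\<bar> powr p) \<partial>lborel)"
    proof (intro nn_integral_cong)
      fix x
      have "(q * \<bar>\<phi> x\<bar> powr (q - 1))\<^sup>2 = q\<^sup>2 * \<bar>\<phi> x\<bar> powr p"
        unfolding pq(2)[symmetric] power_mult_distrib power2_eq_square[of "_ powr _"] powr_add[symmetric] by (simp only: mult_2)
      then show "ennreal (q * \<bar>\<phi> x\<bar> powr (q - 1)) ^ 2 = ennreal (q\<^sup>2) * ennreal (\<bar>\<phi> x\<bar> powr p)"
        using q by (simp add: ennreal_power ennreal_mult[symmetric])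
    qed
    also have "\<dots> = ennreal (q\<^sup>2) * I" unfolding I_def by (rule nn_integral_cmult) measurable
    finally show ?thesis .
  qed
  \<comment> \<open>The common factor \<open>I ^ n\<close> can be cancelled because \<open>I\<close> is finite for a test function.\<close>
  have "I ^ n * I ^ (n - 2) = (I ^ (n - 1))\<^sup>2"
  proof -
    have "n + (n - 2) = (n - 1) * 2" using n3 by simp
    then show ?thesis by (simp only: power_add[symmetric] power_mult[symmetric])
  qed
  also have "\<dots> \<le> (A ^ n)\<^sup>2" using 1 by (rule power_mono) simp
  also have "\<dots> = (A\<^sup>2) ^ n" by (simp only: power_mult[symmetric] mult.commute)
  also have "\<dots> \<le> (ennreal (q\<^sup>2) * I * D) ^ n" using 2 by (rule power_mono) simp
  also have "\<dots> = I ^ n * (ennreal (sobolev_const n) * D ^ n)"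
  proof -
    have "ennreal (q\<^sup>2) ^ n = ennreal (sobolev_const n)"
      by (simp add: ennreal_power sobolev_const_def q_def power_mult)
    then show ?thesis by (simp only: power_mult_distrib mult_ac)
  qed
  finally have "I ^ n * I ^ (n - 2) \<le> I ^ n * (ennreal (sobolev_const n) * D ^ n)" .
  moreover have "I \<noteq> top" unfolding I_def using test_fun_powr_integrable[OF \<phi> p] by simp
  ultimately have "I ^ (n - 2) \<le> ennreal (sobolev_const n) * D ^ n"
  proof (cases "I = 0")
    case True
    then show ?thesis using n3 by (simp add: power_0_left)
  next
    case False
    then have "I ^ n \<noteq> 0" "I ^ n \<noteq> top" using \<open>I \<noteq> top\<close> by (auto simp: power_eq_top_ennreal)
    with \<open>I ^ n * I ^ (n - 2) \<le> _\<close> show ?thesis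
      by (simp add: ennreal_mult_le_mult_iff)
  qed
  then show ?thesis unfolding I_def D_def p_def n_def .
qed

section \<open>Finiteness of the Gagliardo seminorm on test functions\<close>

lemma dyadic_inside:
  fixes x :: real
  assumes "0 < x" "x \<le> 1"
  obtains k :: nat where "(1/2) ^ Suc k < x" "x \<le> (1/2) ^ k"
proof -
  obtain m where m: "(1/2::real) ^ m < x" using real_arch_pow_inv[of x "1/2"] assms by auto
  define l where "l = (LEAST m. (1/2::real) ^ m < x)"
  have l: "(1/2) ^ l < x" unfolding l_def using m by (rule LeastI)
  then have "l \<noteq> 0" using assms by (intro notI) simp
  then obtain k where k: "l = Suc k" by (cases l) auto
  have "\<not> (1/2) ^ k < x" using not_less_Least[of k "\<lambda>m. (1/2::real) ^ m < x"] k l_def by auto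
  then show ?thesis using that[of k] l k by simp
qed

lemma dyadic_outside:
  fixes x :: real
  assumes "1 < x"
  obtains k :: nat where "2 ^ k < x" "x \<le> 2 ^ Suc k"
proof -
  obtain m where m: "x < (2::real) ^ m" using real_arch_pow[of 2 x] by auto
  define l where "l = (LEAST m. x \<le> (2::real) ^ m)"
  have l: "x \<le> 2 ^ l" unfolding l_def using m by (intro LeastI) (rule less_imp_le)
  then have "l \<noteq> 0" using assms by (intro notI) simp
  then obtain k where k: "l = Suc k" by (cases l) auto
  have "\<not> x \<le> 2 ^ k" using not_less_Least[of k "\<lambda>m. x \<le> (2::real) ^ m"] k l_def by auto
  then show ?thesis using that[of k] l k by simp
qed

lemma suminf_cball_finite:
  fixes c d :: real
  assumes "0 \<le> c" "0 \<le> b" "0 \<le> r" "0 < t" "b * t ^ DIM('a::euclidean_space) < 1"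
  shows "(\<integral>\<^sup>+z. (\<Sum>k. ennreal (c * b ^ k) * indicator (cball (0::'a) (r * t ^ k)) z) \<partial>lborel) < \<infinity>"
proof -
  define v where "v = unit_ball_vol (real DIM('a))"
  have v: "v \<ge> 0" by (simp add: v_def)
  have [measurable]: "cball (0::'a) \<rho> \<in> sets borel" for \<rho> by simp
  have "(\<integral>\<^sup>+z. (\<Sum>k. ennreal (c * b ^ k) * indicator (cball (0::'a) (r * t ^ k)) z) \<partial>lborel)
     = (\<Sum>k. \<integral>\<^sup>+z. ennreal (c * b ^ k) * indicator (cball (0::'a) (r * t ^ k)) z \<partial>lborel)"
    by (rule nn_integral_suminf) measurable
  also have "\<dots> = (\<Sum>k. ennreal (c * v * r ^ DIM('a) * (b * t ^ DIM('a)) ^ k))"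
  proof (intro suminf_cong)
    fix k
    have "(\<integral>\<^sup>+z. ennreal (c * b ^ k) * indicator (cball (0::'a) (r * t ^ k)) z \<partial>lborel)
       = ennreal (c * b ^ k) * ennreal (v * (r * t ^ k) ^ DIM('a))"
      unfolding v_def using assms by (subst nn_integral_cmult_indicator) (auto simp: emeasure_cball)
    also have "\<dots> = ennreal (c * v * r ^ DIM('a) * (b * t ^ DIM('a)) ^ k)"
      using assms v by (simp add: ennreal_mult[symmetric] power_mult_distrib power_mult[symmetric] mult_ac)
    finally show "(\<integral>\<^sup>+z. ennreal (c * b ^ k) * indicator (cball (0::'a) (r * t ^ k)) z \<partial>lborel)
       = ennreal (c * v * r ^ DIM('a) * (b * t ^ DIM('a)) ^ k)" .
  qed
  also have "\<dots> = ennreal (\<Sum>k. c * v * r ^ DIM('a) * (b * t ^ DIM('a)) ^ k)"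
    using assms v by (intro suminf_ennreal2) (auto intro!: summable_mult summable_geometric)
  also have "\<dots> < \<infinity>" by simp
  finally show ?thesis .
qed

text \<open>The truncated kernel is integrable near the origin because \<open>s < 1\<close> and at infinity because \<open>s > 0\<close>.
  It is bounded by step functions on balls of dyadic radii, whose integrals form geometric series.\<close>

lemma fractional_kernel_finite:
  assumes s: "0 < s" "s < 1"
  shows "(\<integral>\<^sup>+z. ennreal (min 1 ((norm z)\<^sup>2) / norm z powr (real DIM('a) + 2 * s)) \<partial>(lborel :: 'a::euclidean_space measure)) < \<infinity>"
proof -
  define N where "N = real DIM('a)"
  define a where "a = N + 2 * s - 2"
  define S1 where "S1 z = (\<Sum>k. ennreal (2 powr \<bar>a\<bar> * (2 powr a) ^ k) * indicator (cball (0::'a) (1 * (1/2) ^ k)) z)" for z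
  define S2 where "S2 z = (\<Sum>k. ennreal (1 * (2 powr (- (N + 2 * s))) ^ k) * indicator (cball (0::'a) (2 * 2 ^ k)) z)" for z
  have 1: "(\<integral>\<^sup>+z. S1 z \<partial>lborel) < \<infinity>"
    unfolding S1_def
  proof (rule suminf_cball_finite)
    have "2 powr a * (1/2) ^ DIM('a) = 2 powr (2 * s - 2)"
      unfolding a_def N_def by (simp add: powr_add powr_diff powr_realpow power_one_over divide_simps)
    also have "\<dots> < 2 powr 0" using s by (intro powr_less_mono) auto
    finally show "2 powr a * (1/2) ^ DIM('a) < 1" by simp
  qed auto
  have 2: "(\<integral>\<^sup>+z. S2 z \<partial>lborel) < \<infinity>"
    unfolding S2_def
  proof (rule suminf_cball_finite)
    have "2 powr (- (N + 2 * s)) * 2 ^ DIM('a) = 2 powr (- (2 * s))"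
      unfolding N_def by (simp add: powr_add powr_minus powr_diff powr_realpow divide_simps)
    also have "\<dots> < 2 powr 0" using s by (intro powr_less_mono) auto
    finally show "2 powr (- (N + 2 * s)) * 2 ^ DIM('a) < 1" by simp
  qed auto
  have le: "ennreal (min 1 ((norm z)\<^sup>2) / norm z powr (N + 2 * s)) \<le> S1 z + S2 z" for z :: 'a
  proof -
    consider "z = 0" | "0 < norm z" "norm z \<le> 1" | "1 < norm z" by fastforce
    then show ?thesis
    proof cases
      case 2
      then obtain k where k: "(1/2) ^ Suc k < norm z" "norm z \<le> (1/2) ^ k" by (rule dyadic_inside)
      have "(norm z)\<^sup>2 \<le> 1" using 2 by (simp add: power_le_one)
      then have "min 1 ((norm z)\<^sup>2) / norm z powr (N + 2 * s) = norm z powr 2 / norm z powr (N + 2 * s)"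
        using 2 by (simp add: min_def powr_numeral)
      also have "\<dots> = norm z powr (- a)" unfolding a_def powr_diff[symmetric] by (simp add: algebra_simps)
      also have "\<dots> \<le> 2 powr \<bar>a\<bar> * (2 powr a) ^ k"
      proof (cases "a \<ge> 0")
        case True
        have "norm z powr (- a) \<le> ((1/2) ^ Suc k) powr (- a)"
          using True k by (intro powr_mono2') auto
        also have "\<dots> = (2 powr (- real (Suc k))) powr (- a)"
          by (simp only: powr_minus powr_realpow zero_less_numeral power_one_over inverse_eq_divide)
        also have "\<dots> = 2 powr \<bar>a\<bar> * (2 powr a) ^ k"
          using True by (simp add: powr_powr powr_realpow[symmetric] powr_add[symmetric] algebra_simps)
        finally show ?thesis .
      next
        case False
        have "norm z powr (- a) \<le> ((1/2) ^ k) powr (- a)"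
          using False k by (intro powr_mono2) auto
        also have "\<dots> = (2 powr (- real k)) powr (- a)"
          by (simp only: powr_minus powr_realpow zero_less_numeral power_one_over inverse_eq_divide)
        also have "\<dots> = 1 * (2 powr a) ^ k"
          by (simp add: powr_powr powr_realpow[symmetric] algebra_simps)
        also have "\<dots> \<le> 2 powr \<bar>a\<bar> * (2 powr a) ^ k"
          by (intro mult_right_mono) (auto intro!: ge_one_powr_ge_zero)
        finally show ?thesis .
      qed
      finally have "ennreal (min 1 ((norm z)\<^sup>2) / norm z powr (N + 2 * s)) \<le>
          ennreal (2 powr \<bar>a\<bar> * (2 powr a) ^ k) * indicator (cball (0::'a) (1 * (1/2) ^ k)) z"
        using k by (simp add: ennreal_leI)
      also have "\<dots> \<le> S1 z" unfolding S1_def by (rule le_suminf_ennreal)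
      also have "\<dots> \<le> S1 z + S2 z" by simp
      finally show ?thesis .
    next
      case 3
      then obtain k where k: "2 ^ k < norm z" "norm z \<le> 2 ^ Suc k" by (rule dyadic_outside)
      have "min 1 ((norm z)\<^sup>2) / norm z powr (N + 2 * s) \<le> 1 / norm z powr (N + 2 * s)"
        by (intro divide_right_mono) auto
      also have "\<dots> = norm z powr (- (N + 2 * s))" by (simp only: powr_minus inverse_eq_divide)
      also have "\<dots> \<le> (2 ^ k) powr (- (N + 2 * s))"
        using k s by (intro powr_mono2') (auto simp: N_def)
      also have "\<dots> = 1 * (2 powr (- (N + 2 * s))) ^ k"
        by (simp add: powr_powr powr_realpow[symmetric] algebra_simps)
      finally have "ennreal (min 1 ((norm z)\<^sup>2) / norm z powr (N + 2 * s)) \<le>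
          ennreal (1 * (2 powr (- (N + 2 * s))) ^ k) * indicator (cball (0::'a) (2 * 2 ^ k)) z"
        using k by (simp add: ennreal_leI)
      also have "\<dots> \<le> S2 z" unfolding S2_def by (rule le_suminf_ennreal)
      also have "\<dots> \<le> S1 z + S2 z" by simp
      finally show ?thesis .
    qed simp
  qed
  have [measurable]: "cball (0::'a) \<rho> \<in> sets borel" for \<rho> by simp
  have [measurable]: "S1 \<in> borel_measurable borel" "S2 \<in> borel_measurable borel"
    unfolding S1_def[abs_def] S2_def[abs_def] by measurable
  have "(\<integral>\<^sup>+z. ennreal (min 1 ((norm z)\<^sup>2) / norm z powr (N + 2 * s)) \<partial>(lborel :: 'a measure)) \<le> (\<integral>\<^sup>+z. S1 z + S2 z \<partial>lborel)"
    by (intro nn_integral_mono le)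
  also have "\<dots> = (\<integral>\<^sup>+z. S1 z \<partial>lborel) + (\<integral>\<^sup>+z. S2 z \<partial>lborel)"
    by (rule nn_integral_add) measurable
  also have "\<dots> < \<infinity>" using 1 2 by simp
  finally show ?thesis unfolding N_def .
qed

text \<open>The difference quotient whose square integral over pairs of points is the Gagliardo seminorm; its
  value on the diagonal is \<open>0\<close>.\<close>

definition gagliardo_quotient :: "real \<Rightarrow> ('a::euclidean_space \<Rightarrow> real) \<Rightarrow> 'a \<times> 'a \<Rightarrow> real" where
  "gagliardo_quotient s f z =
     (f (fst z) - f (snd z)) / norm (fst z - snd z) powr ((real DIM('a) + 2 * s) / 2)"

lemma gagliardo_quotient_sq:
  "(norm (gagliardo_quotient s f (x, y)))\<^sup>2 = \<bar>f x - f y\<bar>\<^sup>2 / norm (x - y) powr (real DIM('a) + 2 * s)"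
  for x y :: "'a::euclidean_space"
proof -
  have "(norm (x - y) powr ((real DIM('a) + 2 * s) / 2))\<^sup>2 = norm (x - y) powr (real DIM('a) + 2 * s)"
    by (simp add: power2_eq_square powr_add[symmetric])
  then show ?thesis by (simp add: gagliardo_quotient_def power_divide)
qed

lemma gagliardo_quotient_measurable [measurable]:
  assumes [measurable]: "f \<in> borel_measurable borel"
  shows "gagliardo_quotient s f \<in> borel_measurable (borel \<Otimes>\<^sub>M borel)"
  unfolding gagliardo_quotient_def[abs_def] by measurable

lemma X_norm_sq_eq:
  fixes f :: "'a::euclidean_space \<Rightarrow> real"
  assumes [measurable]: "f \<in> borel_measurable borel"
  shows "X_norm_sq s f = (\<integral>\<^sup>+x. ennreal ((norm (grad f x))\<^sup>2) \<partial>lebesgue) +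
     (\<integral>\<^sup>+z. ennreal ((norm (gagliardo_quotient s f z))\<^sup>2) \<partial>(lborel \<Otimes>\<^sub>M lborel))"
proof -
  have "(\<integral>\<^sup>+z. ennreal ((norm (gagliardo_quotient s f z))\<^sup>2) \<partial>(lborel \<Otimes>\<^sub>M lborel))
      = (\<integral>\<^sup>+x. \<integral>\<^sup>+y. ennreal ((norm (gagliardo_quotient s f (x, y)))\<^sup>2) \<partial>lborel \<partial>lborel)"
    by (rule lborel.nn_integral_fst[symmetric]) measurable
  then show ?thesis
    unfolding X_norm_sq_def by (simp only: gagliardo_quotient_sq nn_integral_completion)
qed

lemma nn_integral_lborel_shift_norm:
  fixes k :: "real \<Rightarrow> ennreal" and a :: "'a::euclidean_space"
  assumes [measurable]: "k \<in> borel_measurable borel"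
  shows "(\<integral>\<^sup>+x. k (norm (a - x)) \<partial>lborel) = (\<integral>\<^sup>+x. k (norm x) \<partial>(lborel :: 'a measure))"
proof -
  have "(\<integral>\<^sup>+x. k (norm x) \<partial>(lborel :: 'a measure)) = (\<integral>\<^sup>+x. k (norm x) \<partial>distr lborel borel ((+) (- a)))"
    by (simp add: lborel_distr_plus)
  also have "\<dots> = (\<integral>\<^sup>+x. k (norm (- a + x)) \<partial>lborel)" by (rule nn_integral_distr) measurable
  also have "\<dots> = (\<integral>\<^sup>+x. k (norm (a - x)) \<partial>lborel)"
    by (intro nn_integral_cong arg_cong[of _ _ k]) (simp add: norm_minus_commute)
  finally show ?thesis by simp
qed

text \<open>The quotient vanishes unless one of the two points lies in a ball containing the support; the other
  point is then integrated out with the truncated kernel, which controls the squared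
  increments by the Lipschitz bound nearby and by the supremum bound far away.\<close>

lemma test_fun_gagliardo_finite:
  fixes f :: "'a::euclidean_space \<Rightarrow> real"
  assumes f: "test_fun f" and s: "0 < s" "s < 1"
  shows "(\<integral>\<^sup>+z. ennreal ((norm (gagliardo_quotient s f z))\<^sup>2) \<partial>(lborel \<Otimes>\<^sub>M lborel)) < \<infinity>"
proof -
  obtain R where R: "R > 0" "\<And>x. R < norm x \<Longrightarrow> f x = 0" "\<And>x. R < norm x \<Longrightarrow> grad f x = 0"
    using test_fun_support[OF f] by blast
  obtain B where B: "B > 0" "\<And>x. \<bar>f x\<bar> \<le> B" using test_fun_bounded[OF f] by blast
  obtain L where L: "L > 0" "\<And>x. norm (grad f x) \<le> L" using test_fun_grad_bounded[OF f] by blast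
  define C where "C = 4 * B\<^sup>2 + L\<^sup>2"
  have C: "C \<ge> 0" by (simp add: C_def)
  define k where "k t = ennreal (min 1 (t\<^sup>2) / t powr (real DIM('a) + 2 * s))" for t
  define K where "K = (\<integral>\<^sup>+x. k (norm x) \<partial>(lborel :: 'a measure))"
  have K: "K < \<infinity>" unfolding K_def k_def by (rule fractional_kernel_finite[OF s])
  have [measurable]: "k \<in> borel_measurable borel" unfolding k_def[abs_def] by measurable
  have [measurable]: "cball (0::'a) R \<in> sets borel" by simp
  have bnd: "\<bar>f x - f y\<bar>\<^sup>2 \<le> C * min 1 ((norm (x - y))\<^sup>2)" for x y
  proof -
    have "\<bar>f x - f y\<bar> \<le> 2 * B" using B(2)[of x] B(2)[of y] by linarith
    then have 1: "\<bar>f x - f y\<bar>\<^sup>2 \<le> (2 * B)\<^sup>2" by (rule power_mono) simp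
    have "\<bar>f x - f y\<bar> \<le> L * norm (x - y)"
      using test_fun_lipschitz[OF f L(2), of y "x - y"] by simp
    then have 2: "\<bar>f x - f y\<bar>\<^sup>2 \<le> (L * norm (x - y))\<^sup>2" by (rule power_mono) simp
    show ?thesis
    proof (cases "1 \<le> (norm (x - y))\<^sup>2")
      case True
      have "(2 * B)\<^sup>2 \<le> C" by (simp add: C_def power_mult_distrib)
      with True 1 show ?thesis by (simp add: min_def)
    next
      case False
      have "(L * norm (x - y))\<^sup>2 \<le> C * (norm (x - y))\<^sup>2"
        unfolding power_mult_distrib by (intro mult_right_mono) (auto simp: C_def)
      with False 2 show ?thesis by (simp add: min_def)
    qed
  qed
  have le: "ennreal ((norm (gagliardo_quotient s f z))\<^sup>2) \<le>
     ennreal C * (indicator (cball 0 R) (fst z) * k (norm (fst z - snd z))) +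
     ennreal C * (indicator (cball 0 R) (snd z) * k (norm (fst z - snd z)))" for z
  proof (cases z)
    case (Pair x y)
    show ?thesis
    proof (cases "R < norm x \<and> R < norm y")
      case True
      then show ?thesis using R(2) by (simp add: Pair gagliardo_quotient_def)
    next
      case False
      have "(norm (gagliardo_quotient s f z))\<^sup>2 \<le> C * min 1 ((norm (x - y))\<^sup>2) / norm (x - y) powr (real DIM('a) + 2 * s)"
        unfolding Pair gagliardo_quotient_sq by (intro divide_right_mono bnd) auto
      then have "ennreal ((norm (gagliardo_quotient s f z))\<^sup>2) \<le> ennreal (C * (min 1 ((norm (x - y))\<^sup>2) / norm (x - y) powr (real DIM('a) + 2 * s)))"
        by (intro ennreal_leI) simp
      also have "\<dots> = ennreal C * k (norm (x - y))"
        unfolding k_def using C by (intro ennreal_mult) auto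
      finally have *: "ennreal ((norm (gagliardo_quotient s f z))\<^sup>2) \<le> ennreal C * k (norm (x - y))" .
      show ?thesis
      proof (cases "norm x \<le> R")
        case True
        then have "ennreal C * k (norm (x - y)) \<le> ennreal C * (indicator (cball 0 R) (fst z) * k (norm (fst z - snd z)))"
          by (simp add: Pair)
        with * show ?thesis by (meson add_increasing2 order_trans zero_le)
      next
        case F: False
        then have "norm y \<le> R" using False by auto
        then have "ennreal C * k (norm (x - y)) \<le> ennreal C * (indicator (cball 0 R) (snd z) * k (norm (fst z - snd z)))"
          by (simp add: Pair)
        with * show ?thesis by (meson add_increasing order_trans zero_le)
      qed
    qed
  qed
  have 1: "(\<integral>\<^sup>+z. indicator (cball 0 R) (fst z) * k (norm (fst z - snd z)) \<partial>(lborel \<Otimes>\<^sub>M (lborel :: 'a measure))) = emeasure lborel (cball (0::'a) R) * K"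
  proof -
    have "(\<integral>\<^sup>+z. indicator (cball 0 R) (fst z) * k (norm (fst z - snd z)) \<partial>(lborel \<Otimes>\<^sub>M (lborel :: 'a measure)))
       = (\<integral>\<^sup>+x. \<integral>\<^sup>+y. indicator (cball 0 R) x * k (norm (x - y)) \<partial>lborel \<partial>(lborel :: 'a measure))"
    proof -
      define g where "g z = indicator (cball 0 R) (fst z) * k (norm (fst z - snd z))" for z :: "'a \<times> 'a"
      have [measurable]: "g \<in> borel_measurable (lborel \<Otimes>\<^sub>M lborel)" unfolding g_def[abs_def] by measurable
      have "(\<integral>\<^sup>+z. g z \<partial>(lborel \<Otimes>\<^sub>M lborel)) = (\<integral>\<^sup>+x. \<integral>\<^sup>+y. g (x, y) \<partial>lborel \<partial>lborel)"
        by (rule lborel.nn_integral_fst[symmetric]) measurable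
      then show ?thesis unfolding g_def by (simp only: fst_conv snd_conv)
    qed
    also have "\<dots> = (\<integral>\<^sup>+x. K * indicator (cball 0 R) x \<partial>(lborel :: 'a measure))"
      by (intro nn_integral_cong, subst nn_integral_cmult) (auto simp: nn_integral_lborel_shift_norm K_def mult.commute)
    finally show ?thesis by (simp add: nn_integral_cmult_indicator mult.commute)
  qed
  have 2: "(\<integral>\<^sup>+z. indicator (cball 0 R) (snd z) * k (norm (fst z - snd z)) \<partial>(lborel \<Otimes>\<^sub>M (lborel :: 'a measure))) = emeasure lborel (cball (0::'a) R) * K"
  proof -
    have "(\<integral>\<^sup>+z. indicator (cball 0 R) (snd z) * k (norm (fst z - snd z)) \<partial>(lborel \<Otimes>\<^sub>M (lborel :: 'a measure)))
       = (\<integral>\<^sup>+y. \<integral>\<^sup>+x. indicator (cball 0 R) y * k (norm (x - y)) \<partial>lborel \<partial>(lborel :: 'a measure))"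
    proof -
      define g where "g z = indicator (cball 0 R) (snd z) * k (norm (fst z - snd z))" for z :: "'a \<times> 'a"
      have [measurable]: "g \<in> borel_measurable (lborel \<Otimes>\<^sub>M lborel)" unfolding g_def[abs_def] by measurable
      have "(\<integral>\<^sup>+z. g z \<partial>(lborel \<Otimes>\<^sub>M lborel)) = (\<integral>\<^sup>+y. \<integral>\<^sup>+x. g (x, y) \<partial>lborel \<partial>lborel)"
        by (rule lborel_pair.nn_integral_snd[symmetric]) measurable
      then show ?thesis unfolding g_def by (simp only: fst_conv snd_conv)
    qed
    also have "\<dots> = (\<integral>\<^sup>+y. \<integral>\<^sup>+x. indicator (cball 0 R) y * k (norm (y - x)) \<partial>lborel \<partial>(lborel :: 'a measure))"
      by (simp only: norm_minus_commute)
    also have "\<dots> = (\<integral>\<^sup>+x. K * indicator (cball 0 R) x \<partial>(lborel :: 'a measure))"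
      by (intro nn_integral_cong, subst nn_integral_cmult) (auto simp: nn_integral_lborel_shift_norm K_def mult.commute)
    finally show ?thesis by (simp add: nn_integral_cmult_indicator mult.commute)
  qed
  have "(\<integral>\<^sup>+z. ennreal ((norm (gagliardo_quotient s f z))\<^sup>2) \<partial>(lborel \<Otimes>\<^sub>M lborel)) \<le>
    (\<integral>\<^sup>+z. ennreal C * (indicator (cball 0 R) (fst z) * k (norm (fst z - snd z))) +
     ennreal C * (indicator (cball 0 R) (snd z) * k (norm (fst z - snd z))) \<partial>(lborel \<Otimes>\<^sub>M (lborel :: 'a measure)))"
    by (intro nn_integral_mono le)
  also have "\<dots> = ennreal C * (emeasure lborel (cball (0::'a) R) * K) + ennreal C * (emeasure lborel (cball (0::'a) R) * K)"
    unfolding 1[symmetric] 2[symmetric]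
    by (subst nn_integral_add) (auto simp: nn_integral_cmult 1 2)
  also have "\<dots> < \<infinity>"
    using K emeasure_lborel_cball_finite[of "0::'a" R] by (simp add: ennreal_mult_less_top)
  finally show ?thesis .
qed

lemma AE_lborel_pair_fst_snd:
  fixes P :: "'a::euclidean_space \<Rightarrow> bool"
  assumes "AE x in lborel. P x"
  shows "AE z in lborel \<Otimes>\<^sub>M lborel. P (fst z) \<and> P (snd z)"
proof -
  obtain N where N: "N \<in> null_sets lborel" "{x \<in> space lborel. \<not> P x} \<subseteq> N"
    using assms by (auto elim: AE_E simp: null_sets_def)
  have [measurable]: "N \<in> sets borel" using N(1) by auto
  have "N \<times> UNIV \<in> null_sets (lborel \<Otimes>\<^sub>M lborel)" "UNIV \<times> N \<in> null_sets (lborel \<Otimes>\<^sub>M (lborel :: 'a measure))"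
    using N(1) by (auto simp: null_sets_def lborel.emeasure_pair_measure_Times)
  then have "N \<times> UNIV \<union> UNIV \<times> N \<in> null_sets (lborel \<Otimes>\<^sub>M lborel)" by (rule null_sets.Un)
  then show ?thesis
    by (rule AE_I') (use N(2) in auto)
qed

section \<open>Passing to the limit in weak gradients\<close>

lemma tendsto_ennreal_0I:
  fixes f :: "'a \<Rightarrow> ennreal"
  assumes "\<And>e::real. e > 0 \<Longrightarrow> eventually (\<lambda>n. f n \<le> ennreal e) F"
  shows "(f \<longlongrightarrow> 0) F"
proof (rule order_tendstoI)
  fix a :: ennreal assume a: "0 < a"
  obtain e where e: "e > 0" "ennreal e < a"
  proof (cases a)
    case (real r)
    with a show ?thesis by (intro that[of "r / 2"]) (auto simp: ennreal_less_iff)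
  next
    case top
    then show ?thesis by (intro that[of 1]) auto
  qed
  show "eventually (\<lambda>n. f n < a) F"
    using assms[OF e(1)] by eventually_elim (use e(2) in \<open>auto intro: le_less_trans\<close>)
qed auto

lemma tendsto_ennreal_0D:
  fixes f :: "'a \<Rightarrow> ennreal"
  assumes "(f \<longlongrightarrow> 0) F" "e > 0"
  shows "eventually (\<lambda>n. f n \<le> ennreal e) F"
  using order_tendstoD(2)[OF assms(1), of "ennreal e"] assms(2)
  by (auto elim: eventually_mono)

lemma le_add_powr:
  fixes y \<epsilon> q :: real
  assumes "0 \<le> y" "0 < \<epsilon>" "1 \<le> q"
  shows "y \<le> \<epsilon> + \<epsilon> powr (1 - q) * y powr q"
proof (cases "y \<le> \<epsilon>")
  case False
  then have "y = y powr (1 - q) * y powr q" using assms by (simp add: powr_add[symmetric])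
  also have "\<dots> \<le> \<epsilon> powr (1 - q) * y powr q"
    using False assms by (intro mult_right_mono powr_mono2') auto
  finally show ?thesis using assms by simp
qed (use assms in \<open>simp add: add_increasing2\<close>)

text \<open>If \<open>g n\<close> tends to zero in \<open>L\<^sup>q\<close>, then so does the integral of \<open>w * \<bar>g n\<bar>\<close> for a bounded integrable weight
  \<open>w\<close>, and this product bounds the distance of \<open>u n\<close> to \<open>U\<close>. Instead of Hoelder's inequality, \<open>y \<le> \<epsilon> + \<epsilon> powr (1 - q) * y powr q\<close> is used with small \<open>\<epsilon>\<close>.\<close>

lemma Lq_convergence_integral:
  fixes u :: "nat \<Rightarrow> 'a \<Rightarrow> 'b::{banach, second_countable_topology}"
  assumes int: "\<And>n. integrable M (u n)" and [measurable]: "U \<in> borel_measurable M"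
    and [measurable]: "\<And>n. g n \<in> borel_measurable M" "w \<in> borel_measurable M"
    and q: "q \<ge> 1"
    and lim: "(\<lambda>n. \<integral>\<^sup>+x. ennreal (\<bar>g n x\<bar> powr q) \<partial>M) \<longlonglongrightarrow> 0"
    and w: "\<And>x. 0 \<le> w x" "\<And>x. w x \<le> B" "(\<integral>\<^sup>+x. ennreal (w x) \<partial>M) < \<infinity>"
    and le: "\<And>n x. norm (u n x - U x) \<le> w x * \<bar>g n x\<bar>"
  shows "integrable M U" "(\<lambda>n. LINT x|M. u n x) \<longlonglongrightarrow> (LINT x|M. U x)"
proof -
  note [measurable] = borel_measurable_integrable[OF int]
  have B: "B \<ge> 0" using w(1,2) order_trans by blast
  obtain C where C: "(\<integral>\<^sup>+x. ennreal (w x) \<partial>M) = ennreal C" "C \<ge> 0"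
    using w(3) by (rule ennreal_less_top_E)
  have L1: "(\<lambda>n. \<integral>\<^sup>+x. ennreal (norm (u n x - U x)) \<partial>M) \<longlonglongrightarrow> 0"
  proof (rule tendsto_ennreal_0I)
    fix e :: real assume e: "e > 0"
    define \<epsilon> where "\<epsilon> = e / (2 * (C + 1))"
    define K where "K = B * \<epsilon> powr (1 - q)"
    have \<epsilon>: "\<epsilon> > 0" using e C by (simp add: \<epsilon>_def)
    have K: "K \<ge> 0" using B by (simp add: K_def)
    have \<epsilon>C: "\<epsilon> * C \<le> e / 2" using e C(2) by (simp add: \<epsilon>_def field_simps)
    have bound: "(\<integral>\<^sup>+x. ennreal (norm (u n x - U x)) \<partial>M) \<le>
        ennreal (e / 2) + ennreal K * (\<integral>\<^sup>+x. ennreal (\<bar>g n x\<bar> powr q) \<partial>M)" for n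
    proof -
      have "(\<integral>\<^sup>+x. ennreal (norm (u n x - U x)) \<partial>M) \<le>
         (\<integral>\<^sup>+x. ennreal \<epsilon> * ennreal (w x) + ennreal K * ennreal (\<bar>g n x\<bar> powr q) \<partial>M)"
      proof (intro nn_integral_mono)
        fix x
        have "norm (u n x - U x) \<le> w x * \<bar>g n x\<bar>" by (rule le)
        also have "\<dots> \<le> w x * (\<epsilon> + \<epsilon> powr (1 - q) * \<bar>g n x\<bar> powr q)"
          using w(1) q \<epsilon> by (intro mult_left_mono le_add_powr) auto
        also have "\<dots> = \<epsilon> * w x + w x * (\<epsilon> powr (1 - q) * \<bar>g n x\<bar> powr q)" by (simp add: algebra_simps)
        also have "\<dots> \<le> \<epsilon> * w x + B * (\<epsilon> powr (1 - q) * \<bar>g n x\<bar> powr q)"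
          using w(2) by (intro add_left_mono mult_right_mono) auto
        also have "\<dots> = \<epsilon> * w x + K * \<bar>g n x\<bar> powr q" by (simp add: K_def)
        finally have "ennreal (norm (u n x - U x)) \<le> ennreal (\<epsilon> * w x + K * \<bar>g n x\<bar> powr q)" by (rule ennreal_leI)
        also have "\<dots> = ennreal \<epsilon> * ennreal (w x) + ennreal K * ennreal (\<bar>g n x\<bar> powr q)"
          using \<epsilon> K w(1) by (simp add: ennreal_mult)
        finally show "ennreal (norm (u n x - U x)) \<le> ennreal \<epsilon> * ennreal (w x) + ennreal K * ennreal (\<bar>g n x\<bar> powr q)" .
      qed
      also have "\<dots> = ennreal \<epsilon> * ennreal C + ennreal K * (\<integral>\<^sup>+x. ennreal (\<bar>g n x\<bar> powr q) \<partial>M)"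
        by (simp add: nn_integral_add nn_integral_cmult C(1))
      also have "ennreal \<epsilon> * ennreal C \<le> ennreal (e / 2)"
        using \<epsilon> C(2) \<epsilon>C by (simp add: ennreal_mult[symmetric] ennreal_leI)
      finally show ?thesis by (simp add: add_right_mono)
    qed
    have "eventually (\<lambda>n. (\<integral>\<^sup>+x. ennreal (\<bar>g n x\<bar> powr q) \<partial>M) \<le> ennreal (e / (2 * (K + 1)))) sequentially"
      using e K by (intro tendsto_ennreal_0D[OF lim]) auto
    then show "eventually (\<lambda>n. (\<integral>\<^sup>+x. ennreal (norm (u n x - U x)) \<partial>M) \<le> ennreal e) sequentially"
    proof eventually_elim
      case (elim n)
      have "K * (e / (2 * (K + 1))) \<le> e / 2" using e K by (simp add: field_simps)
      then have "ennreal K * ennreal (e / (2 * (K + 1))) \<le> ennreal (e / 2)"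
        using e K by (simp add: ennreal_mult[symmetric] ennreal_leI)
      then have "ennreal K * (\<integral>\<^sup>+x. ennreal (\<bar>g n x\<bar> powr q) \<partial>M) \<le> ennreal (e / 2)"
        using mult_left_mono[OF elim, of "ennreal K"] by simp
      then have "(\<integral>\<^sup>+x. ennreal (norm (u n x - U x)) \<partial>M) \<le> ennreal (e / 2) + ennreal (e / 2)"
        using bound[of n] by (meson add_left_mono order_trans)
      then show ?case using e by (simp add: ennreal_plus[symmetric] del: ennreal_plus)
    qed
  qed
  obtain n where n: "(\<integral>\<^sup>+x. ennreal (norm (u n x - U x)) \<partial>M) \<le> ennreal 1"
    using tendsto_ennreal_0D[OF L1, of 1] eventually_happens[of _ sequentially] by auto
  have "integrable M (\<lambda>x. u n x - U x)"
  proof (rule integrableI_bounded)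
    have "ennreal 1 < \<infinity>" by simp
    with n show "(\<integral>\<^sup>+x. ennreal (norm (u n x - U x)) \<partial>M) < \<infinity>" by (rule le_less_trans)
  qed measurable
  then have "integrable M (\<lambda>x. u n x - (u n x - U x))"
    by (rule Bochner_Integration.integrable_diff[OF int])
  then show U: "integrable M U" by simp
  show "(\<lambda>n. LINT x|M. u n x) \<longlonglongrightarrow> (LINT x|M. U x)"
    by (rule tendsto_L1_int[OF int U L1])
qed

lemma locally_integrable_limit:
  fixes f :: "nat \<Rightarrow> 'a::euclidean_space \<Rightarrow> 'b::euclidean_space"
  assumes f: "\<And>n. continuous_on UNIV (f n)" and [measurable]: "F \<in> borel_measurable lebesgue"
    and q: "q \<ge> 1"
    and lim: "(\<lambda>n. \<integral>\<^sup>+x. ennreal (norm (f n x - F x) powr q) \<partial>lebesgue) \<longlonglongrightarrow> 0"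
  shows "locally_integrable F"
  unfolding locally_integrable_def
proof (intro allI impI)
  fix K :: "'a set" assume K: "compact K"
  then have Kb: "K \<in> sets borel" by (simp add: compact_imp_closed)
  then have [measurable]: "K \<in> sets lebesgue" by simp
  have [measurable]: "f n \<in> borel_measurable lebesgue" for n
    by (intro measurable_lebesgueI borel_measurable_continuous_onI f)
  have "integrable lebesgue (\<lambda>x. indicat_real K x *\<^sub>R F x)"
  proof (rule Lq_convergence_integral(1)[where q=q and B=1 and w="indicat_real K"])
    show "integrable lebesgue (\<lambda>x. indicat_real K x *\<^sub>R f n x)" for n
    proof -
      have "integrable lborel (\<lambda>x. indicat_real K x *\<^sub>R f n x)"
        by (rule borel_integrable_compact[OF K continuous_on_subset[OF f]]) simp
      then show ?thesis by (subst integrable_completion) auto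
    qed
    show "(\<lambda>n. \<integral>\<^sup>+x. ennreal (\<bar>norm (f n x - F x)\<bar> powr q) \<partial>lebesgue) \<longlonglongrightarrow> 0" using lim by simp
    show "(\<integral>\<^sup>+x. ennreal (indicat_real K x) \<partial>lebesgue) < \<infinity>"
      using emeasure_compact_finite[OF K] Kb by (simp add: ennreal_indicator nn_integral_completion)
    show "norm (indicat_real K x *\<^sub>R f n x - indicat_real K x *\<^sub>R F x) \<le> indicat_real K x * \<bar>norm (f n x - F x)\<bar>" for n x
      by (simp add: scaleR_diff_right[symmetric])
  qed (use q in \<open>auto simp: indicator_def\<close>)
  then show "set_integrable lebesgue K F" unfolding set_integrable_def .
qed

lemma powr_2_norm: "norm x powr 2 = (norm x)\<^sup>2"
  by (cases "x = 0") (auto simp: powr_numeral)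

text \<open>Weak gradients are closed under convergence of the functions in \<open>L\<^sup>q\<close> and of the gradients
  in \<open>L\<^sup>2\<close>.\<close>

lemma has_weak_grad_limit:
  fixes \<psi> :: "nat \<Rightarrow> 'a::euclidean_space \<Rightarrow> real"
  assumes \<psi>: "\<And>n. test_fun (\<psi> n)"
    and [measurable]: "v \<in> borel_measurable lebesgue" "H \<in> borel_measurable lebesgue"
    and q: "q \<ge> 1"
    and lim1: "(\<lambda>n. \<integral>\<^sup>+x. ennreal (\<bar>\<psi> n x - v x\<bar> powr q) \<partial>lebesgue) \<longlonglongrightarrow> 0"
    and lim2: "(\<lambda>n. \<integral>\<^sup>+x. ennreal ((norm (grad (\<psi> n) x - H x))\<^sup>2) \<partial>lebesgue) \<longlonglongrightarrow> 0"
  shows "has_weak_grad v H"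
  unfolding has_weak_grad_def
proof (intro conjI allI impI)
  have lim2': "(\<lambda>n. \<integral>\<^sup>+x. ennreal (norm (grad (\<psi> n) x - H x) powr 2) \<partial>lebesgue) \<longlonglongrightarrow> 0"
    using lim2 by (simp only: powr_2_norm)
  show "locally_integrable v"
    by (rule locally_integrable_limit[OF test_fun_continuous[OF \<psi>] _ q]) (use lim1 in auto)
  show "locally_integrable H"
    by (rule locally_integrable_limit[OF test_fun_grad_continuous[OF \<psi>] _ _ lim2']) auto
  fix \<phi> :: "'a \<Rightarrow> real" assume \<phi>: "test_fun \<phi>"
  obtain R where R: "R > 0" "\<And>x. R < norm x \<Longrightarrow> \<phi> x = 0" "\<And>x. R < norm x \<Longrightarrow> grad \<phi> x = 0"
    using test_fun_support[OF \<phi>] by blast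
  obtain B where B: "B > 0" "\<And>x. \<bar>\<phi> x\<bar> \<le> B" using test_fun_bounded[OF \<phi>] by blast
  obtain L where L: "L > 0" "\<And>x. norm (grad \<phi> x) \<le> L" using test_fun_grad_bounded[OF \<phi>] by blast
  note mb[measurable] = test_fun_borel[OF \<phi>] test_fun_grad_borel[OF \<phi>] test_fun_borel[OF \<psi>] test_fun_grad_borel[OF \<psi>]
  note [measurable] = mb[THEN measurable_lebesgueI]
  have 1: "(\<lambda>n. LINT x|lebesgue. \<psi> n x *\<^sub>R grad \<phi> x) \<longlonglongrightarrow> (LINT x|lebesgue. v x *\<^sub>R grad \<phi> x)"
  proof (rule Lq_convergence_integral(2)[OF _ _ _ _ q lim1, where w="\<lambda>x. norm (grad \<phi> x)" and B=L])
    show "integrable lebesgue (\<lambda>x. \<psi> n x *\<^sub>R grad \<phi> x)" for n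
    proof -
      have "integrable lborel (\<lambda>x. \<psi> n x *\<^sub>R grad \<phi> x)"
      proof (rule integrable_compact_support)
        show "continuous_on UNIV (\<lambda>x. \<psi> n x *\<^sub>R grad \<phi> x)"
          by (rule continuous_on_scaleR[OF test_fun_continuous[OF \<psi>] test_fun_grad_continuous[OF \<phi>]])
        show "\<psi> n x *\<^sub>R grad \<phi> x = 0" if "R < norm x" for x using R(3)[OF that] by simp
      qed
      then show ?thesis by (subst integrable_completion) auto
    qed
    have "integrable lborel (grad \<phi>)"
      by (rule integrable_compact_support[OF test_fun_grad_continuous[OF \<phi>] R(3)])
    then show "(\<integral>\<^sup>+x. ennreal (norm (grad \<phi> x)) \<partial>lebesgue) < \<infinity>"
      by (simp add: integrable_iff_bounded nn_integral_completion)
    show "norm (\<psi> n x *\<^sub>R grad \<phi> x - v x *\<^sub>R grad \<phi> x) \<le> norm (grad \<phi> x) * \<bar>\<psi> n x - v x\<bar>" for n x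
      by (simp add: scaleR_diff_left[symmetric] mult.commute)
  qed (use L in auto)
  have 2: "(\<lambda>n. LINT x|lebesgue. \<phi> x *\<^sub>R grad (\<psi> n) x) \<longlonglongrightarrow> (LINT x|lebesgue. \<phi> x *\<^sub>R H x)"
  proof (rule Lq_convergence_integral(2)[where g="\<lambda>n x. norm (grad (\<psi> n) x - H x)" and q=2 and w="\<lambda>x. \<bar>\<phi> x\<bar>" and B=B])
    show "(\<lambda>n. \<integral>\<^sup>+x. ennreal (\<bar>norm (grad (\<psi> n) x - H x)\<bar> powr 2) \<partial>lebesgue) \<longlonglongrightarrow> 0"
      using lim2' by simp
    show "integrable lebesgue (\<lambda>x. \<phi> x *\<^sub>R grad (\<psi> n) x)" for n
    proof -
      have "integrable lborel (\<lambda>x. \<phi> x *\<^sub>R grad (\<psi> n) x)"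
      proof (rule integrable_compact_support)
        show "continuous_on UNIV (\<lambda>x. \<phi> x *\<^sub>R grad (\<psi> n) x)"
          by (rule continuous_on_scaleR[OF test_fun_continuous[OF \<phi>] test_fun_grad_continuous[OF \<psi>]])
        show "\<phi> x *\<^sub>R grad (\<psi> n) x = 0" if "R < norm x" for x using R(2)[OF that] by simp
      qed
      then show ?thesis by (subst integrable_completion) auto
    qed
    have "integrable lborel \<phi>"
      by (rule integrable_compact_support[OF test_fun_continuous[OF \<phi>] R(2)])
    then show "(\<integral>\<^sup>+x. ennreal \<bar>\<phi> x\<bar> \<partial>lebesgue) < \<infinity>"
      by (simp add: integrable_iff_bounded nn_integral_completion)
    show "norm (\<phi> x *\<^sub>R grad (\<psi> n) x - \<phi> x *\<^sub>R H x) \<le> \<bar>\<phi> x\<bar> * \<bar>norm (grad (\<psi> n) x - H x)\<bar>" for n x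
      by (simp add: scaleR_diff_right[symmetric])
  qed (use B in auto)
  have "(\<lambda>n. LINT x|lebesgue. \<psi> n x *\<^sub>R grad \<phi> x) \<longlonglongrightarrow> - (LINT x|lebesgue. \<phi> x *\<^sub>R H x)"
    unfolding test_fun_integration_by_parts[OF \<psi> \<phi>] by (rule tendsto_minus[OF 2])
  with 1 show "(LINT x|lebesgue. v x *\<^sub>R grad \<phi> x) = - (LINT x|lebesgue. \<phi> x *\<^sub>R H x)"
    by (rule LIMSEQ_unique)
qed

section \<open>Approximation of elements of the energy space\<close>

lemma gagliardo_quotient_diff:
  "gagliardo_quotient s (\<lambda>x. f x - g x) z = gagliardo_quotient s f z - gagliardo_quotient s g z"
  by (simp add: gagliardo_quotient_def diff_divide_distrib[symmetric] algebra_simps)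

text \<open>An element of the energy space is the limit of a sequence of test functions that, after passing to a
  subsequence, converges almost everywhere together with the gradients, and whose gradients and
  Gagliardo quotients are dominated by fixed square-integrable functions. The domination makes
  it possible to compose with nonlinear functions and pass to the limit.\<close>

lemma X_space_approx:
  fixes u :: "'a::euclidean_space \<Rightarrow> real"
  assumes u: "u \<in> X_space s" and s: "0 < s" "s < 1" and n3: "DIM('a) \<ge> 3"
  obtains \<psi> G W V where
    "\<And>k. test_fun (\<psi> k)"
    "(\<lambda>k. \<integral>\<^sup>+x. ennreal (\<bar>\<psi> k x - u x\<bar> powr crit_exp DIM('a) 1) \<partial>lebesgue) \<longlonglongrightarrow> 0"
    "AE x in lebesgue. (\<lambda>k. \<psi> k x) \<longlonglongrightarrow> u x"
    "G \<in> borel_measurable lebesgue" "W \<in> borel_measurable lebesgue" "(\<integral>\<^sup>+x. W x \<partial>lebesgue) < \<infinity>"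
    "AE x in lebesgue. (\<lambda>k. grad (\<psi> k) x) \<longlonglongrightarrow> G x"
    "AE x in lebesgue. \<forall>k. ennreal ((norm (grad (\<psi> k) x))\<^sup>2) \<le> W x"
    "V \<in> borel_measurable (lborel \<Otimes>\<^sub>M lborel)" "(\<integral>\<^sup>+z. V z \<partial>(lborel \<Otimes>\<^sub>M lborel)) < \<infinity>"
    "AE z in lborel \<Otimes>\<^sub>M lborel. \<forall>k. ennreal ((norm (gagliardo_quotient s (\<psi> k) z))\<^sup>2) \<le> V z"
proof -
  define p where "p = crit_exp DIM('a) 1"
  have p: "p > 0" using n3 by (simp add: p_def crit_exp_def)
  obtain \<phi> where um[measurable]: "u \<in> borel_measurable lebesgue" and \<phi>: "\<And>n. test_fun (\<phi> n)"
    and C: "\<forall>e>0. \<exists>M. \<forall>m\<ge>M. \<forall>n\<ge>M. X_norm_sq s (\<lambda>x. \<phi> m x - \<phi> n x) < ennreal e"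
    and L: "(\<lambda>n. \<integral>\<^sup>+x. ennreal (\<bar>\<phi> n x - u x\<bar> powr p) \<partial>lebesgue) \<longlonglongrightarrow> 0"
    using u unfolding X_space_def p_def by blast
  have "\<exists>M. \<forall>m\<ge>M. \<forall>n\<ge>M. X_norm_sq s (\<lambda>x. \<phi> m x - \<phi> n x) < ennreal ((1/8) ^ k)" for k :: nat
    using C by simp
  then obtain N1 where N1: "\<And>k m n. N1 k \<le> m \<Longrightarrow> N1 k \<le> n \<Longrightarrow> X_norm_sq s (\<lambda>x. \<phi> m x - \<phi> n x) < ennreal ((1/8) ^ k)"
    by metis
  have "\<exists>M. \<forall>n\<ge>M. (\<integral>\<^sup>+x. ennreal (\<bar>\<phi> n x - u x\<bar> powr p) \<partial>lebesgue) \<le> ennreal ((1/2) ^ k)" for k :: nat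
    using tendsto_ennreal_0D[OF L, of "(1/2) ^ k"] by (simp add: eventually_sequentially)
  then obtain N2 where N2: "\<And>k n. N2 k \<le> n \<Longrightarrow> (\<integral>\<^sup>+x. ennreal (\<bar>\<phi> n x - u x\<bar> powr p) \<partial>lebesgue) \<le> ennreal ((1/2) ^ k)"
    by metis
  \<comment> \<open>Partial sums give monotone indices that exceed both thresholds.\<close>
  define r where "r k = (\<Sum>i\<le>k. N1 i + N2 i)" for k
  have r: "N1 k + N2 k \<le> r k" "r k \<le> r (Suc k)" for k
    unfolding r_def by (auto intro: member_le_sum)
  define \<psi> where "\<psi> k = \<phi> (r k)" for k
  have \<psi>: "test_fun (\<psi> k)" for k unfolding \<psi>_def by (rule \<phi>)
  note mb[measurable] = test_fun_borel[OF \<psi>] test_fun_grad_borel[OF \<psi>]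
  note [measurable] = mb[THEN measurable_lebesgueI]
  have close: "(\<integral>\<^sup>+x. ennreal (\<bar>\<psi> k x - u x\<bar> powr p) \<partial>lebesgue) \<le> ennreal ((1/2) ^ k)" for k
    unfolding \<psi>_def using r(1)[of k] by (intro N2) simp
  have Lp: "(\<lambda>k. \<integral>\<^sup>+x. ennreal (\<bar>\<psi> k x - u x\<bar> powr p) \<partial>lebesgue) \<longlonglongrightarrow> 0"
  proof (rule tendsto_sandwich[OF _ _ tendsto_const])
    have "(\<lambda>k. ennreal ((1/2) ^ k)) \<longlonglongrightarrow> ennreal 0"
      by (intro tendsto_ennrealI LIMSEQ_power_zero) simp
    then show "(\<lambda>k. ennreal ((1/2) ^ k)) \<longlonglongrightarrow> 0" by simp
  qed (use close in auto)
  have AEu: "AE x in lebesgue. (\<lambda>k. \<psi> k x) \<longlonglongrightarrow> u x"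
  proof -
    have "AE x in lebesgue. (\<lambda>k. \<psi> k x - u x) \<longlonglongrightarrow> 0"
      by (rule fast_convergence_AE[OF _ p close]) measurable
    then show ?thesis by eventually_elim (simp add: LIM_zero_iff)
  qed
  have Xfast: "X_norm_sq s (\<lambda>x. \<psi> (Suc k) x - \<psi> k x) \<le> ennreal ((1/8) ^ k)" for k
  proof -
    have "N1 k \<le> r (Suc k)" "N1 k \<le> r k" using r(1)[of k] r(2)[of k] by auto
    then show ?thesis unfolding \<psi>_def by (rule less_imp_le[OF N1])
  qed
  have [measurable]: "(\<lambda>x. \<psi> (Suc k) x - \<psi> k x) \<in> borel_measurable borel" for k by measurable
  have Xeq: "X_norm_sq s (\<lambda>x. \<psi> (Suc k) x - \<psi> k x) =
      (\<integral>\<^sup>+x. ennreal ((norm (grad (\<psi> (Suc k)) x - grad (\<psi> k) x))\<^sup>2) \<partial>lebesgue) +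
      (\<integral>\<^sup>+z. ennreal ((norm (gagliardo_quotient s (\<psi> (Suc k)) z - gagliardo_quotient s (\<psi> k) z))\<^sup>2) \<partial>(lborel \<Otimes>\<^sub>M lborel))" for k
    by (subst X_norm_sq_eq) (auto simp: grad_diff[OF \<psi> \<psi>] gagliardo_quotient_diff)
  obtain W where W: "W \<in> borel_measurable lebesgue" "(\<integral>\<^sup>+x. W x \<partial>lebesgue) < \<infinity>"
    "AE x in lebesgue. convergent (\<lambda>k. grad (\<psi> k) x) \<and> (\<forall>k. ennreal ((norm (grad (\<psi> k) x))\<^sup>2) \<le> W x)"
  proof (rule fast_Cauchy_L2_dominated[of "\<lambda>k. grad (\<psi> k)" lebesgue])
    show "(\<integral>\<^sup>+x. ennreal ((norm (grad (\<psi> 0) x))\<^sup>2) \<partial>lebesgue) < \<infinity>"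
    proof -
      obtain R where R: "R > 0" "\<And>x. R < norm x \<Longrightarrow> \<psi> 0 x = 0" "\<And>x. R < norm x \<Longrightarrow> grad (\<psi> 0) x = 0"
        using test_fun_support[OF \<psi>] by blast
      have "integrable lborel (\<lambda>x. (norm (grad (\<psi> 0) x))\<^sup>2)"
        by (rule integrable_compact_support[where R=R])
           (use R(3) in \<open>auto intro!: continuous_on_power continuous_on_norm test_fun_grad_continuous \<psi>\<close>)
      then show ?thesis by (simp add: integrable_iff_bounded nn_integral_completion)
    qed
    show "(\<integral>\<^sup>+x. ennreal ((norm (grad (\<psi> (Suc k)) x - grad (\<psi> k) x))\<^sup>2) \<partial>lebesgue) \<le> ennreal ((1/8) ^ k)" for k
      using Xfast[of k] unfolding Xeq by (rule order_trans[rotated]) simp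
  qed auto
  obtain V where V: "V \<in> borel_measurable (lborel \<Otimes>\<^sub>M lborel)" "(\<integral>\<^sup>+z. V z \<partial>(lborel \<Otimes>\<^sub>M lborel)) < \<infinity>"
    "AE z in lborel \<Otimes>\<^sub>M lborel. convergent (\<lambda>k. gagliardo_quotient s (\<psi> k) z) \<and>
       (\<forall>k. ennreal ((norm (gagliardo_quotient s (\<psi> k) z))\<^sup>2) \<le> V z)"
  proof (rule fast_Cauchy_L2_dominated[of "\<lambda>k. gagliardo_quotient s (\<psi> k)" "lborel \<Otimes>\<^sub>M lborel"])
    show "gagliardo_quotient s (\<psi> k) \<in> borel_measurable (lborel \<Otimes>\<^sub>M lborel)" for k by measurable
    show "(\<integral>\<^sup>+z. ennreal ((norm (gagliardo_quotient s (\<psi> 0) z))\<^sup>2) \<partial>(lborel \<Otimes>\<^sub>M lborel)) < \<infinity>"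
      by (rule test_fun_gagliardo_finite[OF \<psi> s])
    show "(\<integral>\<^sup>+z. ennreal ((norm (gagliardo_quotient s (\<psi> (Suc k)) z - gagliardo_quotient s (\<psi> k) z))\<^sup>2) \<partial>(lborel \<Otimes>\<^sub>M lborel)) \<le> ennreal ((1/8) ^ k)" for k
      using Xfast[of k] unfolding Xeq by (rule order_trans[rotated]) simp
  qed auto
  define G where "G x = lim (\<lambda>k. grad (\<psi> k) x)" for x
  have G: "G \<in> borel_measurable lebesgue" unfolding G_def[abs_def] by measurable
  show ?thesis
  proof (rule that[of \<psi> G W V])
    show "AE x in lebesgue. (\<lambda>k. grad (\<psi> k) x) \<longlonglongrightarrow> G x"
      using W(3) by eventually_elim (simp add: G_def convergent_LIMSEQ_iff)
    show "AE x in lebesgue. \<forall>k. ennreal ((norm (grad (\<psi> k) x))\<^sup>2) \<le> W x"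
      using W(3) by eventually_elim simp
    show "AE z in lborel \<Otimes>\<^sub>M lborel. \<forall>k. ennreal ((norm (gagliardo_quotient s (\<psi> k) z))\<^sup>2) \<le> V z"
      using V(3) by eventually_elim simp
  qed (use \<psi> Lp AEu G W V in \<open>auto simp: p_def\<close>)
qed

section \<open>Composition with smooth functions\<close>

lemma locally_integrable_measurable:
  fixes G :: "'a::euclidean_space \<Rightarrow> 'b::euclidean_space"
  assumes "locally_integrable G"
  shows "G \<in> borel_measurable lebesgue"
proof (rule borel_measurable_LIMSEQ_metric)
  show "(\<lambda>x. indicat_real (cball 0 (real n)) x *\<^sub>R G x) \<in> borel_measurable lebesgue" for n
    using assms compact_cball unfolding locally_integrable_def set_integrable_def
    by (blast intro: borel_measurable_integrable)
  show "(\<lambda>n. indicat_real (cball 0 (real n)) x *\<^sub>R G x) \<longlonglongrightarrow> G x" for x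
  proof (rule tendsto_eventually)
    obtain n0 where "norm x \<le> real n0" using real_arch_simple by blast
    then show "\<forall>\<^sub>F n in sequentially. indicat_real (cball 0 (real n)) x *\<^sub>R G x = G x"
      unfolding eventually_sequentially by (intro exI[of _ n0]) (auto simp: indicator_def)
  qed
qed

text \<open>The gradient obtained by choice agrees with any other weak gradient almost everywhere, once one exists.\<close>

lemma weak_grad_AE_eq:
  assumes "has_weak_grad u G"
  shows "AE x in lebesgue. weak_grad u x = G x" "weak_grad u \<in> borel_measurable lebesgue"
proof -
  have w: "has_weak_grad u (weak_grad u)"
    unfolding weak_grad_def using someI[of "has_weak_grad u" G] assms by simp
  show "AE x in lebesgue. weak_grad u x = G x" by (rule weak_grad_unique[OF w assms])
  from w show "weak_grad u \<in> borel_measurable lebesgue"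
    by (intro locally_integrable_measurable) (simp add: has_weak_grad_def)
qed

text \<open>The Sobolev inequality passes to the limit by Fatou's lemma.\<close>

lemma sobolev_limit:
  fixes \<theta> :: "nat \<Rightarrow> 'a::euclidean_space \<Rightarrow> real" and H :: "'a \<Rightarrow> 'a"
  assumes \<theta>: "\<And>k. test_fun (\<theta> k)" and n3: "DIM('a) \<ge> 3"
    and v: "AE x in lebesgue. (\<lambda>k. \<theta> k x) \<longlonglongrightarrow> v x"
    and D: "(\<lambda>k. \<integral>\<^sup>+x. ennreal ((norm (grad (\<theta> k) x))\<^sup>2) \<partial>lebesgue) \<longlonglongrightarrow> ennreal d" and d: "d \<ge> 0"
  shows "(\<integral>\<^sup>+x. ennreal (\<bar>v x\<bar> powr crit_exp DIM('a) 1) \<partial>lebesgue) ^ (DIM('a) - 2) \<le>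
    ennreal (sobolev_const DIM('a) * d ^ DIM('a))"
proof -
  define p where "p = crit_exp DIM('a) 1"
  have p: "p > 0" using n3 by (simp add: p_def crit_exp_def)
  define m where "m = DIM('a) - 2"
  have m: "m > 0" using n3 by (simp add: m_def)
  define S where "S = sobolev_const DIM('a)"
  have S: "S \<ge> 0" unfolding S_def sobolev_const_def by (simp add: power_mult)
  define I where "I k = (\<integral>\<^sup>+x. ennreal (\<bar>\<theta> k x\<bar> powr p) \<partial>lebesgue)" for k
  define Dk where "Dk k = (\<integral>\<^sup>+x. ennreal ((norm (grad (\<theta> k) x))\<^sup>2) \<partial>lebesgue)" for k
  note [measurable] = test_fun_borel[OF \<theta>, THEN measurable_lebesgueI]
  have sob: "I k ^ m \<le> ennreal S * Dk k ^ DIM('a)" for k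
    using sobolev_inequality[OF \<theta>[of k] n3]
    by (simp add: I_def Dk_def S_def p_def m_def nn_integral_completion)
  have lim: "(\<lambda>k. ennreal S * Dk k ^ DIM('a)) \<longlonglongrightarrow> ennreal (S * d ^ DIM('a))"
  proof -
    have fin: "eventually (\<lambda>k. Dk k < top) sequentially"
      using order_tendstoD(2)[OF D, of top] by (simp add: Dk_def)
    have "(\<lambda>k. enn2real (Dk k)) \<longlonglongrightarrow> d"
      using D d unfolding Dk_def[symmetric] by (intro tendsto_enn2real) auto
    then have "(\<lambda>k. ennreal (S * enn2real (Dk k) ^ DIM('a))) \<longlonglongrightarrow> ennreal (S * d ^ DIM('a))"
      by (intro tendsto_ennrealI tendsto_mult tendsto_const tendsto_power)
    moreover have "eventually (\<lambda>k. ennreal (S * enn2real (Dk k) ^ DIM('a)) = ennreal S * Dk k ^ DIM('a)) sequentially"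
      using fin by eventually_elim (use S in \<open>simp add: ennreal_mult ennreal_power[symmetric]\<close>)
    ultimately show ?thesis by (rule Lim_transform_eventually)
  qed
  have fatou: "(\<integral>\<^sup>+x. ennreal (\<bar>v x\<bar> powr p) \<partial>lebesgue) \<le> liminf I"
  proof -
    have "(\<integral>\<^sup>+x. ennreal (\<bar>v x\<bar> powr p) \<partial>lebesgue) = (\<integral>\<^sup>+x. liminf (\<lambda>k. ennreal (\<bar>\<theta> k x\<bar> powr p)) \<partial>lebesgue)"
    proof (rule nn_integral_cong_AE)
      show "AE x in lebesgue. ennreal (\<bar>v x\<bar> powr p) = liminf (\<lambda>k. ennreal (\<bar>\<theta> k x\<bar> powr p))"
        using v
      proof eventually_elim
        case (elim x)
        have "(\<lambda>k. ennreal (\<bar>\<theta> k x\<bar> powr p)) \<longlonglongrightarrow> ennreal (\<bar>v x\<bar> powr p)"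
          using p elim by (intro tendsto_ennrealI tendsto_powr2 tendsto_rabs tendsto_const) (auto simp: always_eventually)
        then show ?case by (rule lim_imp_Liminf[OF sequentially_bot, symmetric])
      qed
    qed
    also have "\<dots> \<le> liminf I" unfolding I_def by (rule nn_integral_liminf) measurable
    finally show ?thesis .
  qed
  have "(\<integral>\<^sup>+x. ennreal (\<bar>v x\<bar> powr p) \<partial>lebesgue) ^ m \<le> ennreal (S * d ^ DIM('a))"
  proof (rule ennreal_le_epsilon)
    fix e :: real assume e: "e > 0"
    define c where "c = S * d ^ DIM('a) + e"
    have c0: "S * d ^ DIM('a) \<ge> 0" using S d by simp
    then have c: "c > 0" using e by (simp add: c_def)
    have rc: "ennreal (root m c) ^ m = ennreal c"
      using c m by (simp add: ennreal_power real_root_pow_pos less_imp_le)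
    have "eventually (\<lambda>k. ennreal S * Dk k ^ DIM('a) < ennreal c) sequentially"
      using c0 e by (intro order_tendstoD(2)[OF lim]) (simp add: c_def ennreal_less_iff)
    then have "eventually (\<lambda>k. I k \<le> ennreal (root m c)) sequentially"
    proof eventually_elim
      case (elim k)
      then have "I k ^ m \<le> ennreal (root m c) ^ m"
        unfolding rc using sob[of k] by (meson le_less_trans less_imp_le)
      then show ?case by (rule ennreal_power_le_imp_le[OF _ m])
    qed
    then have "limsup I \<le> ennreal (root m c)" by (rule Limsup_bounded)
    then have "liminf I \<le> ennreal (root m c)" using Liminf_le_Limsup[of sequentially I] by simp
    then have "(\<integral>\<^sup>+x. ennreal (\<bar>v x\<bar> powr p) \<partial>lebesgue) ^ m \<le> ennreal (root m c) ^ m"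
      using fatou by (intro power_mono) auto
    also have "\<dots> = ennreal (S * d ^ DIM('a)) + ennreal e"
      unfolding rc using c0 e by (simp add: c_def ennreal_plus)
    finally show "(\<integral>\<^sup>+x. ennreal (\<bar>v x\<bar> powr p) \<partial>lebesgue) ^ m \<le> ennreal (S * d ^ DIM('a)) + ennreal e" .
  qed
  then show ?thesis by (simp add: p_def m_def S_def)
qed

text \<open>The chain rule: a smooth function with derivative bounded by one and fixing the origin maps the
  energy space to itself. The approximating test functions are composed with \<open>h\<close>; their gradients and
  Gagliardo quotients keep the dominating functions and converge almost everywhere, hence in \<open>L\<^sup>2\<close>.
  The Sobolev inequality is recorded for the composition as well.\<close>

lemma X_space_compose:
  fixes u :: "'a::euclidean_space \<Rightarrow> real"
  assumes u: "u \<in> X_space s" and s: "0 < s" "s < 1" and n3: "DIM('a) \<ge> 3"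
    and h: "smooth_real h" "h 0 = 0"
    and der: "\<And>t. (h has_real_derivative h' t) (at t)" and cont: "continuous_on UNIV h'"
    and bnd: "\<And>t. \<bar>h' t\<bar> \<le> 1"
  obtains G d where "G \<in> borel_measurable lebesgue" "(\<integral>\<^sup>+x. ennreal ((norm (G x))\<^sup>2) \<partial>lebesgue) < \<infinity>"
    "weak_grad u \<in> borel_measurable lebesgue"
    "AE x in lebesgue. weak_grad u x = G x"
    "(\<lambda>x. h (u x)) \<in> X_space s"
    "weak_grad (\<lambda>x. h (u x)) \<in> borel_measurable lebesgue"
    "AE x in lebesgue. weak_grad (\<lambda>x. h (u x)) x = h' (u x) *\<^sub>R G x"
    "d \<ge> 0" "(\<integral>\<^sup>+x. ennreal ((norm (h' (u x) *\<^sub>R G x))\<^sup>2) \<partial>lebesgue) = ennreal d"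
    "(\<integral>\<^sup>+x. ennreal (\<bar>h (u x)\<bar> powr crit_exp DIM('a) 1) \<partial>lebesgue) ^ (DIM('a) - 2) \<le>
      ennreal (sobolev_const DIM('a) * d ^ DIM('a))"
proof -
  define p where "p = crit_exp DIM('a) 1"
  have p1: "p \<ge> 1" using n3 by (simp add: p_def crit_exp_def field_simps)
  have um[measurable]: "u \<in> borel_measurable lebesgue" using u by (simp add: X_space_def)
  obtain \<psi> G W V where \<psi>: "\<And>k. test_fun (\<psi> k)"
    and Lp: "(\<lambda>k. \<integral>\<^sup>+x. ennreal (\<bar>\<psi> k x - u x\<bar> powr p) \<partial>lebesgue) \<longlonglongrightarrow> 0"
    and AEu: "AE x in lebesgue. (\<lambda>k. \<psi> k x) \<longlonglongrightarrow> u x"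
    and G[measurable]: "G \<in> borel_measurable lebesgue" and W[measurable]: "W \<in> borel_measurable lebesgue"
    and Wfin: "(\<integral>\<^sup>+x. W x \<partial>lebesgue) < \<infinity>"
    and AEG: "AE x in lebesgue. (\<lambda>k. grad (\<psi> k) x) \<longlonglongrightarrow> G x"
    and AEW: "AE x in lebesgue. \<forall>k. ennreal ((norm (grad (\<psi> k) x))\<^sup>2) \<le> W x"
    and V[measurable]: "V \<in> borel_measurable (lborel \<Otimes>\<^sub>M lborel)" and Vfin: "(\<integral>\<^sup>+z. V z \<partial>(lborel \<Otimes>\<^sub>M lborel)) < \<infinity>"
    and AEV: "AE z in lborel \<Otimes>\<^sub>M lborel. \<forall>k. ennreal ((norm (gagliardo_quotient s (\<psi> k) z))\<^sup>2) \<le> V z"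
    by (rule X_space_approx[OF u s n3, folded p_def]) (rule that; assumption)
  define \<theta> where "\<theta> k x = h (\<psi> k x)" for k x
  have \<theta>: "test_fun (\<theta> k)" for k
    unfolding \<theta>_def[abs_def] by (rule test_fun_compose[OF h \<psi>])
  have grad_\<theta>: "grad (\<theta> k) x = h' (\<psi> k x) *\<^sub>R grad (\<psi> k) x" for k x
    unfolding \<theta>_def[abs_def] by (rule grad_compose[OF der \<psi>])
  note mb[measurable] = test_fun_borel[OF \<psi>] test_fun_grad_borel[OF \<psi>] test_fun_borel[OF \<theta>] test_fun_grad_borel[OF \<theta>]
  note [measurable] = mb[THEN measurable_lebesgueI]
  have hcont: "continuous_on UNIV h"
    using der by (meson DERIV_continuous_on has_field_derivative_at_within)
  have [measurable]: "h \<in> borel_measurable borel" "h' \<in> borel_measurable borel"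
    using hcont cont by (auto intro: borel_measurable_continuous_onI)
  have lip: "\<bar>h a - h b\<bar> \<le> \<bar>a - b\<bar>" for a b
    using field_differentiable_bound[of UNIV h h' 1 a b] der bnd by simp
  define H where "H x = h' (u x) *\<^sub>R G x" for x
  have [measurable]: "H \<in> borel_measurable lebesgue" unfolding H_def[abs_def] by measurable
  have Lp\<theta>: "(\<lambda>k. \<integral>\<^sup>+x. ennreal (\<bar>\<theta> k x - h (u x)\<bar> powr p) \<partial>lebesgue) \<longlonglongrightarrow> 0"
  proof (rule tendsto_sandwich[OF _ _ tendsto_const Lp])
    show "\<forall>\<^sub>F k in sequentially. (\<integral>\<^sup>+x. ennreal (\<bar>\<theta> k x - h (u x)\<bar> powr p) \<partial>lebesgue)
        \<le> (\<integral>\<^sup>+x. ennreal (\<bar>\<psi> k x - u x\<bar> powr p) \<partial>lebesgue)"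
      unfolding \<theta>_def using p1 by (intro always_eventually allI nn_integral_mono ennreal_leI powr_mono2 lip) auto
  qed simp
  have AE\<theta>: "AE x in lebesgue. (\<lambda>k. \<theta> k x) \<longlonglongrightarrow> h (u x)"
    using AEu
  proof eventually_elim
    case (elim x)
    show ?case unfolding \<theta>_def
      by (rule continuous_on_tendsto_compose[OF hcont elim]) auto
  qed
  have AEH: "AE x in lebesgue. (\<lambda>k. grad (\<theta> k) x) \<longlonglongrightarrow> H x"
    using AEu AEG
  proof eventually_elim
    case (elim x)
    have "(\<lambda>k. h' (\<psi> k x)) \<longlonglongrightarrow> h' (u x)"
      by (rule continuous_on_tendsto_compose[OF cont elim(1)]) auto
    then show ?case unfolding grad_\<theta> H_def by (intro tendsto_scaleR elim(2))
  qed
  have AEW\<theta>: "AE x in lebesgue. \<forall>k. ennreal ((norm (grad (\<theta> k) x))\<^sup>2) \<le> W x"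
    using AEW
  proof eventually_elim
    case (elim x)
    show ?case
    proof
      fix k
      have "norm (grad (\<theta> k) x) \<le> 1 * norm (grad (\<psi> k) x)"
        unfolding grad_\<theta> norm_scaleR using bnd by (intro mult_right_mono) auto
      then have "ennreal ((norm (grad (\<theta> k) x))\<^sup>2) \<le> ennreal ((norm (grad (\<psi> k) x))\<^sup>2)"
        by (intro ennreal_leI power_mono) auto
      then show "ennreal ((norm (grad (\<theta> k) x))\<^sup>2) \<le> W x" using elim by (meson order_trans)
    qed
  qed
  have gradG: "(\<lambda>k. \<integral>\<^sup>+x. ennreal ((norm (grad (\<psi> k) x - G x))\<^sup>2) \<partial>lebesgue) \<longlonglongrightarrow> 0"
    and GW: "AE x in lebesgue. ennreal ((norm (G x))\<^sup>2) \<le> W x"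
    by (rule L2_dominated_convergence[where W=W and f="\<lambda>k. grad (\<psi> k)"]; use Wfin AEG AEW in auto)+
  have gradH: "(\<lambda>k. \<integral>\<^sup>+x. ennreal ((norm (grad (\<theta> k) x - H x))\<^sup>2) \<partial>lebesgue) \<longlonglongrightarrow> 0"
    and HW: "AE x in lebesgue. ennreal ((norm (H x))\<^sup>2) \<le> W x"
    by (rule L2_dominated_convergence[where W=W and f="\<lambda>k. grad (\<theta> k)"]; use Wfin AEH AEW\<theta> in auto)+
  define g where "g z = lim (\<lambda>k. gagliardo_quotient s (\<theta> k) z)" for z
  have [measurable]: "gagliardo_quotient s (\<theta> k) \<in> borel_measurable (lborel \<Otimes>\<^sub>M lborel)" for k by measurable
  have [measurable]: "g \<in> borel_measurable (lborel \<Otimes>\<^sub>M lborel)" unfolding g_def[abs_def] by measurable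
  have quot: "(\<lambda>k. \<integral>\<^sup>+z. ennreal ((norm (gagliardo_quotient s (\<theta> k) z - g z))\<^sup>2) \<partial>(lborel \<Otimes>\<^sub>M lborel)) \<longlonglongrightarrow> 0"
  proof (rule L2_dominated_convergence(1)[where W=V])
    show "AE z in lborel \<Otimes>\<^sub>M lborel. \<forall>k. ennreal ((norm (gagliardo_quotient s (\<theta> k) z))\<^sup>2) \<le> V z"
      using AEV
    proof eventually_elim
      case (elim z)
      show ?case
      proof
        fix k
        have "norm (gagliardo_quotient s (\<theta> k) z) \<le> norm (gagliardo_quotient s (\<psi> k) z)"
          unfolding gagliardo_quotient_def \<theta>_def by (simp add: divide_right_mono lip)
        then have "ennreal ((norm (gagliardo_quotient s (\<theta> k) z))\<^sup>2) \<le> ennreal ((norm (gagliardo_quotient s (\<psi> k) z))\<^sup>2)"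
          by (intro ennreal_leI power_mono) auto
        then show "ennreal ((norm (gagliardo_quotient s (\<theta> k) z))\<^sup>2) \<le> V z" using elim by (meson order_trans)
      qed
    qed
    have "AE x in lborel. (\<lambda>k. \<theta> k x) \<longlonglongrightarrow> h (u x)" using AE\<theta> by (simp add: AE_completion_iff)
    then have "AE z in lborel \<Otimes>\<^sub>M lborel. (\<lambda>k. \<theta> k (fst z)) \<longlonglongrightarrow> h (u (fst z)) \<and> (\<lambda>k. \<theta> k (snd z)) \<longlonglongrightarrow> h (u (snd z))"
      by (rule AE_lborel_pair_fst_snd)
    then show "AE z in lborel \<Otimes>\<^sub>M lborel. (\<lambda>k. gagliardo_quotient s (\<theta> k) z) \<longlonglongrightarrow> g z"
    proof eventually_elim
      case (elim z)
      have "(\<lambda>k. gagliardo_quotient s (\<theta> k) z) \<longlonglongrightarrow> gagliardo_quotient s (\<lambda>x. h (u x)) z"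
        unfolding gagliardo_quotient_def divide_inverse using elim by (intro tendsto_mult tendsto_diff tendsto_const) auto
      then show ?case unfolding g_def by (simp add: limI)
    qed
  qed (use Vfin in auto)
  have X: "(\<lambda>x. h (u x)) \<in> X_space s"
    unfolding X_space_def mem_Collect_eq
  proof (intro conjI exI[of _ \<theta>] allI impI)
    show "(\<lambda>x. h (u x)) \<in> borel_measurable lebesgue" by measurable
    show "test_fun (\<theta> k)" for k by (rule \<theta>)
    show "(\<lambda>k. \<integral>\<^sup>+x. ennreal (\<bar>\<theta> k x - h (u x)\<bar> powr crit_exp DIM('a) 1) \<partial>lebesgue) \<longlonglongrightarrow> 0"
      using Lp\<theta> by (simp add: p_def)
    fix e :: real assume e: "e > 0"
    define A where "A k = (\<integral>\<^sup>+x. ennreal ((norm (grad (\<theta> k) x - H x))\<^sup>2) \<partial>lebesgue)" for k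
    define B where "B k = (\<integral>\<^sup>+z. ennreal ((norm (gagliardo_quotient s (\<theta> k) z - g z))\<^sup>2) \<partial>(lborel \<Otimes>\<^sub>M lborel))" for k
    have "eventually (\<lambda>k. A k \<le> ennreal (e / 16) \<and> B k \<le> ennreal (e / 16)) sequentially"
      using tendsto_ennreal_0D[OF gradH, of "e / 16"] tendsto_ennreal_0D[OF quot, of "e / 16"] e
      unfolding A_def B_def by (intro eventually_conj) auto
    then obtain M where M: "\<And>k. k \<ge> M \<Longrightarrow> A k \<le> ennreal (e / 16)" "\<And>k. k \<ge> M \<Longrightarrow> B k \<le> ennreal (e / 16)"
      unfolding eventually_sequentially by blast
    show "\<exists>M. \<forall>m\<ge>M. \<forall>n\<ge>M. X_norm_sq s (\<lambda>x. \<theta> m x - \<theta> n x) < ennreal e"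
    proof (intro exI[of _ M] allI impI)
      fix m n assume mn: "m \<ge> M" "n \<ge> M"
      have "X_norm_sq s (\<lambda>x. \<theta> m x - \<theta> n x) =
        (\<integral>\<^sup>+x. ennreal ((norm (grad (\<theta> m) x - grad (\<theta> n) x))\<^sup>2) \<partial>lebesgue) +
        (\<integral>\<^sup>+z. ennreal ((norm (gagliardo_quotient s (\<theta> m) z - gagliardo_quotient s (\<theta> n) z))\<^sup>2) \<partial>(lborel \<Otimes>\<^sub>M lborel))"
        by (subst X_norm_sq_eq) (auto simp: grad_diff[OF \<theta> \<theta>] gagliardo_quotient_diff)
      also have "\<dots> \<le> (2 * A m + 2 * A n) + (2 * B m + 2 * B n)"
        unfolding A_def B_def by (intro add_mono nn_integral_norm_diff_sq_le) measurable
      also have "\<dots> \<le> (2 * ennreal (e / 16) + 2 * ennreal (e / 16)) + (2 * ennreal (e / 16) + 2 * ennreal (e / 16))"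
        using mn by (intro add_mono mult_left_mono M) auto
      also have "\<dots> = 8 * ennreal (e / 16)" by (simp add: distrib_right[symmetric])
      also have "\<dots> = ennreal (e / 2)" using e by (simp add: ennreal_mult[symmetric] flip: ennreal_numeral)
      also have "\<dots> < ennreal e" using e by (simp add: ennreal_less_iff)
      finally show "X_norm_sq s (\<lambda>x. \<theta> m x - \<theta> n x) < ennreal e" .
    qed
  qed
  have wu: "has_weak_grad u G"
    by (rule has_weak_grad_limit[OF \<psi> _ _ p1 Lp gradG]) auto
  have wh: "has_weak_grad (\<lambda>x. h (u x)) H"
    by (rule has_weak_grad_limit[OF \<theta> _ _ p1 Lp\<theta> gradH]) auto
  have Gfin: "(\<integral>\<^sup>+x. ennreal ((norm (G x))\<^sup>2) \<partial>lebesgue) < \<infinity>"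
    using nn_integral_mono_AE[OF GW] Wfin by (rule le_less_trans)
  have Hfin: "(\<integral>\<^sup>+x. ennreal ((norm (H x))\<^sup>2) \<partial>lebesgue) < \<infinity>"
    using nn_integral_mono_AE[OF HW] Wfin by (rule le_less_trans)
  obtain d where d: "(\<integral>\<^sup>+x. ennreal ((norm (H x))\<^sup>2) \<partial>lebesgue) = ennreal d" "d \<ge> 0"
    using Hfin by (rule ennreal_less_top_E)
  have "(\<lambda>k. \<integral>\<^sup>+x. ennreal ((norm (grad (\<theta> k) x))\<^sup>2) \<partial>lebesgue) \<longlonglongrightarrow> (\<integral>\<^sup>+x. ennreal ((norm (H x))\<^sup>2) \<partial>lebesgue)"
  proof (rule nn_integral_dominated_convergence[where w=W])
    show "AE x in lebesgue. (\<lambda>k. ennreal ((norm (grad (\<theta> k) x))\<^sup>2)) \<longlonglongrightarrow> ennreal ((norm (H x))\<^sup>2)"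
      using AEH by eventually_elim (intro tendsto_ennrealI tendsto_power tendsto_norm)
    show "AE x in lebesgue. ennreal ((norm (grad (\<theta> k) x))\<^sup>2) \<le> W x" for k
      using AEW\<theta> by eventually_elim simp
  qed (use Wfin in auto)
  then have "(\<integral>\<^sup>+x. ennreal (\<bar>h (u x)\<bar> powr crit_exp DIM('a) 1) \<partial>lebesgue) ^ (DIM('a) - 2) \<le>
      ennreal (sobolev_const DIM('a) * d ^ DIM('a))"
    unfolding d(1) by (intro sobolev_limit[OF \<theta> n3 AE\<theta> _ d(2)])
  then show ?thesis
    by (intro that[of G d]) (use G Gfin X d weak_grad_AE_eq[OF wu] weak_grad_AE_eq[OF wh] in \<open>auto simp: H_def[abs_def]\<close>)
qed

section \<open>Smooth truncations\<close>

text \<open>The function \<open>t * exp (-1/t)\<close> for \<open>t > 0\<close>, extended by zero. Its derivative is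
  \<open>(1 + 1/t) * exp (-1/t)\<close>, which lies in the unit interval because \<open>1 + x \<le> exp x\<close>.\<close>

lemma smooth_truncation_unit:
  obtains E E' :: "real \<Rightarrow> real" where "smooth_real E" "\<forall>t. (E has_real_derivative E' t) (at t)"
    "continuous_on UNIV E'" "\<forall>t. 0 \<le> E' t" "\<forall>t. E' t \<le> 1" "\<forall>t\<le>0. E t = 0"
    "\<forall>t\<ge>0. 0 \<le> E t" "\<forall>t\<ge>0. E t \<le> t" "\<forall>t\<ge>1. exp (- 1) * t \<le> E t"
proof -
  define E where "E t = t * exp_inv 1 t" for t
  define E' where "E' t = exp_inv 1 t + t * exp_inv ([:0,0,1:] * (1 - pderiv 1)) t" for t
  have sm: "smooth_real E" unfolding E_def[abs_def] by (intro smooth_real_mult_id smooth_exp_inv)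
  have D: "(E has_real_derivative E' t) (at t)" for t
    unfolding E_def[abs_def] E'_def
    using DERIV_mult[OF DERIV_ident exp_inv_DERIV[of 1 t]] by (simp add: mult.commute)
  have cont: "continuous_on UNIV E'"
    unfolding E'_def[abs_def]
    by (intro continuous_on_add continuous_on_mult continuous_on_id)
       (meson DERIV_continuous_on exp_inv_DERIV has_field_derivative_at_within)+
  have E'_pos: "E' t = (1 + 1 / t) * exp (- (1 / t))" if "t > 0" for t
    using that by (simp add: E'_def exp_inv_def field_simps)
  have E'_neg: "E' t = 0" if "t \<le> 0" for t
    using that by (simp add: E'_def exp_inv_def)
  show ?thesis
  proof (rule that[of E E'])
    show "\<forall>t. 0 \<le> E' t" by (metis E'_pos E'_neg not_le add_nonneg_nonneg divide_nonneg_pos exp_ge_zero mult_nonneg_nonneg order.refl zero_le_one)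
    have "E' t \<le> 1" for t
    proof (cases "t > 0")
      case True
      have "(1 + 1 / t) * exp (- (1 / t)) \<le> exp (1 / t) * exp (- (1 / t))"
        by (intro mult_right_mono) auto
      then show ?thesis using True by (simp add: E'_pos exp_minus)
    qed (simp add: E'_neg)
    then show "\<forall>t. E' t \<le> 1" by blast
    show "\<forall>t\<le>0. E t = 0" by (simp add: E_def exp_inv_def)
    show "\<forall>t\<ge>0. 0 \<le> E t" using exp_inv_1_bounds by (simp add: E_def)
    show "\<forall>t\<ge>0. E t \<le> t" using exp_inv_1_bounds by (simp add: E_def mult_left_le)
    show "\<forall>t\<ge>1. exp (- 1) * t \<le> E t"
    proof (intro allI impI)
      fix t :: real assume t: "1 \<le> t"
      have "exp (- 1) \<le> exp (- 1 / t)" using t by (simp add: field_simps)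
      then show "exp (- 1) * t \<le> E t" using t by (simp add: E_def exp_inv_def mult.commute)
    qed
  qed (use sm D cont in auto)
qed

text \<open>A smooth substitute for \<open>max 0 (t - b)\<close>, comparable to the positive part of \<open>t - c\<close> from below.\<close>

lemma smooth_truncation:
  fixes b c :: real
  assumes bc: "b < c"
  obtains h h' :: "real \<Rightarrow> real" where "smooth_real h" "\<forall>t. (h has_real_derivative h' t) (at t)"
    "continuous_on UNIV h'" "\<forall>t. 0 \<le> h' t" "\<forall>t. h' t \<le> 1" "\<forall>t\<le>b. h t = 0"
    "\<forall>t\<ge>b. 0 \<le> h t" "\<forall>t\<ge>b. h t \<le> t - b" "\<forall>t\<ge>c. exp (- 1) * (t - c) \<le> h t"
proof -
  obtain E E' :: "real \<Rightarrow> real" where E': "smooth_real E" "\<forall>t. (E has_real_derivative E' t) (at t)"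
    "continuous_on UNIV E'" "\<forall>t. 0 \<le> E' t" "\<forall>t. E' t \<le> 1" "\<forall>t\<le>0. E t = 0"
    "\<forall>t\<ge>0. 0 \<le> E t" "\<forall>t\<ge>0. E t \<le> t" "\<forall>t\<ge>1. exp (- 1) * t \<le> E t"
    by (rule smooth_truncation_unit)
  note E = E'[rule_format]
  define w where "w = c - b"
  have w: "w > 0" using bc by (simp add: w_def)
  define l where "l t = inverse w * t + (- b * inverse w)" for t
  have l: "l t = (t - b) / w" for t using w by (simp add: l_def divide_inverse algebra_simps)
  define h where "h t = w * E (l t)" for t
  define h' where "h' t = E' (l t)" for t
  show ?thesis
  proof (rule that[of h h'])
    show "smooth_real h"
      unfolding h_def[abs_def] l_def by (intro smooth_real_cmult smooth_real_affine E)
    show "\<forall>t. (h has_real_derivative h' t) (at t)"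
    proof
      fix t
      have "(l has_real_derivative inverse w) (at t)"
        unfolding l_def[abs_def] by (auto intro!: derivative_eq_intros)
      from DERIV_cmult[OF DERIV_chain2[OF E(2) this], of w]
      have "((\<lambda>t. w * E (l t)) has_real_derivative w * (E' (l t) * inverse w)) (at t)" .
      moreover have "w * (E' (l t) * inverse w) = E' (l t)" using w by simp
      ultimately show "(h has_real_derivative h' t) (at t)" by (simp only: h_def[abs_def] h'_def)
    qed
    have "continuous_on UNIV l" unfolding l_def[abs_def] by (intro continuous_intros)
    from continuous_on_compose2[OF E(3) this] show "continuous_on UNIV h'"
      by (simp add: h'_def[abs_def])
    show "\<forall>t. 0 \<le> h' t" "\<forall>t. h' t \<le> 1" using E(4,5) by (auto simp: h'_def)
    show "\<forall>t\<le>b. h t = 0"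
      using w E(6) by (simp add: h_def l divide_le_0_iff)
    show "\<forall>t\<ge>b. 0 \<le> h t"
      using w E(7) by (simp add: h_def l)
    show "\<forall>t\<ge>b. h t \<le> t - b"
    proof (intro allI impI)
      fix t assume t: "b \<le> t"
      have "w * E (l t) \<le> w * l t" using t w by (intro mult_left_mono E(8)) (auto simp: l)
      then show "h t \<le> t - b" using w by (simp add: h_def l)
    qed
    show "\<forall>t\<ge>c. exp (- 1) * (t - c) \<le> h t"
    proof (intro allI impI)
      fix t assume t: "c \<le> t"
      have "exp (- 1) * (t - c) \<le> exp (- 1) * (t - b)" using bc by (intro mult_left_mono) auto
      also have "\<dots> = w * (exp (- 1) * l t)" using w by (simp add: l)
      also have "\<dots> \<le> w * E (l t)"
        using t w by (intro mult_left_mono E(9)) (auto simp: l w_def)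
      finally show "exp (- 1) * (t - c) \<le> h t" by (simp add: h_def)
    qed
  qed
qed

section \<open>The energy estimate on level sets\<close>

text \<open>The integral of the positive part of \<open>u - a\<close> raised to the critical exponent.\<close>

definition level_excess :: "('a::euclidean_space \<Rightarrow> real) \<Rightarrow> real \<Rightarrow> ennreal" where
  "level_excess u a = (\<integral>\<^sup>+x. ennreal (max 0 (u x - a) powr crit_exp DIM('a) 1) \<partial>lebesgue)"

lemma crit_exp_mono:
  assumes "n \<ge> 3" "s \<le> 1"
  shows "crit_exp n s \<le> crit_exp n 1"
  unfolding crit_exp_def using assms by (intro divide_left_mono mult_pos_pos) auto

lemma crit_exp_pos: "n \<ge> 3 \<Longrightarrow> crit_exp n 1 > 0"
  by (simp add: crit_exp_def)

lemma level_excess_antimono: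
  assumes "a \<le> b" "DIM('a::euclidean_space) \<ge> 3"
  shows "level_excess (u :: 'a \<Rightarrow> real) b \<le> level_excess u a"
  unfolding level_excess_def
  using assms crit_exp_pos[of "DIM('a)"] by (intro nn_integral_mono ennreal_leI powr_mono2) auto

text \<open>For arguments above \<open>1\<close> the larger exponent dominates, so the growth of \<open>f\<close> is measured by the critical
  exponent alone. An argument \<open>t \<ge> b\<close> is comparable to its excess over \<open>a\<close>.\<close>

lemma growth_bound:
  assumes growth: "\<And>t. \<bar>f t * t\<bar> \<le> C * (\<bar>t\<bar> powr crit_exp n s + \<bar>t\<bar> powr crit_exp n 1)"
    and C: "C > 0" and n: "n \<ge> 3" and s: "s \<le> 1" and ab: "0 < a" "a < b" and t: "1 \<le> t" "b \<le> t"
  shows "\<bar>f t\<bar> * t \<le> 2 * C * (b / (b - a)) powr crit_exp n 1 * (t - a) powr crit_exp n 1"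
proof -
  define p where "p = crit_exp n 1"
  have p: "p > 0" unfolding p_def by (rule crit_exp_pos[OF n])
  have "\<bar>f t\<bar> * t = \<bar>f t * t\<bar>" using t by (simp add: abs_mult)
  also have "\<dots> \<le> C * (t powr crit_exp n s + t powr p)"
    using growth[of t] t by (simp add: p_def)
  also have "\<dots> \<le> C * (t powr p + t powr p)"
    using C t unfolding p_def by (intro mult_left_mono add_right_mono powr_mono crit_exp_mono n s) auto
  also have "\<dots> = 2 * C * t powr p" by simp
  also have "\<dots> \<le> 2 * C * ((b / (b - a)) * (t - a)) powr p"
  proof (intro mult_left_mono powr_mono2)
    have "a * b \<le> a * t" using ab t by (intro mult_left_mono) auto
    then show "t \<le> b / (b - a) * (t - a)" using ab by (simp add: field_simps)
  qed (use C t p in auto)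
  also have "\<dots> = 2 * C * (b / (b - a)) powr p * (t - a) powr p"
  proof -
    have "(b / (b - a) * (t - a)) powr p = (b / (b - a)) powr p * (t - a) powr p"
      by (subst powr_mult) (use ab t in auto)
    then show ?thesis by simp
  qed
  finally show ?thesis by (simp add: p_def)
qed

text \<open>The equation is tested with \<open>h (u)\<close>, where \<open>h\<close> is the smooth truncation between \<open>b\<close> and \<open>c\<close>. Since \<open>h\<close> is
  monotone, the nonlocal term has a sign and can be dropped. As \<open>0 \<le> h' \<le> 1\<close>, the squared gradient of
  \<open>h (u)\<close>, with factor \<open>h'\<^sup>2\<close>, is at most the local term of the equation, with factor \<open>h'\<close>. The values of \<open>f\<close> at
  arguments up to \<open>b\<close> do not matter, because \<open>h\<close> vanishes there. The power gained on the right,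
  \<open>DIM('a)\<close> against \<open>DIM('a) - 2\<close>, is what makes the iteration converge.\<close>

lemma level_excess_step:
  fixes u :: "'a::euclidean_space \<Rightarrow> real"
  assumes n3: "DIM('a) \<ge> 3" and s: "0 < s" "s < 1"
    and growth: "\<And>t. \<bar>f t * t\<bar> \<le> C * (\<bar>t\<bar> powr crit_exp DIM('a) s + \<bar>t\<bar> powr crit_exp DIM('a) 1)"
    and C: "C > 0" and sol: "is_solution s f u"
    and abc: "1 \<le> a" "a < b" "b < c" and fin: "level_excess u a = ennreal Y" "Y \<ge> 0"
  shows "level_excess u c ^ (DIM('a) - 2) \<le>
    ennreal (exp (crit_exp DIM('a) 1) ^ (DIM('a) - 2) * (sobolev_const DIM('a) *
      (2 * C * (b / (b - a)) powr crit_exp DIM('a) 1 * Y) ^ DIM('a)))"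
proof -
  define n where "n = DIM('a)"
  define p where "p = crit_exp n 1"
  define K where "K = 2 * C * (b / (b - a)) powr p"
  have K: "K \<ge> 0" using C by (simp add: K_def)
  have p: "p > 0" unfolding p_def using n3 by (intro crit_exp_pos) (simp add: n_def)
  have uX: "u \<in> X_space s" using sol by (simp add: is_solution_def)
  then have [measurable]: "u \<in> borel_measurable lebesgue" by (simp add: X_space_def)
  obtain h h' :: "real \<Rightarrow> real" where trunc: "smooth_real h" "\<forall>t. (h has_real_derivative h' t) (at t)"
    "continuous_on UNIV h'" "\<forall>t. 0 \<le> h' t" "\<forall>t. h' t \<le> 1" "\<forall>t\<le>b. h t = 0"
    "\<forall>t\<ge>b. 0 \<le> h t" "\<forall>t\<ge>b. h t \<le> t - b" "\<forall>t\<ge>c. exp (- 1) * (t - c) \<le> h t"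
    by (rule smooth_truncation[OF abc(3)])
  note h = trunc[rule_format]
  have h0: "h 0 = 0" using abc by (intro h(6)) simp
  have h'1: "\<bar>h' t\<bar> \<le> 1" for t using h(4,5)[of t] by simp
  have [measurable]: "h' \<in> borel_measurable borel" using h(3) by (rule borel_measurable_continuous_onI)
  have hmono: "h x \<le> h y" if "x \<le> y" for x y
    using that by (rule DERIV_nonneg_imp_nondecreasing) (use h(2,4) in blast)
  obtain G d where G[measurable]: "G \<in> borel_measurable lebesgue"
    and Gfin: "(\<integral>\<^sup>+x. ennreal ((norm (G x))\<^sup>2) \<partial>lebesgue) < \<infinity>"
    and [measurable]: "weak_grad u \<in> borel_measurable lebesgue"
    and wu: "AE x in lebesgue. weak_grad u x = G x"
    and hX: "(\<lambda>x. h (u x)) \<in> X_space s"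
    and [measurable]: "weak_grad (\<lambda>x. h (u x)) \<in> borel_measurable lebesgue"
    and wh: "AE x in lebesgue. weak_grad (\<lambda>x. h (u x)) x = h' (u x) *\<^sub>R G x"
    and d: "d \<ge> 0" "(\<integral>\<^sup>+x. ennreal ((norm (h' (u x) *\<^sub>R G x))\<^sup>2) \<partial>lebesgue) = ennreal d"
    and sob: "(\<integral>\<^sup>+x. ennreal (\<bar>h (u x)\<bar> powr crit_exp DIM('a) 1) \<partial>lebesgue) ^ (DIM('a) - 2) \<le>
      ennreal (sobolev_const DIM('a) * d ^ DIM('a))"
    by (rule X_space_compose[OF uX s n3 h(1) h0 h(2) h(3) h'1]) (rule that; assumption)
  have eq: "integrable lebesgue (\<lambda>x. f (u x) * h (u x))"
    "(LINT x|lebesgue. weak_grad u x \<bullet> weak_grad (\<lambda>x. h (u x)) x) + gagliardo_form s u (\<lambda>x. h (u x))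
          = (LINT x|lebesgue. f (u x) * h (u x))"
    using bspec[OF conjunct2[OF sol[unfolded is_solution_def]] hX] by simp_all
  have form: "gagliardo_form s u (\<lambda>x. h (u x)) \<ge> 0"
  proof -
    have "0 \<le> (u x - u y) * (h (u x) - h (u y)) / norm (x - y) powr (real DIM('a) + 2 * s)" for x y
    proof (intro divide_nonneg_nonneg)
      show "0 \<le> (u x - u y) * (h (u x) - h (u y))"
        using hmono[of "u x" "u y"] hmono[of "u y" "u x"]
        by (cases "u x \<le> u y") (auto simp: mult_nonpos_nonpos)
    qed simp
    then show ?thesis unfolding gagliardo_form_def by (intro integral_nonneg_AE AE_I2) auto
  qed
  \<comment> \<open>The function \<open>q\<close> below is the integrand \<open>h' (u) * \<bar>G\<bar>\<^sup>2\<close> of the local term.\<close>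
  have dle: "d \<le> (LINT x|lebesgue. weak_grad u x \<bullet> weak_grad (\<lambda>x. h (u x)) x)"
  proof -
    define q where "q x = h' (u x) * (norm (G x))\<^sup>2" for x
    have [measurable]: "q \<in> borel_measurable lebesgue" unfolding q_def[abs_def] by measurable
    have q0: "q x \<ge> 0" for x using h(4) by (simp add: q_def)
    have "integrable lebesgue (\<lambda>x. (norm (G x))\<^sup>2)"
      using Gfin by (intro integrableI_bounded) auto
    then have qi: "integrable lebesgue q"
      by (rule Bochner_Integration.integrable_bound)
         (use h(4,5) in \<open>auto simp: q_def abs_mult mult_left_le_one_le\<close>)
    have "ennreal d \<le> (\<integral>\<^sup>+x. ennreal (q x) \<partial>lebesgue)"
      unfolding d(2)[symmetric]
    proof (intro nn_integral_mono ennreal_leI)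
      fix x
      have "(norm (h' (u x) *\<^sub>R G x))\<^sup>2 = h' (u x) * q x"
        by (simp add: q_def power_mult_distrib power2_eq_square)
      also have "\<dots> \<le> 1 * q x" using q0 h(5) by (intro mult_right_mono)
      finally show "(norm (h' (u x) *\<^sub>R G x))\<^sup>2 \<le> q x" by simp
    qed
    also have "\<dots> = ennreal (LINT x|lebesgue. q x)" using qi q0 by (intro nn_integral_eq_integral) auto
    finally have "d \<le> (LINT x|lebesgue. q x)" using q0 by (simp add: integral_nonneg_AE)
    also have "\<dots> = (LINT x|lebesgue. weak_grad u x \<bullet> weak_grad (\<lambda>x. h (u x)) x)"
    proof (rule integral_cong_AE)
      show "AE x in lebesgue. q x = weak_grad u x \<bullet> weak_grad (\<lambda>x. h (u x)) x"
        using wu wh by eventually_elim (simp add: q_def power2_norm_eq_inner)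
    qed measurable
    finally show ?thesis .
  qed
  define e where "e x = max 0 (u x - a) powr p" for x
  have [measurable]: "e \<in> borel_measurable lebesgue" unfolding e_def[abs_def] by measurable
  have e_int: "(\<integral>\<^sup>+x. ennreal (e x) \<partial>lebesgue) = ennreal Y"
    using fin by (simp add: level_excess_def e_def p_def n_def)
  have ei: "integrable lebesgue e"
    using e_int by (intro integrableI_bounded) (auto simp: e_def)
  have eY: "(LINT x|lebesgue. e x) = Y"
  proof -
    have "e x \<ge> 0" for x by (simp add: e_def)
    then have "ennreal (LINT x|lebesgue. e x) = ennreal Y" "(LINT x|lebesgue. e x) \<ge> 0"
      using nn_integral_eq_integral[OF ei] e_int by (simp_all add: integral_nonneg_AE)
    then show ?thesis using fin(2) by simp
  qed
  have "(LINT x|lebesgue. f (u x) * h (u x)) \<le> (LINT x|lebesgue. K * e x)"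
  proof (rule Bochner_Integration.integral_mono)
    show "integrable lebesgue (\<lambda>x. K * e x)" using ei by simp
    fix x
    show "f (u x) * h (u x) \<le> K * e x"
    proof (cases "u x \<le> b")
      case True
      then show ?thesis using K by (simp add: h(6) e_def)
    next
      case False
      have "f (u x) * h (u x) \<le> \<bar>f (u x)\<bar> * u x"
      proof -
        have "0 \<le> h (u x)" "h (u x) \<le> u x" using False abc h(7)[of "u x"] h(8)[of "u x"] by auto
        then have "f (u x) * h (u x) \<le> \<bar>f (u x)\<bar> * h (u x)" "\<bar>f (u x)\<bar> * h (u x) \<le> \<bar>f (u x)\<bar> * u x"
          by (auto intro: mult_right_mono mult_left_mono)
        then show ?thesis by (rule order_trans)
      qed
      also have "\<dots> \<le> K * (u x - a) powr p"
        unfolding K_def p_def by (rule growth_bound[OF growth[folded n_def] C]) (use False abc s n3 in \<open>auto simp: n_def\<close>)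
      also have "\<dots> = K * e x" using False abc by (simp add: e_def)
      finally show ?thesis .
    qed
  qed (rule eq(1))
  then have dY: "d \<le> K * Y" using dle form eq(2) by (simp add: eY)
  have "level_excess u c \<le> (\<integral>\<^sup>+x. ennreal (exp p) * ennreal (\<bar>h (u x)\<bar> powr p) \<partial>lebesgue)"
    unfolding level_excess_def n_def[symmetric] p_def[symmetric]
  proof (intro nn_integral_mono)
    fix x
    have "max 0 (u x - c) powr p \<le> (exp 1 * \<bar>h (u x)\<bar>) powr p"
    proof (intro powr_mono2)
      show "max 0 (u x - c) \<le> exp 1 * \<bar>h (u x)\<bar>"
      proof (cases "c \<le> u x")
        case True
        have "exp 1 * (exp (- 1) * (u x - c)) \<le> exp 1 * \<bar>h (u x)\<bar>"
          using h(9)[OF True] by (intro mult_left_mono) auto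
        then show ?thesis using True by (simp add: mult.assoc[symmetric] exp_add[symmetric])
      qed (simp add: max_def)
    qed (use p in auto)
    also have "\<dots> = exp p * \<bar>h (u x)\<bar> powr p"
    proof -
      have "exp 1 powr p = exp p" by (simp add: powr_def)
      then show ?thesis by (subst powr_mult) auto
    qed
    finally show "ennreal (max 0 (u x - c) powr p) \<le> ennreal (exp p) * ennreal (\<bar>h (u x)\<bar> powr p)"
      by (simp add: ennreal_mult[symmetric] ennreal_leI)
  qed
  also have "\<dots> = ennreal (exp p) * (\<integral>\<^sup>+x. ennreal (\<bar>h (u x)\<bar> powr p) \<partial>lebesgue)"
  proof (rule nn_integral_cmult)
    have "h \<in> borel_measurable borel"
      using h(2) by (intro borel_measurable_continuous_onI) (meson DERIV_continuous_on has_field_derivative_at_within)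
    then show "(\<lambda>x. ennreal (\<bar>h (u x)\<bar> powr p)) \<in> borel_measurable lebesgue" by measurable
  qed
  finally have "level_excess u c ^ (n - 2) \<le> (ennreal (exp p) * (\<integral>\<^sup>+x. ennreal (\<bar>h (u x)\<bar> powr p) \<partial>lebesgue)) ^ (n - 2)"
    by (rule power_mono) simp
  also have "\<dots> = ennreal (exp p ^ (n - 2)) * (\<integral>\<^sup>+x. ennreal (\<bar>h (u x)\<bar> powr p) \<partial>lebesgue) ^ (n - 2)"
    by (simp add: power_mult_distrib ennreal_power)
  also have "\<dots> \<le> ennreal (exp p ^ (n - 2)) * ennreal (sobolev_const n * d ^ n)"
    using sob by (intro mult_left_mono) (auto simp: n_def p_def)
  also have "\<dots> \<le> ennreal (exp p ^ (n - 2)) * ennreal (sobolev_const n * (K * Y) ^ n)"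
    using d(1) dY by (intro mult_left_mono ennreal_leI power_mono) (auto simp: sobolev_const_def power_mult)
  also have "\<dots> = ennreal (exp p ^ (n - 2) * (sobolev_const n * (K * Y) ^ n))"
    by (rule ennreal_mult'[symmetric]) simp
  finally show ?thesis by (simp only: n_def p_def K_def)
qed

section \<open>De Giorgi iteration\<close>

text \<open>A sequence satisfying a superlinear recursion with geometrically growing coefficients tends to zero if
  it starts small enough: by induction it stays below \<open>\<delta> * r ^ j\<close> with \<open>\<rho> * r\<^sup>2 = 1\<close>.\<close>

lemma fast_geometric_decay:
  fixes K \<rho> :: real
  assumes K: "K \<ge> 0" and \<rho>: "\<rho> > 1" and m: "m > 0"
  obtains \<delta> where "\<delta> > 0"
    "\<forall>y. (\<forall>j::nat. 0 \<le> y j) \<longrightarrow> (\<forall>j. y (Suc j) ^ m \<le> K * \<rho> ^ j * y j ^ (m + 2)) \<longrightarrow> y 0 \<le> \<delta> \<longrightarrow> y \<longlonglongrightarrow> (0::real)"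
proof -
  define r where "r = 1 / sqrt \<rho>"
  have r: "0 < r" "r < 1" "\<rho> * r\<^sup>2 = 1" using \<rho> by (auto simp: r_def power_divide real_sqrt_gt_1_iff)
  define \<delta> where "\<delta> = sqrt (r ^ m / (K + 1))"
  have \<delta>: "\<delta> > 0" using K r by (simp add: \<delta>_def)
  have K\<delta>: "K * \<delta>\<^sup>2 \<le> r ^ m"
  proof -
    have "\<delta>\<^sup>2 = r ^ m / (K + 1)" using K r by (simp add: \<delta>_def)
    then have "\<delta>\<^sup>2 + K * \<delta>\<^sup>2 = r ^ m" using K by (simp add: field_simps)
    then show ?thesis using zero_le_power2[of \<delta>] by linarith
  qed
  show ?thesis
  proof (rule that[OF \<delta>], intro allI impI)
    fix y :: "nat \<Rightarrow> real"
    assume y0': "\<forall>j. 0 \<le> y j" and step': "\<forall>j. y (Suc j) ^ m \<le> K * \<rho> ^ j * y j ^ (m + 2)" and init: "y 0 \<le> \<delta>"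
    note y0 = y0'[rule_format] and step = step'[rule_format]
    have bound: "y j \<le> \<delta> * r ^ j" for j
    proof (induction j)
      case 0
      then show ?case using init by simp
    next
      case (Suc j)
      have "y (Suc j) ^ m \<le> K * \<rho> ^ j * y j ^ (m + 2)" by (rule step)
      also have "\<dots> \<le> K * \<rho> ^ j * (\<delta> * r ^ j) ^ (m + 2)"
        using K \<rho> Suc y0 by (intro mult_left_mono power_mono) auto
      also have "\<dots> = (K * \<delta>\<^sup>2) * (\<delta> * r ^ j) ^ m * (\<rho> * r\<^sup>2) ^ j"
      proof -
        have "(\<delta> * r ^ j) ^ (m + 2) = (\<delta> * r ^ j) ^ m * (\<delta>\<^sup>2 * (r\<^sup>2) ^ j)"
          unfolding power_add[of _ m 2] power_mult_distrib[of \<delta> _ 2]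
          by (simp add: power_mult[symmetric] mult.commute)
        then show ?thesis by (simp only: power_mult_distrib[of \<rho>] mult_ac)
      qed
      also have "\<dots> \<le> r ^ m * (\<delta> * r ^ j) ^ m * 1"
        using K\<delta> \<delta> r by (simp add: mult_right_mono)
      also have "\<dots> = (\<delta> * r ^ Suc j) ^ m" by (simp add: power_mult_distrib mult_ac)
      finally show ?case
        using power_mono_iff[of "y (Suc j)" "\<delta> * r ^ Suc j" m] y0 \<delta> r m by simp
    qed
    have "(\<lambda>j. \<delta> * r ^ j) \<longlonglongrightarrow> \<delta> * 0"
      using r by (intro tendsto_mult tendsto_const LIMSEQ_power_zero) auto
    then have lim: "(\<lambda>j. \<delta> * r ^ j) \<longlonglongrightarrow> 0" by simp
    show "y \<longlonglongrightarrow> 0"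
      by (rule tendsto_sandwich[OF _ _ tendsto_const lim]) (use y0 bound in auto)
  qed
qed

text \<open>Above a bound for a test function \<open>\<phi>\<close>, the excess of \<open>u\<close> is at most \<open>\<bar>\<phi> - u\<bar>\<close>; so approximation by
  test functions makes it small.\<close>

lemma level_excess_small:
  fixes u :: "'a::euclidean_space \<Rightarrow> real"
  assumes u: "u \<in> X_space s" and n3: "DIM('a) \<ge> 3" and \<delta>: "\<delta> > 0"
  obtains M where "M \<ge> 1" "level_excess u M \<le> ennreal \<delta>"
proof -
  obtain \<phi> where \<phi>: "\<And>n. test_fun (\<phi> n)"
    and L: "(\<lambda>n. \<integral>\<^sup>+x. ennreal (\<bar>\<phi> n x - u x\<bar> powr crit_exp DIM('a) 1) \<partial>lebesgue) \<longlonglongrightarrow> 0"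
    using u unfolding X_space_def by blast
  obtain n where n: "(\<integral>\<^sup>+x. ennreal (\<bar>\<phi> n x - u x\<bar> powr crit_exp DIM('a) 1) \<partial>lebesgue) \<le> ennreal \<delta>"
    using eventually_happens[OF tendsto_ennreal_0D[OF L \<delta>]] by auto
  obtain B where B: "B > 0" "\<And>x. \<bar>\<phi> n x\<bar> \<le> B" using test_fun_bounded[OF \<phi>] by blast
  show ?thesis
  proof (rule that[of "max 1 B"])
    have "level_excess u (max 1 B) \<le> (\<integral>\<^sup>+x. ennreal (\<bar>\<phi> n x - u x\<bar> powr crit_exp DIM('a) 1) \<partial>lebesgue)"
      unfolding level_excess_def
    proof (intro nn_integral_mono ennreal_leI powr_mono2)
      fix x
      show "max 0 (u x - max 1 B) \<le> \<bar>\<phi> n x - u x\<bar>" using B(2)[of x] by linarith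
    qed (use crit_exp_pos[OF n3] in auto)
    then show "level_excess u (max 1 B) \<le> ennreal \<delta>" using n by (rule order_trans)
  qed simp
qed

lemma solution_bounded_above:
  fixes u :: "'a::euclidean_space \<Rightarrow> real"
  assumes n3: "DIM('a) \<ge> 3" and s: "0 < s" "s < 1"
    and growth: "\<And>t. \<bar>f t * t\<bar> \<le> C * (\<bar>t\<bar> powr crit_exp DIM('a) s + \<bar>t\<bar> powr crit_exp DIM('a) 1)"
    and C: "C > 0" and sol: "is_solution s f u"
  shows "\<exists>M. AE x in lebesgue. u x \<le> M"
proof -
  define n where "n = DIM('a)"
  define m where "m = n - 2"
  have m: "m > 0" "n = m + 2" using n3 by (auto simp: m_def n_def)
  define p where "p = crit_exp n 1"
  have p: "p > 0" unfolding p_def using n3 by (intro crit_exp_pos) (simp add: n_def)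
  have uX: "u \<in> X_space s" using sol by (simp add: is_solution_def)
  then have [measurable]: "u \<in> borel_measurable lebesgue" by (simp add: X_space_def)
  define \<rho> where "\<rho> = (2 powr p) ^ n"
  define K where "K = exp p ^ m * (sobolev_const n * (2 * C * 8 powr p) ^ n)"
  have S: "sobolev_const n \<ge> 0" by (simp add: sobolev_const_def power_mult)
  have K: "K \<ge> 0" using S C by (simp add: K_def)
  have \<rho>: "\<rho> > 1" unfolding \<rho>_def using p m by (intro one_less_power) auto
  obtain \<delta> where \<delta>: "\<delta> > 0"
    and decay: "\<forall>y. (\<forall>j::nat. 0 \<le> y j) \<longrightarrow> (\<forall>j. y (Suc j) ^ m \<le> K * \<rho> ^ j * y j ^ (m + 2)) \<longrightarrow> y 0 \<le> \<delta> \<longrightarrow> y \<longlonglongrightarrow> (0::real)"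
    by (rule fast_geometric_decay[OF K \<rho> m(1)])
  obtain M where M: "M \<ge> 1" "level_excess u M \<le> ennreal \<delta>"
    by (rule level_excess_small[OF uX n3 \<delta>])
  \<comment> \<open>The levels increase from \<open>M\<close> to \<open>2 * M\<close>; consecutive ones differ by \<open>M * (1/2) ^ (j + 1)\<close>.\<close>
  define k where "k j = M * (2 - (1/2) ^ j)" for j
  have k: "M \<le> k j" "k j \<le> 2 * M" for j
    using M(1) by (auto simp: k_def power_le_one)
  have finite: "level_excess u a < \<infinity>" if "a \<ge> M" for a
  proof -
    have "level_excess u a \<le> ennreal \<delta>" using level_excess_antimono[OF that n3, of u] M(2) by (rule order_trans)
    then show ?thesis by (simp add: le_less_trans)
  qed
  define y where "y j = enn2real (level_excess u (k j))" for j
  have y: "level_excess u (k j) = ennreal (y j)" "y j \<ge> 0" for j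
    using finite[OF k(1), of j] by (auto simp: y_def)
  have step: "y (Suc j) ^ m \<le> K * \<rho> ^ j * y j ^ (m + 2)" for j
  proof -
    define b where "b = k j + M * (1/2) ^ (j + 2)"
    have kS: "k (Suc j) = k j + M * (1/2) ^ (j + 1)" by (simp add: k_def algebra_simps)
    have b1: "k j < b" using M(1) by (simp add: b_def)
    have b2: "b < k (Suc j)" using M(1) unfolding b_def kS by (simp add: power_add)
    have "b \<le> 2 * M" using b2 k(2)[of "Suc j"] by simp
    moreover have bk: "b - k j = M * (1/2) ^ (j + 2)" by (simp add: b_def)
    ultimately have "b / (b - k j) \<le> 2 * M / (M * (1/2) ^ (j + 2))"
      unfolding bk using M(1) by (intro divide_right_mono) auto
    also have "\<dots> = 8 * 2 ^ j" using M(1) by (simp add: power_add field_simps power_one_over)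
    finally have q: "b / (b - k j) \<le> 8 * 2 ^ j" .
    have "b > 0" using b1 k(1)[of j] M(1) by linarith
    then have q0: "0 \<le> b / (b - k j)" using b1 by simp
    have "level_excess u (k (Suc j)) ^ m \<le>
       ennreal (exp p ^ m * (sobolev_const n * (2 * C * (b / (b - k j)) powr p * y j) ^ n))"
      unfolding m_def n_def p_def
      using level_excess_step[OF n3 s growth C sol _ b1 b2 y] M(1) k(1)[of j] by simp
    then have "y (Suc j) ^ m \<le> exp p ^ m * (sobolev_const n * (2 * C * (b / (b - k j)) powr p * y j) ^ n)"
      unfolding y(1) using y(2) S C by (simp add: ennreal_power)
    also have "\<dots> \<le> exp p ^ m * (sobolev_const n * (2 * C * (8 * 2 ^ j) powr p * y j) ^ n)"
      using q q0 S C y(2) p by (intro mult_left_mono power_mono mult_right_mono powr_mono2) auto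
    also have "(8 * 2 ^ j) powr p = 8 powr p * (2 powr p) ^ j"
      by (simp add: powr_mult powr_realpow[symmetric] powr_powr mult.commute)
    also have "exp p ^ m * (sobolev_const n * (2 * C * (8 powr p * (2 powr p) ^ j) * y j) ^ n) = K * \<rho> ^ j * y j ^ n"
      unfolding K_def \<rho>_def by (simp add: power_mult_distrib power_mult[symmetric] mult_ac)
    finally show ?thesis unfolding m(2) .
  qed
  have "y 0 \<le> \<delta>"
  proof -
    have "ennreal (y 0) \<le> ennreal \<delta>" using M(2) y(1)[of 0] by (simp add: k_def)
    then show ?thesis using \<delta> by simp
  qed
  then have "y \<longlonglongrightarrow> 0" using decay y(2) step by blast
  then have "(\<lambda>j. ennreal (y j)) \<longlonglongrightarrow> ennreal 0" by (rule tendsto_ennrealI)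
  moreover have "level_excess u (2 * M) \<le> ennreal (y j)" for j
    unfolding y(1)[symmetric] by (rule level_excess_antimono[OF k(2) n3])
  ultimately have "level_excess u (2 * M) \<le> ennreal 0"
    by (intro LIMSEQ_le_const) auto
  then have "(\<integral>\<^sup>+x. ennreal (max 0 (u x - 2 * M) powr p) \<partial>lebesgue) = 0"
    by (simp add: level_excess_def p_def n_def)
  then have "AE x in lebesgue. ennreal (max 0 (u x - 2 * M) powr p) = 0"
    by (subst (asm) nn_integral_0_iff_AE) auto
  then have "AE x in lebesgue. u x \<le> 2 * M"
  proof eventually_elim
    case (elim x)
    then have "max 0 (u x - 2 * M) = 0" by (simp add: max_def ennreal_eq_0_iff)
    then show ?case by (simp add: max_def split: if_splits)
  qed
  then show ?thesis by blast
qed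

theorem theorem1p3:
  fixes s :: real and f :: "real \<Rightarrow> real" and u :: "real ^ 'n \<Rightarrow> real"
  assumes "CARD('n) \<ge> 3" and "0 < s" and "s < 1"
    and "\<exists>C>0. \<forall>t. \<bar>f t * t\<bar> \<le>
           C * (\<bar>t\<bar> powr crit_exp CARD('n) s + \<bar>t\<bar> powr crit_exp CARD('n) 1)"
    and "is_solution s f u"
    and "AE x in lebesgue. u x \<ge> 0"
  shows "u \<in> L_infinity"
proof -
  obtain C where C: "C > 0" "\<And>t. \<bar>f t * t\<bar> \<le>
      C * (\<bar>t\<bar> powr crit_exp DIM(real ^ 'n) s + \<bar>t\<bar> powr crit_exp DIM(real ^ 'n) 1)"
    using assms(4) by auto
  have "\<exists>M. AE x in lebesgue. u x \<le> M"
    by (rule solution_bounded_above[OF _ assms(2,3) C(2,1) assms(5)]) (use assms(1) in simp)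
  then obtain M where "AE x in lebesgue. u x \<le> M" by blast
  with assms(6) have "AE x in lebesgue. \<bar>u x\<bar> \<le> M" by eventually_elim simp
  then show ?thesis
    using assms(5) unfolding L_infinity_def is_solution_def X_space_def by blast
qed

end
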